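(* If $A$ is a set that is not $K$-trivial and $D$ is a non-computable set, then there exists a Martin-L\"of random set $R$ such that (1) $A\oplus R \equiv_T A\oplus D\oplus \emptyset'$; (2) $R \not\ge_T D$; (3) $R' \le_T A\oplus R$.
   Context: $K$ denotes prefix-free Kolmogorov complexity, with $K(n)=K(1^n)$. A set $A$ is $K$-trivial if there is a constant $c$ such that $K(A\upharpoonright n) \le K(n) + c$ for all $n$. A set $R$ is Martin-L\"of random if there is a constant $c$ such that $K(R\upharpoonright n) > n-c$ for all $n$. $R'$ denotes the Turing jump of $R$. *)

theory Defs
  imports Main "HOL-Library.Nat_Bijection" "HOL-Library.Sublist"
begin

section \<open>Oracle computation\<close>

text \<open>
  Programs denote unary partial functions on the natural numbers; several arguments are packed
  with \<^const>\<open>prod_encode\<close>. Together with an oracle \<open>A\<close> they generate exactly the partial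
  \<open>A\<close>-recursive functions (the identity is \<open>Pairing First Second\<close>).
\<close>

datatype prog =
    Zero | Succ | First | Second | Query
  | Pairing prog prog | Comp prog prog | PrimRec prog prog | Mu prog

text \<open>\<open>eval A p x y\<close>: program \<open>p\<close> with oracle \<open>A\<close> halts on input \<open>x\<close> with output \<open>y\<close>.\<close>

inductive eval :: "nat set \<Rightarrow> prog \<Rightarrow> nat \<Rightarrow> nat \<Rightarrow> bool" for A :: "nat set" where
  zero: "eval A Zero x 0"
| succ: "eval A Succ x (Suc x)"
| first: "eval A First (prod_encode (x, y)) x"
| second: "eval A Second (prod_encode (x, y)) y"
| query: "eval A Query x (of_bool (x \<in> A))"
| pairing: "eval A p x y \<Longrightarrow> eval A q x z \<Longrightarrow> eval A (Pairing p q) x (prod_encode (y, z))"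
| comp: "eval A q x y \<Longrightarrow> eval A p y z \<Longrightarrow> eval A (Comp p q) x z"
| primrec_0: "eval A p x y \<Longrightarrow> eval A (PrimRec p q) (prod_encode (x, 0)) y"
| primrec_Suc:
    "eval A (PrimRec p q) (prod_encode (x, n)) y \<Longrightarrow>
     eval A q (prod_encode (x, prod_encode (n, y))) z \<Longrightarrow>
     eval A (PrimRec p q) (prod_encode (x, Suc n)) z"
| mu:
    "eval A p (prod_encode (x, n)) 0 \<Longrightarrow>
     (\<And>m. m < n \<Longrightarrow> \<exists>y. eval A p (prod_encode (x, m)) (Suc y)) \<Longrightarrow>
     eval A (Mu p) x n"

lemma eval_deterministic:
  assumes "eval A p x y" and "eval A p x z"
  shows "y = z"
  using assms
proof (induction arbitrary: z rule: eval.induct)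
  case (pairing p x y q z')
  from pairing.prems pairing.IH show ?case by (auto elim: eval.cases)
next
  case (comp q x y p z')
  from comp.prems show ?case by cases (use comp.IH in blast)
next
  case (primrec_0 p x y q)
  from primrec_0.prems show ?case by cases (use primrec_0.IH in auto)
next
  case (primrec_Suc p q x n y z')
  from primrec_Suc.prems show ?case by cases (use primrec_Suc.IH in auto)
next
  case (mu p x n)
  from mu.prems show ?case
  proof cases
    case mu': mu
    show ?thesis
    proof (rule linorder_cases [of n z])
      assume "n < z"
      with mu'(2) obtain w where "eval A p (prod_encode (x, n)) (Suc w)" by blast
      with mu.IH(1) have "0 = Suc w" by blast
      then show ?thesis by simp
    next
      assume "z < n"
      with mu.IH(2) mu'(1) have "\<exists>w. Suc w = 0" by blast
      then show ?thesis by simp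
    qed
  qed
qed (auto elim: eval.cases)

subsection \<open>Turing reducibility, join and jump\<close>

definition turing_le :: "nat set \<Rightarrow> nat set \<Rightarrow> bool" (infix \<open>\<le>\<^sub>T\<close> 50) where
  "A \<le>\<^sub>T B \<longleftrightarrow> (\<exists>p. \<forall>n. eval B p n (of_bool (n \<in> A)))"

definition turing_equiv :: "nat set \<Rightarrow> nat set \<Rightarrow> bool" (infix \<open>\<equiv>\<^sub>T\<close> 50) where
  "A \<equiv>\<^sub>T B \<longleftrightarrow> A \<le>\<^sub>T B \<and> B \<le>\<^sub>T A"

definition computable_set :: "nat set \<Rightarrow> bool" where
  "computable_set A \<longleftrightarrow> A \<le>\<^sub>T {}"

definition join :: "nat set \<Rightarrow> nat set \<Rightarrow> nat set" (infixr \<open>\<oplus>\<close> 65) where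
  "A \<oplus> B = {2 * n | n. n \<in> A} \<union> {2 * n + 1 | n. n \<in> B}"

fun goedel :: "prog \<Rightarrow> nat" where
  "goedel Zero = 0"
| "goedel Succ = 1"
| "goedel First = 2"
| "goedel Second = 3"
| "goedel Query = 4"
| "goedel (Pairing p q) = 4 * prod_encode (goedel p, goedel q) + 5"
| "goedel (Comp p q) = 4 * prod_encode (goedel p, goedel q) + 6"
| "goedel (PrimRec p q) = 4 * prod_encode (goedel p, goedel q) + 7"
| "goedel (Mu p) = 4 * goedel p + 8"

lemma inj_goedel: "goedel p = goedel q \<Longrightarrow> p = q"
proof (induction p arbitrary: q)
  case Zero then show ?case by (cases q) auto
next
  case Succ then show ?case by (cases q) auto
next
  case First then show ?case by (cases q) auto
next
  case Second then show ?case by (cases q) auto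
next
  case Query then show ?case by (cases q) auto
next
  case (Pairing p1 p2) then show ?case by (cases q; (simp; presburger)?; auto)
next
  case (Comp p1 p2) then show ?case by (cases q; (simp; presburger)?; auto)
next
  case (PrimRec p1 p2) then show ?case by (cases q; (simp; presburger)?; auto)
next
  case (Mu p) then show ?case by (cases q; (simp; presburger)?; auto)
qed

lemma surj_goedel: "\<exists>p. goedel p = n"
proof (induction n rule: less_induct)
  case (less n)
  show ?case
  proof (cases "n < 5")
    case True
    then have "n = 0 \<or> n = 1 \<or> n = 2 \<or> n = 3 \<or> n = 4" by linarith
    then show ?thesis by (metis goedel.simps(1-5))
  next
    case False
    define m where "m = (n - 5) div 4"
    have n: "n = 4 * m + 5 \<or> n = 4 * m + 6 \<or> n = 4 * m + 7 \<or> n = 4 * m + 8"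
      using False unfolding m_def by presburger
    obtain a b where ab: "prod_encode (a, b) = m"
      by (metis prod_decode_inverse surj_pair)
    have "a \<le> m" "b \<le> m" "m < n"
      using ab n le_prod_encode_1 [of a b] le_prod_encode_2 [of b a] by auto
    with less.IH obtain p q r where "goedel p = a" "goedel q = b" "goedel r = m"
      by (meson le_less_trans)
    with n ab show ?thesis by (metis goedel.simps(6-9))
  qed
qed

text \<open>
  Since \<^const>\<open>goedel\<close> is a bijection, every number \<open>e\<close> is the index of exactly one program, and
  the jump is the set of all \<open>e\<close> such that the \<open>e\<close>-th program with oracle \<open>A\<close> halts on \<open>e\<close>.
\<close>

lemma bij_goedel: "bij goedel"
  unfolding bij_def inj_def surj_def by (metis inj_goedel surj_goedel)

definition jump :: "nat set \<Rightarrow> nat set" where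
  "jump A = {goedel p | p. \<exists>y. eval A p (goedel p) y}"

section \<open>Prefix-free Kolmogorov complexity\<close>

text \<open>Bijective base-2 notation, least significant digit first, with digits 1 and 2.\<close>

fun string_code :: "bool list \<Rightarrow> nat" where
  "string_code [] = 0"
| "string_code (b # s) = 2 * string_code s + (if b then 2 else 1)"

lemma bij_string_code: "bij string_code"
proof (rule bijI)
  have "string_code s = string_code t \<Longrightarrow> s = t" for s t
  proof (induction s arbitrary: t)
    case Nil then show ?case by (cases t) (auto split: if_splits)
  next
    case (Cons b s)
    then obtain c u where t: "t = c # u"
      by (cases t) (auto split: if_splits)
    from Cons.prems have "b = c \<and> string_code s = string_code u"
      unfolding t by (cases b; cases c; simp; presburger)
    with Cons.IH t show ?case by simp
  qed
  then show "inj string_code" by (simp add: inj_def)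
  have "\<exists>s. string_code s = n" for n
  proof (induction n rule: less_induct)
    case (less n)
    show ?case
    proof (cases "n = 0")
      case True then show ?thesis by (metis string_code.simps(1))
    next
      case False
      define m where "m = (n - 1) div 2"
      have n: "n = 2 * m + 1 \<or> n = 2 * m + 2" using False unfolding m_def by presburger
      then have "m < n" by linarith
      with less.IH obtain s where "string_code s = m" by blast
      with n have "string_code (False # s) = n \<or> string_code (True # s) = n" by auto
      then show ?thesis by blast
    qed
  qed
  then show "surj string_code" by (metis surjI)
qed

definition partial_computable :: "(bool list \<rightharpoonup> bool list) \<Rightarrow> bool" where
  "partial_computable M \<longleftrightarrow>
     (\<exists>p. \<forall>s t. M s = Some t \<longleftrightarrow> eval {} p (string_code s) (string_code t))"

definition prefix_free_machine :: "(bool list \<rightharpoonup> bool list) \<Rightarrow> bool" where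
  "prefix_free_machine M \<longleftrightarrow>
     partial_computable M \<and> (\<forall>s \<in> dom M. \<forall>t \<in> dom M. prefix s t \<longrightarrow> s = t)"

text \<open>
  Prefix-free complexity is taken relative to an optimal prefix-free machine. Optimality is
  the inequality \<open>K\<^sub>U \<le> K\<^sub>M + O(1)\<close> for every prefix-free machine \<open>M\<close>, spelled out on descriptions
  because some strings may have no \<open>M\<close>-description.
\<close>

definition optimal_machine :: "(bool list \<rightharpoonup> bool list) \<Rightarrow> bool" where
  "optimal_machine U \<longleftrightarrow>
     prefix_free_machine U \<and>
     (\<forall>M. prefix_free_machine M \<longrightarrow>
        (\<exists>d. \<forall>s t. M s = Some t \<longrightarrow> (\<exists>s'. U s' = Some t \<and> length s' \<le> length s + d)))"

text \<open>If \<open>U\<close> is optimal, then every string has a \<open>U\<close>-description, so the minimum exists.\<close>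

definition K :: "(bool list \<rightharpoonup> bool list) \<Rightarrow> bool list \<Rightarrow> nat" where
  "K U t = (LEAST n. \<exists>s. U s = Some t \<and> length s = n)"

definition initial_segment :: "nat set \<Rightarrow> nat \<Rightarrow> bool list" (infix \<open>\<restriction>\<close> 75) where
  "A \<restriction> n = map (\<lambda>i. i \<in> A) [0..<n]"

definition K_trivial :: "(bool list \<rightharpoonup> bool list) \<Rightarrow> nat set \<Rightarrow> bool" where
  "K_trivial U A \<longleftrightarrow> (\<exists>c. \<forall>n. K U (A \<restriction> n) \<le> K U (replicate n True) + c)"

text \<open>The bound \<open>K (R \<restriction> n) > n - c\<close>, rearranged to avoid truncated subtraction.\<close>

definition martin_loef_random :: "(bool list \<rightharpoonup> bool list) \<Rightarrow> nat set \<Rightarrow> bool" where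
  "martin_loef_random U R \<longleftrightarrow> (\<exists>c. \<forall>n. n < K U (R \<restriction> n) + c)"

end

theory Submission
  imports Defs Complex_Main "HOL-Library.FuncSet"
begin

text \<open>
  For each description of a number \<open>n\<close> by a string \<open>s\<close> consider the event that \<open>X\<close> has only ones on a
  block of \<open>length s + b\<close> positions reserved for the triple of \<open>A \<restriction> n\<close>, \<open>s\<close> and a witness of the
  description. These events are independent. If all of them missed some \<open>\<Pi>\<^sup>0\<^sub>1\<close> class of positive
  measure, then the computably enumerable set of all triples (for arbitrary strings in place of
  \<open>A \<restriction> n\<close>) missing the class would have finite weight, and the machine existence theorem would make
  \<open>A\<close> \<open>K\<close>-trivial. So some event meets each such class. As the measures of the events add up to at
  most \<open>2\<^sup>-\<^sup>b\<close>, finitely many of them can also be avoided, and the index of the first event that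
  contains \<open>R\<close> can be made arbitrarily large. This index is computable from \<open>A \<oplus> R\<close> and carries the coding.

  \<open>R\<close> is built by forcing with \<open>\<Pi>\<^sup>0\<^sub>1\<close> classes of random sets of positive measure, deciding the jump and
  avoiding computations of \<open>D\<close>. Lower bounds for the measures depend only on the coded
  indices, so \<open>A \<oplus> R\<close> finds the coding locations without knowing the classes. Each stage codes two
  indices. The first majorizes the halting time needed for one bit of the halting problem and a code
  of the current class; the second exceeds the largest unforced choice over all classes
  with smaller codes iff \<open>n \<in> D\<close>, and \<open>A \<oplus> jump {}\<close> computes that threshold.
\<close>

section \<open>Computable functions on encoded types\<close>

text \<open>The obstacle is that the reader \<open>A \<oplus> R\<close> must recover every index
  although it cannot know the constraints, which were chosen with the help of \<open>D\<close> and
  the halting problem. (1) An index is the least one valid for \<open>A\<close> whose block meets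
  the current thinned class. If the string chosen inside that block lay in the block of a smaller
  valid index too, its extensions would show that this smaller index meets the class; hence the
  reader sees the index as the first valid block that contains \<open>R\<close>. (2) The block
  lengths of the next index depend on a measure bound for the next class. Meeting a class only gives
  nonemptiness; thinning by \<open>star\<close> turns this into a bound that the reader can compute
  from the length of the string. (3) A class of measure at least 2^-k gets blocks with the extra
  length k + 1. Together they have measure at most 2^-(k+1), so avoiding finitely many of them costs
  at most half of the class. (4) Whether an index was forced to be large cannot be seen without the
  class. This is why a bit of \<open>D\<close> needs an earlier index that bounds the code of the
  class, and why \<open>D\<close> can be decoded only after the halting problem.\<close>

class enc =
  fixes enc :: "'a \<Rightarrow> nat" and dec :: "nat \<Rightarrow> 'a"
  assumes dec_enc [simp]: "dec (enc x) = x"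
    and computable_enc_dec: "\<exists>p. \<forall>n. eval {} p n (enc (dec n))"

lemma enc_eq_iff [simp]: "enc (x :: 'a::enc) = enc y \<longleftrightarrow> x = y"
  by (metis dec_enc)

fun subst_query :: "prog \<Rightarrow> prog \<Rightarrow> prog" where
  "subst_query r Zero = Zero"
| "subst_query r Succ = Succ"
| "subst_query r First = First"
| "subst_query r Second = Second"
| "subst_query r Query = r"
| "subst_query r (Pairing p q) = Pairing (subst_query r p) (subst_query r q)"
| "subst_query r (Comp p q) = Comp (subst_query r p) (subst_query r q)"
| "subst_query r (PrimRec p q) = PrimRec (subst_query r p) (subst_query r q)"
| "subst_query r (Mu p) = Mu (subst_query r p)"

text \<open>Each oracle question is replaced by a run of \<open>r\<close>; this is the transitivity
  of Turing reducibility on the level of programs.\<close>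

lemma eval_subst_query:
  assumes r: "\<And>n. eval B r n (of_bool (n \<in> A))"
  shows "eval A p x y \<Longrightarrow> eval B (subst_query r p) x y"
proof (induction rule: eval.induct)
  case (query x)
  show ?case using r by simp
next
  case (mu p x n)
  show ?case unfolding subst_query.simps
    by (rule eval.mu) (use mu.IH in auto)
qed (auto intro: eval.intros)

definition rec :: "nat set \<Rightarrow> ('a::enc \<Rightarrow> 'b::enc) \<Rightarrow> bool" where
  "rec A f \<longleftrightarrow> (\<exists>p. \<forall>x. eval A p (enc x) (enc (f x)))"

lemma recI: "(\<And>x. eval A p (enc x) (enc (f x))) \<Longrightarrow> rec A f"
  unfolding rec_def by blast

lemma rec_trans:
  assumes "rec A f" and "A \<le>\<^sub>T B"
  shows "rec B f"
  using assms eval_subst_query unfolding rec_def turing_le_def by metis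

lemma empty_turing_le: "{} \<le>\<^sub>T A"
  unfolding turing_le_def by (rule exI[of _ Zero]) (simp add: eval.zero)

lemma rec_relativize: "rec {} f \<Longrightarrow> rec A f"
  using rec_trans empty_turing_le by blast

fun const_prog :: "nat \<Rightarrow> prog" where
  "const_prog 0 = Zero"
| "const_prog (Suc n) = Comp Succ (const_prog n)"

lemma eval_const_prog: "eval A (const_prog n) x n"
  by (induction n) (auto intro: eval.intros)

lemma eval_first: "eval A First n (fst (prod_decode n))"
  by (metis eval.first prod.collapse prod_decode_inverse)

lemma eval_second: "eval A Second n (snd (prod_decode n))"
  by (metis eval.second prod.collapse prod_decode_inverse)

lemma eval_identity: "eval A (Pairing First Second) n n"
  using eval.pairing[OF eval_first eval_second] by simp

text \<open>Primitive recursion on the tested value, with a step that keeps only the parameter, acts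
  as a case distinction. Both branches have to halt.\<close>

lemma eval_cond_zero:
  assumes "eval A p x u" and "eval A q x v" and "eval A r x n"
  shows "eval A (Comp (PrimRec p (Comp q First)) (Pairing (Pairing First Second) r)) x (if n = 0 then u else v)"
proof -
  have "eval A (PrimRec p (Comp q First)) (prod_encode (x, m)) (if m = 0 then u else v)" for m
    by (induction m) (auto intro!: eval.intros assms intro: eval.first)
  then show ?thesis using assms(3)
    by (meson eval.comp eval.pairing eval_identity)
qed

instantiation nat :: enc begin
definition enc_nat :: "nat \<Rightarrow> nat" where [simp]: "enc_nat n = n"
definition dec_nat :: "nat \<Rightarrow> nat" where [simp]: "dec_nat n = n"
instance by standard (auto intro: eval_identity)
end

instantiation bool :: enc begin
definition enc_bool :: "bool \<Rightarrow> nat" where "enc_bool b = of_bool b"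
definition dec_bool :: "nat \<Rightarrow> bool" where "dec_bool n = (n \<noteq> 0)"
instance
proof
  have "\<forall>n. eval {} (Comp (PrimRec Zero (Comp (const_prog 1) First)) (Pairing (Pairing First Second) (Pairing First Second))) n (enc (dec n :: bool))"
  proof
    fix n :: nat
    show "eval {} (Comp (PrimRec Zero (Comp (const_prog 1) First)) (Pairing (Pairing First Second) (Pairing First Second))) n (enc (dec n :: bool))"
      using eval_cond_zero[OF eval.zero[of "{}" n] eval_const_prog[of "{}" 1 n] eval_identity[of "{}" n]]
      by (cases "n = 0") (simp_all add: enc_bool_def dec_bool_def)
  qed
  then show "\<exists>p. \<forall>n. eval {} p n (enc (dec n :: bool))" by blast
qed (simp add: enc_bool_def dec_bool_def)
end

instantiation prod :: (enc, enc) enc begin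
definition enc_prod :: "'a \<times> 'b \<Rightarrow> nat" where "enc_prod z = prod_encode (enc (fst z), enc (snd z))"
definition dec_prod :: "nat \<Rightarrow> 'a \<times> 'b" where
  "dec_prod n = (dec (fst (prod_decode n)), dec (snd (prod_decode n)))"
instance
proof
  obtain p q where p: "\<And>n. eval {} p n (enc (dec n :: 'a))" and q: "\<And>n. eval {} q n (enc (dec n :: 'b))"
    using computable_enc_dec by metis
  have "\<forall>n. eval {} (Pairing (Comp p First) (Comp q Second)) n (enc (dec n :: 'a \<times> 'b))"
    unfolding enc_prod_def dec_prod_def
    using eval.comp[OF eval_first p] eval.comp[OF eval_second q] by (auto intro: eval.pairing)
  then show "\<exists>p. \<forall>n. eval {} p n (enc (dec n :: 'a \<times> 'b))" by blast
qed (simp add: enc_prod_def dec_prod_def)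
end

instantiation prog :: enc begin
definition enc_prog :: "prog \<Rightarrow> nat" where "enc_prog = goedel"
definition dec_prog :: "nat \<Rightarrow> prog" where "dec_prog = inv goedel"
instance
proof
  show "\<exists>p. \<forall>n. eval {} p n (enc (dec n :: prog))"
    using eval_identity bij_goedel by (metis bij_inv_eq_iff enc_prog_def dec_prog_def)
  show "dec (enc x) = x" for x :: prog
    using bij_goedel by (simp add: enc_prog_def dec_prog_def bij_is_inj)
qed
end

lemma enc_dec_prog [simp]: "enc (dec n :: prog) = n"
  using bij_goedel by (metis bij_inv_eq_iff enc_prog_def dec_prog_def)

named_theorems rec_intros

lemma rec_id [rec_intros]: "rec A (\<lambda>x. x)"
  by (rule recI) (rule eval_identity)

lemma rec_const [rec_intros]: "rec A (\<lambda>x. c)"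
  by (rule recI) (rule eval_const_prog)

lemma rec_comp:
  assumes "rec A f" and "rec A g" shows "rec A (\<lambda>x. f (g x))"
  using assms unfolding rec_def by (meson eval.comp)

lemma rec_pair [rec_intros]:
  assumes "rec A f" and "rec A g" shows "rec A (\<lambda>x. (f x, g x))"
  using assms unfolding rec_def enc_prod_def by (auto intro: eval.pairing)

lemma rec_fst [rec_intros]: assumes "rec A f" shows "rec A (\<lambda>x. fst (f x))"
proof -
  have "rec A (fst :: 'b \<times> 'c \<Rightarrow> 'b)"
    by (rule recI[of _ First]) (simp add: enc_prod_def eval.first)
  from rec_comp[OF this assms] show ?thesis .
qed

lemma rec_snd [rec_intros]: assumes "rec A f" shows "rec A (\<lambda>x. snd (f x))"
proof -
  have "rec A (snd :: 'b \<times> 'c \<Rightarrow> 'c)"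
    by (rule recI[of _ Second]) (simp add: enc_prod_def eval.second)
  from rec_comp[OF this assms] show ?thesis .
qed

lemma rec_comp2:
  assumes "rec A (\<lambda>z. h (fst z) (snd z))" and "rec A f" and "rec A g"
  shows "rec A (\<lambda>x. h (f x) (g x))"
  using rec_comp[OF assms(1) rec_pair[OF assms(2,3)]] by simp

lemma rec_split [rec_intros]:
  assumes "rec A (\<lambda>x. g x (fst (f x)) (snd (f x)))"
  shows "rec A (\<lambda>x. case f x of (a, b) \<Rightarrow> g x a b)"
  using assms by (simp add: case_prod_beta)

lemma rec_let [rec_intros]:
  assumes "rec A (\<lambda>z. g (fst z) (snd z))" and "rec A f"
  shows "rec A (\<lambda>x. let y = f x in g x y)"
  using rec_comp[OF assms(1) rec_pair[OF rec_id assms(2)]] by simp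

lemma rec_enc [rec_intros]: assumes "rec A f" shows "rec A (\<lambda>x. enc (f x))"
  using assms unfolding rec_def by simp

text \<open>Not every number is a code, yet \<open>dec\<close> has to be computable on all numbers.
  This is the purpose of the second axiom of \<open>enc\<close>: it rounds a number to the canonical
  code of the value that it decodes to.\<close>

lemma rec_dec [rec_intros]: assumes "rec A f" shows "rec A (\<lambda>x. dec (f x) :: 'b::enc)"
proof -
  have "rec {} (dec :: nat \<Rightarrow> 'b)"
    unfolding rec_def using computable_enc_dec by simp
  from rec_comp[OF rec_relativize[OF this] assms] show ?thesis .
qed

lemma rec_enc_iff: "rec A (\<lambda>x. enc (f x)) \<longleftrightarrow> rec A f"
  unfolding rec_def by simp

lemma rec_Suc [rec_intros]: assumes "rec A f" shows "rec A (\<lambda>x. Suc (f x))"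
  by (rule rec_comp[OF recI[of A Succ] assms]) (simp add: eval.succ)

lemma rec_prod_encode [rec_intros]: assumes "rec A f" shows "rec A (\<lambda>x. prod_encode (f x))"
  by (rule rec_comp[OF recI[of A "Pairing First Second"] assms]) (simp add: enc_prod_def eval_identity)

lemma rec_prod_decode [rec_intros]: assumes "rec A f" shows "rec A (\<lambda>x. prod_decode (f x))"
  by (rule rec_comp[OF recI[of A "Pairing First Second"] assms]) (simp add: enc_prod_def eval_identity)

lemma rec_rec_nat [rec_intros]:
  assumes f: "rec A f" and g: "rec A (\<lambda>z. g (fst z) (fst (snd z)) (snd (snd z)))" and h: "rec A h"
  shows "rec A (\<lambda>x. rec_nat (f x) (g x) (h x))"
proof -
  obtain p where p: "\<And>x. eval A p (enc x) (enc (f x))" using f unfolding rec_def by blast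
  obtain q where q: "\<And>x n y. eval A q (enc (x, n, y)) (enc (g x n y))"
    using g unfolding rec_def by (metis fst_conv snd_conv)
  have "eval A (PrimRec p q) (prod_encode (enc x, n)) (enc (rec_nat (f x) (g x) n))" for x n
  proof (induction n)
    case 0
    show ?case using p by (auto intro: eval.intros)
  next
    case (Suc n)
    show ?case using eval.primrec_Suc[OF Suc] q by (simp add: enc_prod_def)
  qed
  then have "rec A (\<lambda>z. rec_nat (f (fst z)) (g (fst z)) (snd z))"
    by (intro recI[of _ "PrimRec p q"]) (simp add: enc_prod_def)
  from rec_comp[OF this rec_pair[OF rec_id h]] show ?thesis by simp
qed

lemma rec_if [rec_intros]:
  assumes "rec A b" and "rec A f" and "rec A g"
  shows "rec A (\<lambda>x. if b x then f x else g x)"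
proof -
  have "rec A (\<lambda>x. rec_nat (g x) (\<lambda>_ _. f x) (enc (b x)))"
    using assms by (intro rec_intros rec_comp[OF assms(2)])
  moreover have "rec_nat (g x) (\<lambda>_ _. f x) (enc (b x)) = (if b x then f x else g x)" for x
    by (cases "b x") (simp_all add: enc_bool_def)
  ultimately show ?thesis by simp
qed

lemma rec_not [rec_intros]: assumes "rec A P" shows "rec A (\<lambda>x. \<not> P x)"
proof -
  have eq: "(\<lambda>x. \<not> P x) = (\<lambda>x. if P x then False else True)" by auto
  show ?thesis unfolding eq by (rule rec_if[OF assms rec_const rec_const])
qed

lemma rec_conj [rec_intros]: assumes "rec A P" and "rec A Q" shows "rec A (\<lambda>x. P x \<and> Q x)"
proof -
  have eq: "(\<lambda>x. P x \<and> Q x) = (\<lambda>x. if P x then Q x else False)" by auto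
  show ?thesis unfolding eq by (rule rec_if[OF assms rec_const])
qed

lemma rec_disj [rec_intros]: "rec A P \<Longrightarrow> rec A Q \<Longrightarrow> rec A (\<lambda>x. P x \<or> Q x)"
  using rec_not[OF rec_conj[OF rec_not rec_not]] by simp

lemma rec_imp [rec_intros]: "rec A P \<Longrightarrow> rec A Q \<Longrightarrow> rec A (\<lambda>x. P x \<longrightarrow> Q x)"
  using rec_disj[OF rec_not] unfolding imp_conv_disj .

lemma rec_oracle [rec_intros]: "rec A f \<Longrightarrow> rec A (\<lambda>x. f x \<in> A)"
  by (rule rec_comp[of A "\<lambda>x. x \<in> A" f], rule recI[of _ Query]) (simp_all add: enc_bool_def eval.query)

lemma turing_le_iff_rec: "B \<le>\<^sub>T A \<longleftrightarrow> rec A (\<lambda>n. n \<in> B)"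
  unfolding turing_le_def rec_def by (simp add: enc_bool_def)

section \<open>Arithmetic and bounded quantifiers\<close>

lemma rec_pred: assumes "rec A f" shows "rec A (\<lambda>x. f x - 1 :: nat)"
proof -
  have "rec A (\<lambda>x. rec_nat 0 (\<lambda>n _. n) (f x) :: nat)"
    by (intro rec_intros assms)
  moreover have "rec_nat 0 (\<lambda>n _. n) m = m - 1" for m by (cases m) auto
  ultimately show ?thesis by simp
qed

lemma rec_add [rec_intros]:
  assumes "rec A f" and "rec A g" shows "rec A (\<lambda>x. f x + g x :: nat)"
proof -
  have "rec A (\<lambda>x. rec_nat (f x) (\<lambda>_ y. Suc y) (g x))"
    by (intro rec_intros assms)
  moreover have "rec_nat a (\<lambda>_ y. Suc y) b = a + b" for a b by (induction b) auto
  ultimately show ?thesis by simp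
qed

lemma rec_diff [rec_intros]:
  assumes "rec A f" and "rec A g" shows "rec A (\<lambda>x. f x - g x :: nat)"
proof -
  have "rec A (\<lambda>x. rec_nat (f x) (\<lambda>_ y. y - 1) (g x))"
    by (intro rec_intros rec_pred assms)
  moreover have "rec_nat a (\<lambda>_ y. y - 1) b = a - b" for a b :: nat by (induction b) auto
  ultimately show ?thesis by simp
qed

lemma rec_mult [rec_intros]:
  assumes "rec A f" and "rec A g" shows "rec A (\<lambda>x. f x * g x :: nat)"
proof -
  have "rec A (\<lambda>x. rec_nat 0 (\<lambda>_ y. f x + y) (g x))"
    by (intro rec_intros rec_comp[OF assms(1)] assms)
  moreover have "rec_nat 0 (\<lambda>_ y. a + y) b = a * b" for a b :: nat by (induction b) auto
  ultimately show ?thesis by simp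
qed

lemma rec_power [rec_intros]:
  assumes "rec A f" and "rec A g" shows "rec A (\<lambda>x. f x ^ g x :: nat)"
proof -
  have "rec A (\<lambda>x. rec_nat 1 (\<lambda>_ y. f x * y) (g x))"
    by (intro rec_intros rec_comp[OF assms(1)] assms)
  moreover have "rec_nat 1 (\<lambda>_ y. a * y) b = a ^ b" for a b :: nat by (induction b) auto
  ultimately show ?thesis by simp
qed

lemma rec_sum [rec_intros]:
  fixes f :: "'a::enc \<Rightarrow> nat \<Rightarrow> nat"
  assumes "rec A (\<lambda>z. f (fst z) (snd z))" and "rec A b"
  shows "rec A (\<lambda>x. \<Sum>i<b x. f x i)"
proof -
  have "rec A (\<lambda>x. rec_nat 0 (\<lambda>n y. y + f x n) (b x))"
    by (intro rec_intros rec_comp2[OF assms(1)] assms(2))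
  moreover have "rec_nat 0 (\<lambda>n y. y + h n) m = (\<Sum>i<m. h i)" for h :: "nat \<Rightarrow> nat" and m
    by (induction m) auto
  ultimately show ?thesis by simp
qed

lemma rec_eq_0: assumes "rec A f" shows "rec A (\<lambda>x. f x = (0::nat))"
proof -
  have "rec A (\<lambda>x. rec_nat True (\<lambda>_ _. False) (f x))"
    by (intro rec_intros assms)
  moreover have "rec_nat True (\<lambda>_ _. False) m = (m = 0)" for m by (cases m) auto
  ultimately show ?thesis by simp
qed

lemma rec_le [rec_intros]: "rec A f \<Longrightarrow> rec A g \<Longrightarrow> rec A (\<lambda>x. f x \<le> (g x :: nat))"
  using rec_eq_0[OF rec_diff, of A f g] by simp

lemma rec_less [rec_intros]: "rec A f \<Longrightarrow> rec A g \<Longrightarrow> rec A (\<lambda>x. f x < (g x :: nat))"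
  using rec_not[OF rec_le, of A g f] by (simp add: not_le)

lemma rec_eq [rec_intros]:
  fixes f g :: "'a::enc \<Rightarrow> 'b::enc"
  assumes "rec A f" and "rec A g" shows "rec A (\<lambda>x. f x = g x)"
proof -
  have "rec A (\<lambda>x. enc (f x) \<le> enc (g x) \<and> enc (g x) \<le> enc (f x))"
    by (intro rec_intros assms)
  then show ?thesis by (simp flip: eq_iff)
qed

lemma rec_Ball_lessThan [rec_intros]:
  assumes "rec A (\<lambda>z. P (fst z) (snd z))" and "rec A b"
  shows "rec A (\<lambda>x. \<forall>i<b x :: nat. P x i)"
proof -
  have "rec A (\<lambda>x. (\<Sum>i<b x. if P x i then 0 else 1) = (0::nat))"
    by (intro rec_intros assms)
  moreover have "((\<Sum>i<m. if Q i then 0 else 1) = (0::nat)) \<longleftrightarrow> (\<forall>i<m. Q i)" for Q and m :: nat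
    by (auto split: if_splits)
  ultimately show ?thesis by simp
qed

lemma rec_Bex_lessThan [rec_intros]:
  assumes "rec A (\<lambda>z. P (fst z) (snd z))" and "rec A b"
  shows "rec A (\<lambda>x. \<exists>i<b x :: nat. P x i)"
  using rec_not[OF rec_Ball_lessThan, of A "\<lambda>x i. \<not> P x i" b] rec_not[of A "\<lambda>z. P (fst z) (snd z)"] assms
  by simp

lemma rec_Ball_atMost [rec_intros]:
  assumes "rec A (\<lambda>z. P (fst z) (snd z))" and "rec A b"
  shows "rec A (\<lambda>x. \<forall>i\<le>b x :: nat. P x i)"
  using rec_Ball_lessThan[OF assms(1) rec_Suc[OF assms(2)]] by (simp add: less_Suc_eq_le)

lemma rec_Bex_atMost [rec_intros]:
  assumes "rec A (\<lambda>z. P (fst z) (snd z))" and "rec A b"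
  shows "rec A (\<lambda>x. \<exists>i\<le>b x :: nat. P x i)"
  using rec_Bex_lessThan[OF assms(1) rec_Suc[OF assms(2)]] by (simp add: less_Suc_eq_le)

section \<open>Unbounded search\<close>

lemma eval_Mu_iff:
  assumes p: "\<And>x n. eval A p (prod_encode (x, n)) (of_bool (\<not> P x n))"
  shows "eval A (Mu p) x n \<longleftrightarrow> P x n \<and> (\<forall>m<n. \<not> P x m)"
proof
  assume "eval A (Mu p) x n"
  then show "P x n \<and> (\<forall>m<n. \<not> P x m)"
  proof cases
    case mu
    have "of_bool (\<not> P x n) = (0::nat)" by (rule eval_deterministic[OF p mu(1)])
    moreover have "\<not> P x m" if "m < n" for m
    proof -
      obtain y where "eval A p (prod_encode (x, m)) (Suc y)" using mu(2)[OF \<open>m < n\<close>] by blast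
      then have "of_bool (\<not> P x m) = Suc y" by (rule eval_deterministic[OF p])
      then show ?thesis by (cases "P x m") simp_all
    qed
    ultimately show ?thesis by simp
  qed
next
  assume *: "P x n \<and> (\<forall>m<n. \<not> P x m)"
  show "eval A (Mu p) x n"
  proof (rule eval.mu)
    show "eval A p (prod_encode (x, n)) 0" using p[of x n] * by simp
    show "\<exists>y. eval A p (prod_encode (x, m)) (Suc y)" if "m < n" for m
      using p[of x m] * that by auto
  qed
qed

lemma rec_Least:
  assumes P: "rec A (\<lambda>z. P (fst z) (snd z))" and ex: "\<And>x. \<exists>n. P x n"
  shows "rec A (\<lambda>x. LEAST n :: nat. P x n)"
proof -
  have "rec A (\<lambda>z. \<not> P (dec (fst z)) (snd z))"
    by (intro rec_intros rec_comp2[OF P])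
  then obtain p where p: "\<And>z :: nat \<times> nat. eval A p (enc z) (enc (\<not> P (dec (fst z)) (snd z)))"
    unfolding rec_def by blast
  have p': "eval A p (prod_encode (x, n)) (of_bool (\<not> P (dec x) n))" for x n
    using p[of "(x, n)"] by (simp add: enc_prod_def enc_bool_def)
  have "eval A (Mu p) (enc x) (LEAST n. P x n)" for x
    unfolding eval_Mu_iff[OF p'] using ex[of x] by (auto intro: LeastI_ex dest: not_less_Least)
  then show ?thesis by (intro recI[of _ "Mu p"]) simp
qed

text \<open>The search runs through all numbers until one decodes to the value. Being able to check
  a result is thus enough to compute it, so division and list-valued functions need no explicit
  program.\<close>

lemma rec_graph:
  fixes f :: "'a::enc \<Rightarrow> 'b::enc"
  assumes P: "rec A (\<lambda>z. P (fst z) (snd z))" and f: "\<And>x. P x (f x)" and uniq: "\<And>x y. P x y \<Longrightarrow> y = f x"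
  shows "rec A f"
proof -
  have "rec A (\<lambda>x. dec (LEAST n. P x (dec n)) :: 'b)"
    by (intro rec_intros rec_Least rec_comp2[OF P]) (metis f dec_enc)
  moreover have "dec (LEAST n. P x (dec n)) = f x" for x
    by (rule uniq) (rule LeastI[of _ "enc (f x)"], simp add: f)
  ultimately show ?thesis by simp
qed

lemma rec_div [rec_intros]:
  assumes "rec A f" and "rec A g" shows "rec A (\<lambda>x. f x div g x :: nat)"
proof -
  have "rec A (\<lambda>z. (fst z :: nat) div snd z)"
  proof (rule rec_graph)
    show "rec A (\<lambda>z. (\<lambda>z q. (snd z = 0 \<and> q = 0) \<or> (snd z * q \<le> fst z \<and> fst z < snd z * Suc q)) (fst z :: nat \<times> nat) (snd z :: nat))"
      by (intro rec_intros)
    show "(snd z = 0 \<and> fst z div snd z = 0) \<or> (snd z * (fst z div snd z) \<le> fst z \<and> fst z < snd z * Suc (fst z div snd z))"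
      for z :: "nat \<times> nat"
      by (cases "snd z = 0") (simp_all add: dividend_less_times_div)
    show "q = fst z div snd z"
      if "(snd z = 0 \<and> q = 0) \<or> (snd z * q \<le> fst z \<and> fst z < snd z * Suc q)" for z :: "nat \<times> nat" and q
      using that by (auto intro: div_nat_eqI[symmetric])
  qed
  then show ?thesis by (rule rec_comp2) (rule assms)+
qed

lemma rec_even [rec_intros]: assumes "rec A f" shows "rec A (\<lambda>x. even (f x :: nat))"
proof -
  have eq: "even n \<longleftrightarrow> n - 2 * (n div 2) = 0" for n :: nat by presburger
  show ?thesis unfolding eq by (intro rec_intros assms)
qed

section \<open>Computing with lists\<close>

text \<open>The default value keeps indexing total, hence computable on arbitrary arguments.\<close>

definition nth0 :: "'a::enc list \<Rightarrow> nat \<Rightarrow> 'a" where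
  "nth0 l i = (if i < length l then l ! i else dec 0)"

definition list_code_tl :: "nat \<Rightarrow> nat" where
  "list_code_tl c = snd (prod_decode (c - 1))"

definition list_code_drop :: "nat \<Rightarrow> nat \<Rightarrow> nat" where
  "list_code_drop c n = rec_nat c (\<lambda>_. list_code_tl) n"

lemma list_code_drop_encode: "list_code_drop (list_encode l) n = list_encode (drop n l)"
proof (induction n)
  case (Suc n)
  \<comment> \<open>The code 0 of the empty list has to be its own tail: \<open>0 - 1\<close> is 0
    and decodes to a pair of zeros.\<close>
  have "prod_decode 0 = (0, 0)"
    using prod_encode_inverse[of "(0, 0)"] by (simp add: prod_encode_def)
  then have "list_code_tl (list_encode m) = list_encode (tl m)" for m
    by (cases m) (simp_all add: list_code_tl_def)
  with Suc show ?case by (simp add: list_code_drop_def drop_Suc tl_drop)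
qed (simp add: list_code_drop_def)

lemma list_encode_eq_0_iff: "list_encode l = 0 \<longleftrightarrow> l = []"
  by (cases l) auto

lemma rec_list_code_drop:
  assumes "rec A f" and "rec A g" shows "rec A (\<lambda>x. list_code_drop (f x) (g x))"
  unfolding list_code_drop_def list_code_tl_def by (intro rec_intros rec_pred assms)

lemma rec_length_list_decode:
  assumes "rec A f" shows "rec A (\<lambda>x. length (list_decode (f x)))"
proof -
  have "length (list_decode c) = (LEAST n. list_code_drop c n = 0)" for c
  proof (rule Least_equality[symmetric])
    fix n assume "list_code_drop c n = 0"
    then have "drop n (list_decode c) = []"
      using list_code_drop_encode[of "list_decode c" n] by (simp add: list_encode_eq_0_iff)
    then show "length (list_decode c) \<le> n" by simp
  qed (use list_code_drop_encode[of "list_decode c"] in simp)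
  moreover have "\<exists>n. list_code_drop c n = 0" for c
    using list_code_drop_encode[of "list_decode c" "length (list_decode c)"] by auto
  moreover have "rec A (\<lambda>z. list_code_drop (f (fst z)) (snd z) = 0)"
    by (intro rec_eq_0 rec_list_code_drop rec_comp[OF assms] rec_fst rec_snd rec_id)
  ultimately show ?thesis
    by (simp only:) (rule rec_Least)
qed

lemma rec_nth0_list_decode:
  assumes "rec A f" and "rec A g" shows "rec A (\<lambda>x. nth0 (list_decode (f x)) (g x))"
proof -
  have "nth0 (list_decode c) i = (if i < length (list_decode c) then fst (prod_decode (list_code_drop c i - 1)) else 0)" for c i
  proof (cases "i < length (list_decode c)")
    case True
    then have "drop i (list_decode c) = list_decode c ! i # drop (Suc i) (list_decode c)"
      by (rule Cons_nth_drop_Suc[symmetric])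
    with True show ?thesis
      using list_code_drop_encode[of "list_decode c" i] by (simp add: nth0_def)
  qed (simp add: nth0_def)
  then show ?thesis
    by (simp only:) (intro rec_intros rec_pred rec_length_list_decode rec_list_code_drop assms)
qed

instantiation list :: (enc) enc begin
definition enc_list :: "'a list \<Rightarrow> nat" where "enc_list l = list_encode (map enc l)"
definition dec_list :: "nat \<Rightarrow> 'a list" where "dec_list n = map dec (list_decode n)"
instance
proof
  have "rec {} (\<lambda>n :: nat. enc (dec n :: 'a list))"
  proof (rule rec_graph)
    show "rec {} (\<lambda>z. (\<lambda>c d. length (list_decode d) = length (list_decode c) \<and>
        (\<forall>i<length (list_decode c). nth0 (list_decode d) i = enc (dec (nth0 (list_decode c) i) :: 'a))) (fst z) (snd z))"
      by (intro rec_intros rec_length_list_decode rec_nth0_list_decode)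
    show "d = enc (dec c :: 'a list)"
      if "length (list_decode d) = length (list_decode c) \<and>
        (\<forall>i<length (list_decode c). nth0 (list_decode d) i = enc (dec (nth0 (list_decode c) i) :: 'a))" for c d
    proof -
      have "list_decode d = map enc (dec c :: 'a list)"
        using that by (intro nth_equalityI) (auto simp: dec_list_def nth0_def)
      then show ?thesis unfolding enc_list_def by (metis list_decode_inverse)
    qed
  qed (simp add: enc_list_def dec_list_def nth0_def)
  then show "\<exists>p. \<forall>n. eval {} p n (enc (dec n :: 'a list))" by (simp add: rec_def)
qed (simp add: enc_list_def dec_list_def map_idI comp_def)
end

lemma rec_length [rec_intros]:
  fixes f :: "'a::enc \<Rightarrow> 'b::enc list"
  assumes "rec A f" shows "rec A (\<lambda>x. length (f x))"
proof -
  have "rec A (\<lambda>x. length (list_decode (enc (f x))))"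
    by (intro rec_length_list_decode rec_intros assms)
  then show ?thesis by (simp add: enc_list_def)
qed

lemma rec_nth0 [rec_intros]:
  fixes f :: "'a::enc \<Rightarrow> 'b::enc list"
  assumes "rec A f" and "rec A g" shows "rec A (\<lambda>x. nth0 (f x) (g x))"
proof -
  have "rec A (\<lambda>x. dec (nth0 (list_decode (enc (f x))) (g x)) :: 'b)"
    by (intro rec_nth0_list_decode rec_intros assms)
  moreover have "dec (nth0 (list_decode (enc l)) i) = nth0 l i" for l :: "'b list" and i
    by (simp add: enc_list_def nth0_def)
  ultimately show ?thesis by simp
qed

lemma rec_map_upt [rec_intros]:
  fixes f :: "'a::enc \<Rightarrow> nat \<Rightarrow> 'b::enc"
  assumes "rec A (\<lambda>z. f (fst z) (snd z))" and "rec A n"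
  shows "rec A (\<lambda>x. map (f x) [0..<n x])"
proof (rule rec_graph)
  show "rec A (\<lambda>z. (\<lambda>x l. length l = n x \<and> (\<forall>i<n x. nth0 l i = f x i)) (fst z) (snd z))"
    by (intro rec_intros rec_comp2[OF assms(1)] rec_comp[OF assms(2)])
  show "l = map (f x) [0..<n x]" if "length l = n x \<and> (\<forall>i<n x. nth0 l i = f x i)" for x l
    using that by (intro nth_equalityI) (auto simp: nth0_def)
qed (simp add: nth0_def)

lemma rec_take [rec_intros]:
  fixes f :: "'a::enc \<Rightarrow> 'b::enc list"
  assumes "rec A f" and "rec A n" shows "rec A (\<lambda>x. take (n x) (f x))"
proof -
  have "rec A (\<lambda>x. map (\<lambda>i. nth0 (f x) i) [0..<if n x \<le> length (f x) then n x else length (f x)])"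
    by (intro rec_intros rec_comp[OF assms(1)] assms)
  moreover have "map (\<lambda>i. nth0 l i) [0..<if m \<le> length l then m else length l] = take m l" for l :: "'b list" and m
    by (intro nth_equalityI) (auto simp: nth0_def split: if_splits)
  ultimately show ?thesis by simp
qed

lemma rec_Cons [rec_intros]:
  fixes f :: "'a::enc \<Rightarrow> 'b::enc list"
  assumes "rec A a" and "rec A f" shows "rec A (\<lambda>x. a x # f x)"
proof -
  have "rec A (\<lambda>x. map (\<lambda>i. if i = 0 then a x else nth0 (f x) (i - 1)) [0..<Suc (length (f x))])"
    by (intro rec_intros rec_pred rec_comp[OF assms(1)] rec_comp[OF assms(2)] assms)
  moreover have "map (\<lambda>i. if i = 0 then b else nth0 l (i - 1)) [0..<Suc (length l)] = b # l" for l :: "'b list" and b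
    by (intro nth_equalityI) (auto simp: nth0_def nth_Cons' simp del: upt_Suc)
  ultimately show ?thesis by simp
qed

lemma rec_Ball_set [rec_intros]:
  assumes "rec A (\<lambda>z. P (fst z) (snd z))" and "rec A (f :: 'a::enc \<Rightarrow> 'b::enc list)"
  shows "rec A (\<lambda>x. \<forall>y\<in>set (f x). P x y)"
proof -
  have "rec A (\<lambda>x. \<forall>i<length (f x). P x (nth0 (f x) i))"
    by (intro rec_intros rec_comp2[OF assms(1)] assms(2) rec_comp[OF assms(2)])
  moreover have "(\<forall>i<length l. Q (nth0 l i)) \<longleftrightarrow> (\<forall>y\<in>set l. Q y)" for Q and l :: "'b list"
    by (auto simp: nth0_def all_set_conv_all_nth)
  ultimately show ?thesis by simp
qed

lemma rec_Bex_set [rec_intros]: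
  assumes "rec A (\<lambda>z. P (fst z) (snd z))" and "rec A (f :: 'a::enc \<Rightarrow> 'b::enc list)"
  shows "rec A (\<lambda>x. \<exists>y\<in>set (f x). P x y)"
  using rec_not[OF rec_Ball_set[OF rec_not[OF assms(1)] assms(2)]] by simp

lemma rec_member [rec_intros]:
  assumes "rec A a" and "rec A (f :: 'a::enc \<Rightarrow> 'b::enc list)"
  shows "rec A (\<lambda>x. a x \<in> set (f x))"
proof -
  have "rec A (\<lambda>x. \<exists>y\<in>set (f x). y = a x)"
    by (intro rec_intros assms rec_comp[OF assms(1)])
  then show ?thesis by simp
qed

text \<open>Here \<open>s\<close> is the only sequence whose steps satisfy the decidable relation \<open>S\<close>, so it can be
  found by searching for its initial segments.\<close>

lemma rec_sequence:
  fixes s :: "nat \<Rightarrow> 'a::enc"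
  assumes S: "rec A (\<lambda>z. S (fst z) (fst (snd z)) (snd (snd z)))"
    and step: "\<And>n. S n (s n) (s (Suc n))"
    and uniq: "\<And>n y. S n (s n) y \<Longrightarrow> y = s (Suc n)"
  shows "rec A s"
proof -
  define P where "P n l \<longleftrightarrow> length l = Suc n \<and> nth0 l 0 = s 0 \<and> (\<forall>i<n. S i (nth0 l i) (nth0 l (Suc i)))" for n l
  have "rec A (\<lambda>n. map s [0..<Suc n])"
  proof (rule rec_graph)
    have S': "rec A (\<lambda>x. S (f x) (g x) (h x))" if "rec A f" "rec A g" "rec A h" for f g h :: "(nat \<times> 'a list) \<times> nat \<Rightarrow> _"
      using rec_comp[OF S rec_pair[OF that(1) rec_pair[OF that(2,3)]]] by simp
    show "rec A (\<lambda>z. P (fst z) (snd z))"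
      unfolding P_def by (intro rec_intros S')
    show "P n (map s [0..<Suc n])" for n
      unfolding P_def using step by (simp add: nth0_def del: upt_Suc)
    show "l = map s [0..<Suc n]" if "P n l" for n l
    proof -
      have "i \<le> n \<Longrightarrow> nth0 l i = s i" for i
      proof (induction i)
        case (Suc i)
        then have "nth0 l i = s i" and "i < n" by simp_all
        moreover have "\<forall>i<n. S i (nth0 l i) (nth0 l (Suc i))" using that unfolding P_def by blast
        ultimately have "S i (s i) (nth0 l (Suc i))" by metis
        then show ?case using uniq by simp
      qed (use that P_def in auto)
      then show ?thesis using that unfolding P_def
        by (intro nth_equalityI) (auto simp: nth0_def less_Suc_eq_le simp del: upt_Suc)
    qed
  qed
  then have "rec A (\<lambda>n. nth0 (map s [0..<Suc n]) n)"
    by (intro rec_nth0 rec_id)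
  then show ?thesis by (simp add: nth0_def del: upt_Suc)
qed

definition bit_at :: "bool list \<Rightarrow> nat \<Rightarrow> bool" where
  "bit_at r i \<longleftrightarrow> i < length r \<and> r ! i"

lemma rec_bit_at [rec_intros]:
  assumes "rec A f" and "rec A g" shows "rec A (\<lambda>x. bit_at (f x) (g x))"
proof -
  have "rec A (\<lambda>x. g x < length (f x) \<and> nth0 (f x) (g x))"
    by (intro rec_intros assms)
  moreover have "i < length r \<and> nth0 r i \<longleftrightarrow> bit_at r i" for r i
    by (auto simp: bit_at_def nth0_def)
  ultimately show ?thesis by simp
qed

lemma rec_initial_segment [rec_intros]:
  assumes "rec A f" shows "rec A (\<lambda>x. A \<restriction> f x)"
  unfolding initial_segment_def by (intro rec_intros assms)

lemma rec_replicate [rec_intros]: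
  fixes a :: "'a::enc \<Rightarrow> 'b::enc"
  assumes "rec A n" and "rec A a" shows "rec A (\<lambda>x. replicate (n x) (a x))"
proof -
  have "rec A (\<lambda>x. map (\<lambda>_. a x) [0..<n x])"
    by (intro rec_intros rec_comp[OF assms(2)] assms)
  then show ?thesis by (simp add: map_replicate_const)
qed

lemma rec_of_bool [rec_intros]: assumes "rec A f" shows "rec A (\<lambda>x. of_bool (f x) :: nat)"
  unfolding of_bool_def by (intro rec_intros assms)

text \<open>A bounded sum in place of the recursion on the list brings the function within reach of
  the closure lemmas for \<open>rec\<close>.\<close>

lemma string_code_eq_sum: "string_code s = (\<Sum>i<length s. 2 ^ i * (if nth0 s i then 2 else 1))"
proof (induction s)
  case (Cons b s)
  have "(\<Sum>i<length (b # s). 2 ^ i * (if nth0 (b # s) i then 2 else 1))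
      = (if b then 2 else 1) + (\<Sum>i<length s. 2 ^ Suc i * (if nth0 s i then 2 else 1 :: nat))"
    unfolding length_Cons sum.lessThan_Suc_shift by (simp add: nth0_def)
  also have "\<dots> = (if b then 2 else 1) + 2 * string_code s"
    unfolding Cons sum_distrib_left by (simp add: mult.assoc)
  finally show ?case by simp
qed simp

lemma rec_string_code [rec_intros]: assumes "rec A f" shows "rec A (\<lambda>x. string_code (f x))"
  unfolding string_code_eq_sum by (intro rec_intros rec_comp[OF assms] assms)

lemma inj_string_code: "string_code s = string_code t \<longleftrightarrow> s = t"
  using bij_string_code by (metis bij_def inj_def)

section \<open>Certificates of oracle computations\<close>

text \<open>One application of a rule of \<open>eval\<close> with premises from \<open>l\<close>,
  where the oracle is a finite string. Program shapes are tested arithmetically on Goedel numbers,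
  and a subprogram that occurs in no premise is replaced by a bounded number \<open>m\<close>, so
  that the predicate is decidable.\<close>

definition justified :: "bool list \<Rightarrow> (prog \<times> nat \<times> nat) list \<Rightarrow> prog \<times> nat \<times> nat \<Rightarrow> bool" where
  "justified r l z = (case z of (p, x, y) \<Rightarrow>
     (p = Zero \<and> y = 0) \<or> (p = Succ \<and> y = Suc x) \<or>
     (p = First \<and> y = fst (prod_decode x)) \<or> (p = Second \<and> y = snd (prod_decode x)) \<or>
     (p = Query \<and> x < length r \<and> y = of_bool (bit_at r x)) \<or>
     (\<exists>(q, a, u)\<in>set l. \<exists>(q', a', u')\<in>set l. a = x \<and> a' = x \<and>
        goedel p = 4 * prod_encode (enc q, enc q') + 5 \<and> y = prod_encode (u, u')) \<or>
     (\<exists>(q, a, u)\<in>set l. \<exists>(q', a', u')\<in>set l. a' = x \<and> a = u' \<and>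
        goedel p = 4 * prod_encode (enc q, enc q') + 6 \<and> y = u) \<or>
     (\<exists>(q, a, u)\<in>set l. (\<exists>m\<le>goedel p. goedel p = 4 * prod_encode (enc q, m) + 7) \<and>
        x = prod_encode (a, 0) \<and> y = u) \<or>
     (\<exists>(p', a, u)\<in>set l. \<exists>(q', a', u')\<in>set l. p' = p \<and>
        (\<exists>m\<le>goedel p. goedel p = 4 * prod_encode (m, enc q') + 7) \<and>
        a' = prod_encode (fst (prod_decode a), prod_encode (snd (prod_decode a), u)) \<and>
        x = prod_encode (fst (prod_decode a), Suc (snd (prod_decode a))) \<and> y = u') \<or>
     (\<exists>(q, a, u)\<in>set l. goedel p = 4 * enc q + 8 \<and> a = prod_encode (x, y) \<and> u = 0 \<and>
        (\<forall>m<y. \<exists>(q', a', u')\<in>set l. q' = q \<and> a' = prod_encode (x, m) \<and> u' \<noteq> 0)))"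

lemma rec_goedel [rec_intros]: assumes "rec A f" shows "rec A (\<lambda>x. goedel (f x))"
  using rec_enc[OF assms] by (simp add: enc_prog_def)

lemma rec_justified [rec_intros]:
  assumes "rec A r" and "rec A l" and "rec A z" shows "rec A (\<lambda>x. justified (r x) (l x) (z x))"
  unfolding justified_def
  by (intro rec_intros rec_comp[OF assms(1)] rec_comp[OF assms(2)] rec_comp[OF assms(3)] assms)

definition certificate :: "bool list \<Rightarrow> (prog \<times> nat \<times> nat) list \<Rightarrow> bool" where
  "certificate r l \<longleftrightarrow> (\<forall>i<length l. justified r (take i l) (nth0 l i))"

lemma rec_certificate [rec_intros]:
  assumes "rec A r" and "rec A l" shows "rec A (\<lambda>x. certificate (r x) (l x))"
  unfolding certificate_def
  by (intro rec_intros rec_comp[OF assms(1)] rec_comp[OF assms(2)] assms)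

lemma length_initial_segment [simp]: "length (X \<restriction> n) = n"
  by (simp add: initial_segment_def)

lemma nth_initial_segment [simp]: "i < n \<Longrightarrow> (X \<restriction> n) ! i \<longleftrightarrow> i \<in> X"
  by (simp add: initial_segment_def)

lemma bit_at_initial_segment [simp]: "bit_at (X \<restriction> n) i \<longleftrightarrow> i < n \<and> i \<in> X"
  by (auto simp: bit_at_def)

lemma take_initial_segment [simp]: "take m (X \<restriction> n) = X \<restriction> min m n"
  by (rule nth_equalityI) auto

lemma empty_initial_segment: "{} \<restriction> n = replicate n False"
  by (rule nth_equalityI) auto

lemma Bex_triple: "(\<exists>(q, a, u)\<in>S. P q a u) \<longleftrightarrow> (\<exists>q a u. (q, a, u) \<in> S \<and> P q a u)"
  by auto

lemma justified_sound:
  assumes "justified (X \<restriction> n) l (p, x, y)" and l: "\<And>q a u. (q, a, u) \<in> set l \<Longrightarrow> eval X q a u"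
  shows "eval X p x y"
proof -
  have enc: "enc q = goedel q" for q :: prog by (simp add: enc_prog_def)
  show ?thesis
    using assms(1) unfolding justified_def prod.case Bex_triple enc
  proof (elim disjE)
    assume "\<exists>q a u. (q, a, u) \<in> set l \<and> (\<exists>q' a' u'. (q', a', u') \<in> set l \<and> a = x \<and> a' = x \<and>
      goedel p = 4 * prod_encode (goedel q, goedel q') + 5 \<and> y = prod_encode (u, u'))"
    then obtain q u q' u' where "(q, x, u) \<in> set l" "(q', x, u') \<in> set l"
      "goedel p = goedel (Pairing q q')" and y: "y = prod_encode (u, u')" unfolding goedel.simps by blast
    then have "eval X q x u" "eval X q' x u'" "p = Pairing q q'" using l inj_goedel by blast+
    then show ?thesis unfolding y using eval.pairing by blast
  next
    assume "\<exists>q a u. (q, a, u) \<in> set l \<and> (\<exists>q' a' u'. (q', a', u') \<in> set l \<and> a' = x \<and> a = u' \<and>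
      goedel p = 4 * prod_encode (goedel q, goedel q') + 6 \<and> y = u)"
    then obtain q q' a where "(q, a, y) \<in> set l" "(q', x, a) \<in> set l"
      "goedel p = goedel (Comp q q')" unfolding goedel.simps by blast
    then have "eval X q a y" "eval X q' x a" "p = Comp q q'" using l inj_goedel by blast+
    then show ?thesis using eval.comp by blast
  next
    assume "\<exists>q a u. (q, a, u) \<in> set l \<and> (\<exists>m\<le>goedel p. goedel p = 4 * prod_encode (goedel q, m) + 7) \<and>
      x = prod_encode (a, 0) \<and> y = u"
    then obtain q a m where *: "(q, a, y) \<in> set l" "goedel p = 4 * prod_encode (goedel q, m) + 7"
      "x = prod_encode (a, 0)" by blast
    \<comment> \<open>No premise mentions the step program; the number in its place is an index
      because \<open>goedel\<close> is surjective.\<close>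
    obtain q' where "goedel q' = m" using surj_goedel by blast
    with * have "p = PrimRec q q'" by (intro inj_goedel) simp
    with * l show ?thesis using eval.primrec_0 by blast
  next
    assume "\<exists>p' a u. (p', a, u) \<in> set l \<and> (\<exists>q' a' u'. (q', a', u') \<in> set l \<and> p' = p \<and>
        (\<exists>m\<le>goedel p. goedel p = 4 * prod_encode (m, goedel q') + 7) \<and>
        a' = prod_encode (fst (prod_decode a), prod_encode (snd (prod_decode a), u)) \<and>
        x = prod_encode (fst (prod_decode a), Suc (snd (prod_decode a))) \<and> y = u')"
    then obtain q' a u m b n where *: "(p, a, u) \<in> set l" "(q', prod_encode (b, prod_encode (n, u)), y) \<in> set l"
        "goedel p = 4 * prod_encode (m, goedel q') + 7"
        "x = prod_encode (b, Suc n)" and b: "b = fst (prod_decode a)" "n = snd (prod_decode a)" by blast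
    obtain q where "goedel q = m" using surj_goedel by blast
    with * have "p = PrimRec q q'" by (intro inj_goedel) simp
    moreover have "a = prod_encode (b, n)" using b by simp
    ultimately show ?thesis using eval.primrec_Suc[of X q q' b n u y] * l by blast
  next
    assume "\<exists>q a u. (q, a, u) \<in> set l \<and> goedel p = 4 * goedel q + 8 \<and> a = prod_encode (x, y) \<and> u = 0 \<and>
        (\<forall>m<y. \<exists>q' a' u'. (q', a', u') \<in> set l \<and> q' = q \<and> a' = prod_encode (x, m) \<and> u' \<noteq> 0)"
    then obtain q where *: "goedel p = goedel (Mu q)" "(q, prod_encode (x, y), 0) \<in> set l"
      "\<forall>m<y. \<exists>u'. (q, prod_encode (x, m), u') \<in> set l \<and> u' \<noteq> 0" unfolding goedel.simps by blast
    then have "p = Mu q" by (intro inj_goedel)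
    moreover have "eval X (Mu q) x y"
    proof (rule eval.mu)
      show "\<exists>u. eval X q (prod_encode (x, m)) (Suc u)" if "m < y" for m
        using * that l not0_implies_Suc by metis
    qed (use * l in blast)
    ultimately show ?thesis by simp
  next
    assume "p = Query \<and> x < length (X \<restriction> n) \<and> y = of_bool (bit_at (X \<restriction> n) x)"
    then show ?thesis using eval.query[of X x] by simp
  qed (auto intro: eval.intros eval_first eval_second)
qed

lemma certificate_sound:
  assumes "certificate (X \<restriction> n) l" and "(p, x, y) \<in> set l"
  shows "eval X p x y"
proof -
  have "i < length l \<Longrightarrow> (case l ! i of (p, x, y) \<Rightarrow> eval X p x y)" for i
  proof (induction i rule: less_induct)
    case (less i)
    obtain q a u where z: "l ! i = (q, a, u)" by (cases "l ! i")
    have "eval X q a u"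
    proof (rule justified_sound)
      show "justified (X \<restriction> n) (take i l) (q, a, u)"
        using assms(1) less.prems z unfolding certificate_def by (metis nth0_def)
      show "eval X q' a' u'" if "(q', a', u') \<in> set (take i l)" for q' a' u'
      proof -
        from that less.prems obtain j where "j < i" "l ! j = (q', a', u')"
          by (auto simp: in_set_conv_nth)
        with less show ?thesis by fastforce
      qed
    qed
    with z show ?case by simp
  qed
  with assms(2) show ?thesis by (fastforce simp: in_set_conv_nth)
qed

text \<open>Membership in \<open>l\<close> occurs only positively, and the oracle string is read
  only below its length, so both may grow.\<close>

lemma justified_mono:
  assumes "justified (take m r) l z" and "set l \<subseteq> set l'"
  shows "justified r l' z"
proof -
  obtain p x y where z: "z = (p, x, y)" by (cases z)
  have l: "z \<in> set l \<longrightarrow> z \<in> set l'" for z using assms(2) by blast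
  have q: "x < length (take m r) \<and> y = of_bool (bit_at (take m r) x) \<longrightarrow> x < length r \<and> y = of_bool (bit_at r x)"
    by (simp add: bit_at_def)
  have "justified (take m r) l z \<longrightarrow> justified r l' z"
    unfolding justified_def z prod.case Bex_triple
    by (rule imp_refl l q disj_mono conj_mono ex_mono all_mono imp_mono)+
  with assms(1) show ?thesis by blast
qed

lemma certificate_mono: "certificate (take m r) l \<Longrightarrow> certificate r l"
  unfolding certificate_def using justified_mono by blast

lemma certificate_append: "certificate r l \<Longrightarrow> certificate r l' \<Longrightarrow> certificate r (l @ l')"
  unfolding certificate_def
proof (intro allI impI)
  fix i assume *: "\<forall>i<length l. justified r (take i l) (nth0 l i)"
    "\<forall>i<length l'. justified r (take i l') (nth0 l' i)" "i < length (l @ l')"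
  show "justified r (take i (l @ l')) (nth0 (l @ l') i)"
  proof (cases "i < length l")
    case True
    then show ?thesis using *(1) by (simp add: nth0_def nth_append)
  next
    case False
    then have "justified r (take (i - length l) l') (nth0 l' (i - length l))" using * by auto
    then have "justified (take (length r) r) (take (i - length l) l') (nth0 (l @ l') i)"
      using * False by (simp add: nth0_def nth_append)
    then show ?thesis by (rule justified_mono) (auto simp: False)
  qed
qed

lemma certificate_snoc: "certificate r l \<Longrightarrow> justified r l z \<Longrightarrow> certificate r (l @ [z])"
  unfolding certificate_def by (auto simp: nth0_def nth_append less_Suc_eq)

text \<open>Needed for the rule \<open>mu\<close>, whose number of premises is not fixed: their
  certificates are concatenated over a common oracle string.\<close>

lemma certificate_finite:
  assumes "finite Z" and "\<And>z. z \<in> Z \<Longrightarrow> \<exists>n l. certificate (X \<restriction> n) l \<and> z \<in> set l"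
  shows "\<exists>n l. certificate (X \<restriction> n) l \<and> Z \<subseteq> set l"
  using assms
proof induction
  case empty
  have "certificate (X \<restriction> 0) []" by (simp add: certificate_def)
  then show ?case by auto
next
  case (insert z Z)
  obtain n l where 1: "certificate (X \<restriction> n) l" "Z \<subseteq> set l" using insert.IH insert.prems by blast
  obtain m k where 2: "certificate (X \<restriction> m) k" "z \<in> set k" using insert.prems by blast
  have "certificate (X \<restriction> max m n) l" "certificate (X \<restriction> max m n) k"
    using certificate_mono[of n "X \<restriction> max m n" l] certificate_mono[of m "X \<restriction> max m n" k] 1 2 by simp_all
  then have "certificate (X \<restriction> max m n) (l @ k)" by (rule certificate_append)
  moreover have "insert z Z \<subseteq> set (l @ k)" using 1 2 by auto
  ultimately show ?case by blast
qed

text \<open>Here \<open>Z\<close> collects the premises of a rule and \<open>N\<close> is the length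
  of oracle that the rule itself reads, which is nonzero only for queries.\<close>

lemma certificate_step:
  assumes fin: "finite Z" and Z: "\<And>z. z \<in> Z \<Longrightarrow> \<exists>n l. certificate (X \<restriction> n) l \<and> z \<in> set l"
    and j: "\<And>n l. Z \<subseteq> set l \<Longrightarrow> N \<le> n \<Longrightarrow> justified (X \<restriction> n) l z"
  shows "\<exists>n l. certificate (X \<restriction> n) l \<and> z \<in> set l"
proof -
  obtain n l where 1: "certificate (X \<restriction> n) l" "Z \<subseteq> set l" using certificate_finite[OF fin Z] by blast
  then have "certificate (X \<restriction> max n N) l"
    using certificate_mono[of n "X \<restriction> max n N" l] by simp
  then have "certificate (X \<restriction> max n N) (l @ [z])"
    using certificate_snoc j 1 by simp
  then show ?thesis by (intro exI[of _ "max n N"] exI[of _ "l @ [z]"]) simp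
qed

lemma certificate_complete:
  "eval X p x y \<Longrightarrow> \<exists>n l. certificate (X \<restriction> n) l \<and> (p, x, y) \<in> set l"
proof (induction rule: eval.induct)
  case (zero x) show ?case
    by (rule certificate_step[of "{}" X 0]) (simp_all add: justified_def)
next
  case (succ x) show ?case
    by (rule certificate_step[of "{}" X 0]) (simp_all add: justified_def)
next
  case (first x y) show ?case
    by (rule certificate_step[of "{}" X 0]) (simp_all add: justified_def)
next
  case (second x y) show ?case
    by (rule certificate_step[of "{}" X 0]) (simp_all add: justified_def)
next
  case (query x) show ?case
    by (rule certificate_step[of "{}" X "Suc x"]) (simp_all add: justified_def)
next
  case (pairing p x y q z)
  show ?case
  proof (rule certificate_step[of "{(p, x, y), (q, x, z)}" X 0])
    show "justified (X \<restriction> n) l (Pairing p q, x, prod_encode (y, z))"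
      if "{(p, x, y), (q, x, z)} \<subseteq> set l" for n l
    proof -
      have "goedel (Pairing p q) = 4 * prod_encode (enc p, enc q) + 5" by (simp add: enc_prog_def)
      with that have "\<exists>p' a u. (p', a, u) \<in> set l \<and> (\<exists>q' a' u'. (q', a', u') \<in> set l \<and> a = x \<and> a' = x \<and>
        goedel (Pairing p q) = 4 * prod_encode (enc p', enc q') + 5 \<and> prod_encode (y, z) = prod_encode (u, u'))"
        by blast
      then show ?thesis unfolding justified_def prod.case Bex_triple by blast
    qed
  qed (use pairing in auto)
next
  case (comp q x y p z)
  show ?case
  proof (rule certificate_step[of "{(q, x, y), (p, y, z)}" X 0])
    show "justified (X \<restriction> n) l (Comp p q, x, z)" if "{(q, x, y), (p, y, z)} \<subseteq> set l" for n l
    proof -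
      have "goedel (Comp p q) = 4 * prod_encode (enc p, enc q) + 6" by (simp add: enc_prog_def)
      with that have "\<exists>p' a u. (p', a, u) \<in> set l \<and> (\<exists>q' a' u'. (q', a', u') \<in> set l \<and> a' = x \<and> a = u' \<and>
        goedel (Comp p q) = 4 * prod_encode (enc p', enc q') + 6 \<and> z = u)"
        by blast
      then show ?thesis unfolding justified_def prod.case Bex_triple by blast
    qed
  qed (use comp in auto)
  next
    case (primrec_0 p x y q)
    show ?case
    proof (rule certificate_step[of "{(p, x, y)}" X 0])
      show "justified (X \<restriction> n) l (PrimRec p q, prod_encode (x, 0), y)" if "{(p, x, y)} \<subseteq> set l" for n l
      proof -
        have "goedel q \<le> goedel (PrimRec p q)"
          using le_prod_encode_2[of "goedel q" "goedel p"] by simp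
        moreover have "goedel (PrimRec p q) = 4 * prod_encode (enc p, goedel q) + 7" by (simp add: enc_prog_def)
        ultimately have "\<exists>p' a u. (p', a, u) \<in> set l \<and> (\<exists>m\<le>goedel (PrimRec p q). goedel (PrimRec p q) = 4 * prod_encode (enc p', m) + 7) \<and>
          prod_encode (x, 0) = prod_encode (a, 0) \<and> y = u"
          using that by blast
        then show ?thesis unfolding justified_def prod.case Bex_triple by blast
      qed
    qed (use primrec_0 in auto)
  next
    case (primrec_Suc p q x n y z)
    let ?P = "PrimRec p q"
    show ?case
    proof (rule certificate_step[of "{(?P, prod_encode (x, n), y), (q, prod_encode (x, prod_encode (n, y)), z)}" X 0])
      show "justified (X \<restriction> k) l (?P, prod_encode (x, Suc n), z)"
        if "{(?P, prod_encode (x, n), y), (q, prod_encode (x, prod_encode (n, y)), z)} \<subseteq> set l" for k l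
      proof -
        have "goedel p \<le> goedel ?P"
          using le_prod_encode_1[of "goedel p" "goedel q"] by simp
        moreover have "goedel ?P = 4 * prod_encode (goedel p, enc q) + 7" by (simp add: enc_prog_def)
        moreover have "prod_encode (x, prod_encode (n, y)) = prod_encode (fst (prod_decode (prod_encode (x, n))), prod_encode (snd (prod_decode (prod_encode (x, n))), y))"
          and "prod_encode (x, Suc n) = prod_encode (fst (prod_decode (prod_encode (x, n))), Suc (snd (prod_decode (prod_encode (x, n)))))"
          by simp_all
        ultimately have "\<exists>p' a u. (p', a, u) \<in> set l \<and> (\<exists>q' a' u'. (q', a', u') \<in> set l \<and> p' = ?P \<and>
          (\<exists>m\<le>goedel ?P. goedel ?P = 4 * prod_encode (m, enc q') + 7) \<and>
          a' = prod_encode (fst (prod_decode a), prod_encode (snd (prod_decode a), u)) \<and>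
          prod_encode (x, Suc n) = prod_encode (fst (prod_decode a), Suc (snd (prod_decode a))) \<and> z = u')"
          using that by blast
        then show ?thesis unfolding justified_def prod.case Bex_triple by blast
      qed
    qed (use primrec_Suc in auto)
  next
    case (mu p x n)
    have "\<forall>m<n. \<exists>y. eval X p (prod_encode (x, m)) (Suc y) \<and>
      (\<exists>k l. certificate (X \<restriction> k) l \<and> (p, prod_encode (x, m), Suc y) \<in> set l)"
      using mu.IH(2) by blast
    then obtain y where y: "\<And>m. m < n \<Longrightarrow> \<exists>k l. certificate (X \<restriction> k) l \<and> (p, prod_encode (x, m), Suc (y m)) \<in> set l"
      by metis
    show ?case
    proof (rule certificate_step[of "insert (p, prod_encode (x, n), 0) ((\<lambda>m. (p, prod_encode (x, m), Suc (y m))) ` {..<n})" X 0])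
      show "justified (X \<restriction> k) l (Mu p, x, n)"
        if "insert (p, prod_encode (x, n), 0) ((\<lambda>m. (p, prod_encode (x, m), Suc (y m))) ` {..<n}) \<subseteq> set l" for k l
      proof -
        have "\<exists>q' a' u'. (q', a', u') \<in> set l \<and> q' = p \<and> a' = prod_encode (x, m) \<and> u' \<noteq> 0" if "m < n" for m
        proof -
          have "(p, prod_encode (x, m), Suc (y m)) \<in> set l" using \<open>insert _ _ \<subseteq> _\<close> that by auto
          then show ?thesis by blast
        qed
        moreover have "goedel (Mu p) = 4 * enc p + 8" by (simp add: enc_prog_def)
        ultimately have "\<exists>q a u. (q, a, u) \<in> set l \<and> goedel (Mu p) = 4 * enc q + 8 \<and> a = prod_encode (x, n) \<and> u = 0 \<and>
          (\<forall>m<n. \<exists>q' a' u'. (q', a', u') \<in> set l \<and> q' = q \<and> a' = prod_encode (x, m) \<and> u' \<noteq> 0)"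
          using that by blast
        then show ?thesis unfolding justified_def prod.case Bex_triple by blast
      qed
    qed (use mu.IH(1) y in auto)
qed

text \<open>The length of \<open>r\<close> bounds the use of the oracle and, through the code of the
  certificate, also the running time. Convergence thereby becomes a decidable and monotone property
  of initial segments.\<close>

definition evb :: "bool list \<Rightarrow> prog \<Rightarrow> nat \<Rightarrow> nat \<Rightarrow> bool" where
  "evb r p x y \<longleftrightarrow> (\<exists>c<length r. certificate r (dec c) \<and> (p, x, y) \<in> set (dec c))"

lemma rec_evb [rec_intros]:
  assumes "rec A r" and "rec A p" and "rec A x" and "rec A y"
  shows "rec A (\<lambda>z. evb (r z) (p z) (x z) (y z))"
  unfolding evb_def
  by (intro rec_intros rec_comp[OF assms(1)] rec_comp[OF assms(2)] rec_comp[OF assms(3)] rec_comp[OF assms(4)] assms)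

lemma evb_mono: "evb (take m r) p x y \<Longrightarrow> evb r p x y"
  unfolding evb_def
proof (elim exE conjE)
  fix c assume "c < length (take m r)" "certificate (take m r) (dec c)" "(p, x, y) \<in> set (dec c)"
  then show "\<exists>c<length r. certificate r (dec c) \<and> (p, x, y) \<in> set (dec c)"
    using certificate_mono[of m r "dec c"] by (intro exI[of _ c]) simp
qed

lemma eval_iff_evb: "eval X p x y \<longleftrightarrow> (\<exists>n. evb (X \<restriction> n) p x y)"
proof
  assume "eval X p x y"
  then obtain n l where l: "certificate (X \<restriction> n) l" "(p, x, y) \<in> set l" using certificate_complete by blast
  define m where "m = max n (Suc (enc l))"
  have "certificate (X \<restriction> m) l" using certificate_mono[of n "X \<restriction> m" l] l by (simp add: m_def)
  with l have "evb (X \<restriction> m) p x y" unfolding evb_def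
    by (intro exI[of _ "enc l"]) (simp add: m_def)
  then show "\<exists>n. evb (X \<restriction> n) p x y" ..
qed (auto simp: evb_def dest: certificate_sound)

lemma evb_unique:
  assumes "evb r p x y" and "evb r p x z" shows "y = z"
proof -
  have r: "r = {i. bit_at r i} \<restriction> length r"
    by (rule nth_equalityI) (auto simp: bit_at_def)
  have "eval {i. bit_at r i} p x y" and "eval {i. bit_at r i} p x z"
    using assms unfolding eval_iff_evb by (metis r)+
  then show ?thesis by (rule eval_deterministic)
qed

section \<open>Recursively enumerable predicates and the jump\<close>

definition re :: "('a::enc \<Rightarrow> bool) \<Rightarrow> bool" where
  "re P \<longleftrightarrow> (\<exists>Q. rec {} (\<lambda>z. Q (fst z) (snd z)) \<and> (\<forall>x. P x \<longleftrightarrow> (\<exists>n::nat. Q x n)))"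

lemma reI:
  assumes "rec {} (\<lambda>z. Q (fst z) (snd z))" and "\<And>x. P x \<longleftrightarrow> (\<exists>n::nat. Q x n)" shows "re P"
  using assms unfolding re_def by blast

lemma eval_Comp_iff: "eval A (Comp p q) x z \<longleftrightarrow> (\<exists>y. eval A q x y \<and> eval A p y z)"
  by (auto elim: eval.cases intro: eval.comp)

lemma goedel_const_prog: "goedel (const_prog n) = rec_nat 0 (\<lambda>_ y. 4 * prod_encode (1, y) + 6) n"
  by (induction n) simp_all

text \<open>The program with index \<open>h x\<close> ignores its input and searches for a witness
  for \<open>x\<close>, so running it on its own index settles \<open>P x\<close>. Composition with
  a constant program plays the part of the s-m-n theorem.\<close>

lemma re_imp_rec_jump:
  assumes "re (P :: 'a::enc \<Rightarrow> bool)" and "jump {} \<le>\<^sub>T B" shows "rec B P"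
proof -
  obtain Q where Q: "rec {} (\<lambda>z. Q (fst z) (snd z))" and P: "\<And>x. P x \<longleftrightarrow> (\<exists>n::nat. Q x n)"
    using assms unfolding re_def by blast
  have "rec {} (\<lambda>z. \<not> Q (dec (fst z)) (snd z))"
    by (intro rec_intros rec_comp2[OF Q])
  then obtain q where q: "\<And>z :: nat \<times> nat. eval {} q (enc z) (enc (\<not> Q (dec (fst z)) (snd z)))"
    unfolding rec_def by blast
  have q': "eval {} q (prod_encode (x, n)) (of_bool (\<not> Q (dec x) n))" for x n
    using q[of "(x, n)"] by (simp add: enc_prod_def enc_bool_def)
  define h where "h = (\<lambda>x :: 'a. goedel (Comp (Mu q) (const_prog (enc x))))"
  have "rec {} h"
    unfolding h_def goedel.simps(7) goedel_const_prog by (intro rec_intros)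
  then have "rec (jump {}) (\<lambda>x. h x \<in> jump {})"
    by (rule rec_oracle[OF rec_relativize])
  moreover have "h x \<in> jump {} \<longleftrightarrow> P x" for x
  proof -
    have "h x \<in> jump {} \<longleftrightarrow> (\<exists>y. eval {} (Comp (Mu q) (const_prog (enc x))) (h x) y)"
      unfolding jump_def h_def by (auto dest!: inj_goedel simp del: goedel.simps)
    also have "\<dots> \<longleftrightarrow> (\<exists>y. eval {} (Mu q) (enc x) y)"
      unfolding eval_Comp_iff using eval_const_prog eval_deterministic by blast
    also have "\<dots> \<longleftrightarrow> (\<exists>y. Q x y)"
      unfolding eval_Mu_iff[OF q'] by (simp add: exists_least_iff[of "Q x"])
    finally show ?thesis using P by simp
  qed
  ultimately have "rec (jump {}) P" by simp
  then show ?thesis using assms(2) by (rule rec_trans)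
qed

section \<open>The Kraft inequality and the machine existence theorem\<close>

lemma card_extensions:
  assumes "length s \<le> N"
  shows "card {r :: bool list. length r = N \<and> take (length s) r = s} = 2 ^ (N - length s)"
proof -
  have "{r :: bool list. length r = N \<and> take (length s) r = s} = (\<lambda>t. s @ t) ` {t. length t = N - length s}"
  proof (intro equalityI subsetI)
    fix r assume "r \<in> {r :: bool list. length r = N \<and> take (length s) r = s}"
    then have "r = s @ drop (length s) r" "length (drop (length s) r) = N - length s"
      using append_take_drop_id[of "length s" r] by auto
    then show "r \<in> (\<lambda>t. s @ t) ` {t. length t = N - length s}" by blast
  qed (use assms in auto)
  moreover have "card {t :: bool list. length t = m} = 2 ^ m" for m
    using card_lists_length_eq[of "UNIV :: bool set" m] by simp
  ultimately show ?thesis by (simp add: card_image inj_on_def)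
qed

lemma finite_strings [simp]: "finite {r :: bool list. length r = n \<and> P r}"
  by (rule finite_subset[OF _ finite_lists_length_eq[of "UNIV :: bool set" n]]) auto

lemma card_strings: "card {r :: bool list. length r = n} = 2 ^ n"
  using card_extensions[of "[]" n] by simp

lemma power2_diff: "k \<le> n \<Longrightarrow> (2::real) ^ (n - k) = 2 ^ n * (1/2) ^ k"
  by (simp add: power_diff power_one_over)

text \<open>Incomparable strings have disjoint sets of extensions at a common length
  \<open>N\<close>, and there are only 2^N strings of that length.\<close>

lemma kraft_inequality:
  fixes F :: "bool list set"
  assumes "finite F" and pf: "\<And>s t. s \<in> F \<Longrightarrow> t \<in> F \<Longrightarrow> prefix s t \<Longrightarrow> s = t"
  shows "(\<Sum>s\<in>F. (1/2) ^ length s :: real) \<le> 1"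
proof -
  define N where "N = Max (insert 0 (length ` F))"
  have N: "length s \<le> N" if "s \<in> F" for s
    using that assms(1) unfolding N_def by (intro Max_ge) auto
  define E where "E s = {r :: bool list. length r = N \<and> take (length s) r = s}" for s
  have "(\<Sum>s\<in>F. 2 ^ (N - length s)) = (\<Sum>s\<in>F. card (E s))"
    unfolding E_def using N card_extensions by (intro sum.cong) auto
  also have "\<dots> = card (\<Union>s\<in>F. E s)"
  proof (rule card_UN_disjoint[symmetric])
    show "\<forall>s\<in>F. \<forall>t\<in>F. s \<noteq> t \<longrightarrow> E s \<inter> E t = {}"
    proof (intro ballI impI equals0I)
      fix s t r assume *: "s \<in> F" "t \<in> F" "s \<noteq> t" "r \<in> E s \<inter> E t"
      then have "s = take (length s) r" "t = take (length t) r" by (auto simp: E_def)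
      then have "prefix s r" "prefix t r" using take_is_prefix by metis+
      then have "prefix s t \<or> prefix t s" by (rule prefix_same_cases)
      with * pf show False by blast
    qed
  qed (auto simp: assms E_def)
  also have "\<dots> \<le> card {r :: bool list. length r = N}"
    by (rule card_mono) (use finite_strings[of N "\<lambda>_. True"] in \<open>auto simp: E_def\<close>)
  finally have "(\<Sum>s\<in>F. 2 ^ (N - length s)) \<le> (2 ^ N :: nat)" by (simp add: card_strings)
  then have "real (\<Sum>s\<in>F. 2 ^ (N - length s)) \<le> 2 ^ N"
    by (metis of_nat_le_iff of_nat_numeral of_nat_power)
  moreover have "real (\<Sum>s\<in>F. 2 ^ (N - length s)) = 2 ^ N * (\<Sum>s\<in>F. (1/2) ^ length s)"
    unfolding of_nat_sum sum_distrib_left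
    by (rule sum.cong) (use N power2_diff in auto)
  ultimately show ?thesis by simp
qed

text \<open>The most significant digit comes first, so that truncation is division by a power of two
  and prefixes correspond to enclosing dyadic intervals.\<close>

definition binary :: "nat \<Rightarrow> nat \<Rightarrow> bool list" where
  "binary n v = map (\<lambda>j. odd (v div 2 ^ (n - Suc j))) [0..<n]"

lemma length_binary [simp]: "length (binary n v) = n"
  by (simp add: binary_def)

lemma binary_Suc: "binary (Suc n) v = binary n (v div 2) @ [odd v]"
  by (auto simp: binary_def Suc_diff_Suc div_mult2_eq[symmetric] simp flip: power_Suc)

lemma take_binary: "take n (binary (n + k) v) = binary n (v div 2 ^ k)"
proof (induction k arbitrary: v)
  case (Suc k)
  then show ?case by (simp add: binary_Suc div_mult2_eq[symmetric])
qed simp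

lemma binary_inj: "v < 2 ^ n \<Longrightarrow> w < 2 ^ n \<Longrightarrow> binary n v = binary n w \<Longrightarrow> v = w"
proof (induction n arbitrary: v w)
  case (Suc n)
  then have "v div 2 = w div 2" "odd v = odd w" by (auto simp: binary_Suc)
  then show ?case by presburger
qed simp

lemma prefix_binary:
  assumes "prefix (binary n v) (binary m w)" and "v < 2 ^ n" and "w < 2 ^ m"
  shows "n \<le> m" and "v = w div 2 ^ (m - n)"
proof -
  show nm: "n \<le> m" using prefix_length_le[OF assms(1)] by simp
  have "binary n v = take n (binary (n + (m - n)) w)"
    using assms(1) nm by (auto simp: prefix_def)
  then have "binary n v = binary n (w div 2 ^ (m - n))" unfolding take_binary .
  moreover have "w div 2 ^ (m - n) < 2 ^ n"
    by (rule less_mult_imp_div_less) (use assms(3) nm in \<open>simp flip: power_add\<close>)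
  ultimately show "v = w div 2 ^ (m - n)" using binary_inj assms(2) by blast
qed

text \<open>The request \<open>i\<close> receives an aligned dyadic interval of length \<open>2\<^sup>-\<^sup>d\<^sup>-\<^sup>1\<close> inside the interval of
  length \<open>2\<^sup>-\<^sup>d\<close> (\<open>d = d i\<close>) following those of the earlier requests.\<close>

lemma machine_existence:
  fixes G :: "nat \<Rightarrow> bool" and w :: "nat \<Rightarrow> bool list" and d :: "nat \<Rightarrow> nat"
  assumes opt: "optimal_machine U" and G: "rec {} G" and w: "rec {} w" and d: "rec {} d"
    and weight: "\<And>N. (\<Sum>i | i < N \<and> G i. (1/2) ^ d i :: real) \<le> 1"
  shows "\<exists>c. \<forall>i. G i \<longrightarrow> (\<exists>s. U s = Some (w i) \<and> length s \<le> d i + c)"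
proof -
  \<comment> \<open>2^(D i) is a common denominator of the weights up to \<open>i\<close>, and
    \<open>num i\<close> over it is the weight \<open>S i\<close> of the requests before
    \<open>i\<close>. Exact arithmetic on numbers makes the words computable.\<close>
  define D where "D = (\<lambda>i. \<Sum>j<Suc i. d j)"
  define num where "num = (\<lambda>i. \<Sum>j<i. if G j then 2 ^ (D i - d j) else 0 :: nat)"
  \<comment> \<open>\<open>v i\<close> is \<open>S i\<close> rounded up to a multiple of 2^-(d i +
    1). Rounding loses less than half of the interval of length 2^-(d i), and an aligned interval of
    half that length still fits.\<close>
  define v where "v = (\<lambda>i. LEAST x. num i * 2 ^ Suc (d i) \<le> x * 2 ^ D i)"
  define word where "word = (\<lambda>i. binary (Suc (d i)) (v i))"
  define S where "S i = (\<Sum>j<i. if G j then (1/2) ^ d j else 0 :: real)" for i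
  have dD: "d j \<le> D i" if "j \<le> i" for i j
    using that unfolding D_def by (intro member_le_sum) auto
  have S_eq: "S i = (\<Sum>j | j < i \<and> G j. (1/2) ^ d j)" for i
    unfolding S_def by (auto simp: sum.If_cases intro!: sum.cong)
  have S_mono: "S i + (1/2) ^ d i \<le> S j" if "i < j" "G i" for i j
  proof -
    have "S (Suc i) \<le> S j" unfolding S_def by (rule sum_mono2) (use that in auto)
    with that show ?thesis by (simp add: S_def)
  qed
  have S1: "S i + (1/2) ^ d i \<le> 1" if "G i" for i
    using S_mono[OF lessI that] weight[of "Suc i"] S_eq[of "Suc i"] by simp
  have num: "real (num i) = S i * 2 ^ D i" for i
    unfolding num_def S_def of_nat_sum sum_distrib_right
    by (rule sum.cong) (use dD power2_diff in auto)
  have v_iff: "num i * 2 ^ Suc (d i) \<le> x * 2 ^ D i \<longleftrightarrow> S i * 2 ^ Suc (d i) \<le> real x" for i x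
  proof -
    have "num i * 2 ^ Suc (d i) \<le> x * 2 ^ D i \<longleftrightarrow> real (num i * 2 ^ Suc (d i)) \<le> real (x * 2 ^ D i)"
      by (simp only: of_nat_le_iff)
    also have "\<dots> \<longleftrightarrow> (S i * 2 ^ Suc (d i)) * 2 ^ D i \<le> real x * 2 ^ D i"
      by (simp add: num mult_ac)
    finally show ?thesis by simp
  qed
  have v_ex: "\<exists>x. num i * 2 ^ Suc (d i) \<le> x * 2 ^ D i" for i
    unfolding v_iff using real_arch_simple by blast
  have v_ge: "S i * 2 ^ Suc (d i) \<le> real (v i)" for i
  proof -
    have "num i * 2 ^ Suc (d i) \<le> v i * 2 ^ D i" unfolding v_def by (rule LeastI_ex[OF v_ex])
    then show ?thesis unfolding v_iff .
  qed
  have S_ge: "0 \<le> S i" for i unfolding S_def by (rule sum_nonneg) auto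
  have v_lt: "real (v i) < S i * 2 ^ Suc (d i) + 1" for i
  proof (cases "v i")
    case 0 then show ?thesis using S_ge[of i] by (simp add: add_nonneg_pos)
  next
    case (Suc x)
    then have "\<not> num i * 2 ^ Suc (d i) \<le> x * 2 ^ D i"
      unfolding v_def by (metis lessI not_less_Least)
    then show ?thesis using Suc unfolding v_iff by simp
  qed
  have v_bound: "v i < 2 ^ Suc (d i)" if "G i" for i
  proof -
    have "S i * 2 ^ Suc (d i) + 2 = (S i + (1/2) ^ d i) * 2 ^ Suc (d i)"
      by (simp add: power_one_over field_simps)
    also have "\<dots> \<le> 1 * 2 ^ Suc (d i)" by (rule mult_right_mono) (use S1[OF that] in auto)
    finally have "real (v i) < 2 ^ Suc (d i)" using v_lt[of i] by linarith
    then show ?thesis by (metis of_nat_less_iff of_nat_numeral of_nat_power)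
  qed
  define lo where "lo i = real (v i) / 2 ^ Suc (d i)" for i
  have lo: "S i \<le> lo i" "lo i + (1/2) ^ Suc (d i) < S i + (1/2) ^ d i" for i
  proof -
    define e where "e = (2::real) ^ Suc (d i)"
    have e: "e > 0" and e1: "(1/2) ^ Suc (d i) = 1 / e" and e2: "(1/2) ^ d i = 2 / e"
      by (simp_all add: e_def power_one_over)
    have "S i * e \<le> real (v i)" "real (v i) < S i * e + 1"
      using v_ge[of i] v_lt[of i] unfolding e_def .
    moreover have "S i = S i * e / e" using e by simp
    ultimately have "S i \<le> real (v i) / e" "real (v i) / e + 1 / e < S i + 2 / e"
      using e by (metis divide_right_mono less_imp_le,
        smt (verit) add_divide_distrib divide_strict_right_mono)
    then show "S i \<le> lo i" "lo i + (1/2) ^ Suc (d i) < S i + (1/2) ^ d i"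
      unfolding lo_def e_def[symmetric] e1 e2 by simp_all
  qed
  \<comment> \<open>If the word of \<open>i\<close> is a prefix of the word of \<open>j\<close>,
    then the interval of \<open>j\<close> begins inside that of \<open>i\<close>; but distinct
    requests have disjoint intervals.\<close>
  have inj: "i = j" if ij: "G i" "G j" "prefix (word i) (word j)" for i j
  proof -
    have le: "Suc (d i) \<le> Suc (d j)" and v: "v i = v j div 2 ^ (Suc (d j) - Suc (d i))"
      using prefix_binary[OF ij(3)[unfolded word_def] v_bound v_bound] ij by auto
    define k where "k = d j - d i"
    have k: "d j = d i + k" using le by (simp add: k_def)
    have "v i * 2 ^ k \<le> v j" "v j < (v i + 1) * 2 ^ k"
      unfolding v using k by (simp_all add: dividend_less_div_times)
    then have "real (v i * 2 ^ k) \<le> real (v j)" "real (v j) < real ((v i + 1) * 2 ^ k)"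
      by (simp_all only: of_nat_le_iff of_nat_less_iff)
    then have "lo i \<le> lo j" "lo j < lo i + (1/2) ^ Suc (d i)"
      unfolding lo_def k by (simp_all add: field_simps power_add power_one_over)
    moreover have "(0::real) < (1/2) ^ Suc (d j)" by simp
    ultimately show ?thesis
      using S_mono[of i j] S_mono[of j i] ij(1,2) lo[of i] lo[of j] by (cases i j rule: linorder_cases) auto
  qed
  define M where "M s = (if \<exists>i. G i \<and> word i = s then Some (w (THE i. G i \<and> word i = s)) else None)" for s
  have the: "(THE j. G j \<and> word j = word i) = i" if "G i" for i
    by (rule the_equality) (use that inj in auto)
  have M: "M s = Some t \<longleftrightarrow> (\<exists>i. G i \<and> word i = s \<and> t = w i)" for s t
    unfolding M_def using inj by (auto simp: the) (metis prefix_order.refl)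
  have rec_D: "rec {} D"
    unfolding D_def by (intro rec_intros rec_comp[OF d])
  have rec_num: "rec {} num"
    unfolding num_def by (intro rec_intros rec_comp[OF d] rec_comp[OF G] rec_comp[OF rec_D])
  have rec_v: "rec {} v"
    unfolding v_def
    by (rule rec_Least[OF _ v_ex]) (intro rec_intros rec_comp[OF d] rec_comp[OF rec_num] rec_comp[OF rec_D])
  have rec_word: "rec {} word"
    unfolding word_def binary_def by (intro rec_intros rec_comp[OF d] rec_comp[OF rec_v])
  have "rec {} (\<lambda>z. \<not> (G (snd z) \<and> string_code (word (snd z)) = (fst z :: nat)))"
    by (intro rec_intros rec_comp[OF G] rec_comp[OF rec_word])
  then obtain q where q: "\<And>x n. eval {} q (prod_encode (x, n)) (of_bool (\<not> (G n \<and> string_code (word n) = x)))"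
    unfolding rec_def by (auto simp: enc_prod_def enc_bool_def)
  have "rec {} (\<lambda>i. string_code (w i))" by (intro rec_intros w)
  then obtain p where p: "\<And>i. eval {} p i (string_code (w i))" unfolding rec_def by auto
  have "partial_computable M"
    unfolding partial_computable_def
  proof (intro exI allI)
    fix s t
    have "eval {} (Comp p (Mu q)) (string_code s) (string_code t) \<longleftrightarrow>
      (\<exists>i. G i \<and> word i = s \<and> (\<forall>m<i. \<not> (G m \<and> word m = s)) \<and> eval {} p i (string_code t))"
      unfolding eval_Comp_iff eval_Mu_iff[OF q] by (auto simp: inj_string_code)
    also have "\<dots> \<longleftrightarrow> (\<exists>i. G i \<and> word i = s \<and> eval {} p i (string_code t))"
      using inj by (metis nat_neq_iff prefix_order.refl)
    also have "\<dots> \<longleftrightarrow> M s = Some t"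
      unfolding M using p eval_deterministic inj_string_code by metis
    finally show "M s = Some t \<longleftrightarrow> eval {} (Comp p (Mu q)) (string_code s) (string_code t)" by simp
  qed
  moreover have "\<forall>s\<in>dom M. \<forall>t\<in>dom M. prefix s t \<longrightarrow> s = t"
    unfolding dom_def using M inj by auto
  ultimately have "prefix_free_machine M" unfolding prefix_free_machine_def by blast
  then obtain c where c: "\<And>s t. M s = Some t \<Longrightarrow> \<exists>s'. U s' = Some t \<and> length s' \<le> length s + c"
    using opt unfolding optimal_machine_def by blast
  have "\<exists>s. U s = Some (w i) \<and> length s \<le> d i + Suc c" if "G i" for i
  proof -
    have "M (word i) = Some (w i)" using M that by blast
    from c[OF this] show ?thesis by (simp add: word_def)
  qed
  then show ?thesis by blast
qed

section \<open>Densities of trees of strings\<close>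

lemma bij_betw_binary: "bij_betw (binary n) {..<2 ^ n} {r. length r = n}"
proof -
  have inj: "inj_on (binary n) {..<2 ^ n}" using binary_inj by (auto simp: inj_on_def)
  moreover have "binary n ` {..<2 ^ n} = {r. length r = n}"
    using inj finite_strings[of n "\<lambda>_. True"] by (intro card_subset_eq) (auto simp: card_image card_strings)
  ultimately show ?thesis by (simp add: bij_betw_def)
qed

lemma rec_binary [rec_intros]:
  assumes "rec A n" and "rec A v" shows "rec A (\<lambda>x. binary (n x) (v x))"
  unfolding binary_def by (intro rec_intros rec_comp[OF assms(1)] rec_comp[OF assms(2)] assms)

lemma rec_card_strings [rec_intros]:
  fixes P :: "'a::enc \<Rightarrow> bool list \<Rightarrow> bool"
  assumes "rec A (\<lambda>z. P (fst z) (snd z))" and "rec A n"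
  shows "rec A (\<lambda>x. card {r. length r = n x \<and> P x r})"
proof -
  have eq: "card {r. length r = m \<and> Q r} = (\<Sum>v<2 ^ m. if Q (binary m v) then 1 else 0)" for m Q
  proof -
    have "card {r. length r = m \<and> Q r} = (\<Sum>r | length r = m. if Q r then 1 else 0)"
      using finite_strings[of m "\<lambda>_. True"] by (simp add: sum.If_cases Collect_conj_eq)
    also have "\<dots> = (\<Sum>v<2 ^ m. if Q (binary m v) then 1 else 0)"
      by (rule sum.reindex_bij_betw[OF bij_betw_binary, symmetric])
    finally show ?thesis .
  qed
  show ?thesis
    unfolding eq by (intro rec_intros rec_comp2[OF assms(1)] rec_comp[OF assms(2)] assms(2))
qed

lemma rec_ex_string [rec_intros]:
  fixes P :: "'a::enc \<Rightarrow> bool list \<Rightarrow> bool"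
  assumes "rec A (\<lambda>z. P (fst z) (snd z))" and "rec A n"
  shows "rec A (\<lambda>x. \<exists>r. length r = n x \<and> P x r)"
proof -
  have eq: "(\<exists>r. length r = m \<and> Q r) \<longleftrightarrow> card {r. length r = m \<and> Q r} \<noteq> 0" for m and Q :: "bool list \<Rightarrow> bool"
    by auto
  show ?thesis
    unfolding eq by (intro rec_intros assms)
qed

section \<open>Densities, trees and lower bounds for measures\<close>

definition mu :: "(bool list \<Rightarrow> bool) \<Rightarrow> nat \<Rightarrow> real" where
  "mu P n = card {r. length r = n \<and> P r} / 2 ^ n"

definition tree :: "(bool list \<Rightarrow> bool) \<Rightarrow> bool" where
  "tree T \<longleftrightarrow> (\<forall>r m. T r \<longrightarrow> T (take m r))"

text \<open>For a tree this says that its paths have measure at least 2^-k. The form without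
  fractions shows that for decidable \<open>T\<close> the failure is computably enumerable.\<close>

definition big :: "(bool list \<Rightarrow> bool) \<Rightarrow> nat \<Rightarrow> bool" where
  "big T k \<longleftrightarrow> (\<forall>n. 2 ^ n \<le> 2 ^ k * card {r. length r = n \<and> T r})"

lemma le_mu_iff: "(1/2) ^ k \<le> mu P n \<longleftrightarrow> 2 ^ n \<le> 2 ^ k * card {r. length r = n \<and> P r}"
proof -
  have "(1/2) ^ k \<le> mu P n \<longleftrightarrow> (2::real) ^ n \<le> 2 ^ k * card {r. length r = n \<and> P r}"
    unfolding mu_def by (simp add: power_one_over field_simps)
  also have "\<dots> \<longleftrightarrow> real (2 ^ n) \<le> real (2 ^ k * card {r. length r = n \<and> P r})" by simp
  finally show ?thesis by (simp only: of_nat_le_iff)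
qed

lemma big_iff_mu: "big T k \<longleftrightarrow> (\<forall>n. (1/2) ^ k \<le> mu T n)"
  unfolding big_def le_mu_iff ..

lemma treeD: "tree T \<Longrightarrow> T r \<Longrightarrow> T (take m r)"
  unfolding tree_def by blast

lemma mu_nonneg: "0 \<le> mu P n"
  by (simp add: mu_def)

lemma mu_mono: "(\<And>r. length r = n \<Longrightarrow> P r \<Longrightarrow> Q r) \<Longrightarrow> mu P n \<le> mu Q n"
  unfolding mu_def by (intro divide_right_mono of_nat_mono card_mono) auto

lemma mu_cong: "(\<And>r. length r = n \<Longrightarrow> P r = Q r) \<Longrightarrow> mu P n = mu Q n"
  by (intro antisym mu_mono) auto

lemma mu_True: "mu (\<lambda>_. True) n = 1"
  by (simp add: mu_def card_strings)

lemma mu_UN: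
  assumes "finite I" shows "mu (\<lambda>r. \<exists>i\<in>I. P i r) n \<le> (\<Sum>i\<in>I. mu (P i) n)"
proof -
  have "{r. length r = n \<and> (\<exists>i\<in>I. P i r)} = (\<Union>i\<in>I. {r. length r = n \<and> P i r})" by blast
  then have "card {r. length r = n \<and> (\<exists>i\<in>I. P i r)} \<le> (\<Sum>i\<in>I. card {r. length r = n \<and> P i r})"
    using card_UN_le[OF assms] by simp
  then have "real (card {r. length r = n \<and> (\<exists>i\<in>I. P i r)}) \<le> real (\<Sum>i\<in>I. card {r. length r = n \<and> P i r})"
    by (rule of_nat_mono)
  then show ?thesis
    unfolding mu_def sum_divide_distrib[symmetric] of_nat_sum by (rule divide_right_mono) simp
qed

lemma mu_disj: "mu (\<lambda>r. P r \<or> Q r) n \<le> mu P n + mu Q n"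
  using mu_UN[of "{0, 1::nat}" "\<lambda>i. if i = 0 then P else Q" n] by simp

lemma mu_split: "mu P n = mu (\<lambda>r. P r \<and> Q r) n + mu (\<lambda>r. P r \<and> \<not> Q r) n"
proof -
  have "{r. length r = n \<and> P r} = {r. length r = n \<and> P r \<and> Q r} \<union> {r. length r = n \<and> P r \<and> \<not> Q r}"
    by blast
  then have "card {r. length r = n \<and> P r} = card {r. length r = n \<and> P r \<and> Q r} + card {r. length r = n \<and> P r \<and> \<not> Q r}"
    by (simp only:) (rule card_Un_disjoint, auto)
  then show ?thesis by (simp add: mu_def add_divide_distrib)
qed

lemma mu_take:
  assumes "n \<le> N" shows "mu (\<lambda>r. P (take n r)) N = mu P n"
proof -
  have "{r. length r = N \<and> P (take n r)} = (\<Union>s\<in>{s. length s = n \<and> P s}. {r. length r = N \<and> take (length s) r = s})"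
    using assms by (auto simp: min_def)
  then have "card {r. length r = N \<and> P (take n r)} = (\<Sum>s | length s = n \<and> P s. card {r. length r = N \<and> take (length s) r = s})"
    by (simp only:) (rule card_UN_disjoint, auto)
  also have "\<dots> = (\<Sum>s | length s = n \<and> P s. 2 ^ (N - n))"
    by (rule sum.cong) (use assms card_extensions in auto)
  finally show ?thesis
    unfolding mu_def using assms by (simp add: power2_diff power_one_over)
qed

text \<open>Truncation compares densities at different levels; in particular the density of a tree
  never increases with the level.\<close>

lemma mu_level:
  assumes "n \<le> N" and "\<And>r. length r = N \<Longrightarrow> P r \<Longrightarrow> Q (take n r)"
  shows "mu P N \<le> mu Q n"
  unfolding mu_take[OF assms(1), symmetric] by (rule mu_mono) (use assms in auto)

lemma mu_extensions: "length s \<le> n \<Longrightarrow> mu (\<lambda>r. take (length s) r = s) n = (1/2) ^ length s"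
  unfolding mu_def by (simp add: card_extensions power2_diff)

lemma mu_posD: "0 < mu P n \<Longrightarrow> \<exists>r. length r = n \<and> P r"
  unfolding mu_def by (cases "{r. length r = n \<and> P r} = {}") auto

text \<open>Comparability with \<open>s\<close> instead of extension of \<open>s\<close>: the
  prefixes of \<open>s\<close> belong to it as well, which makes it a tree.\<close>

definition cone :: "bool list \<Rightarrow> bool list \<Rightarrow> bool" where
  "cone s r \<longleftrightarrow> take (length s) r = take (length r) s"

lemma cone_take: "cone s r \<Longrightarrow> cone s (take m r)"
proof -
  assume "cone s r"
  then have "take m (take (length s) r) = take m (take (length r) s)" by (simp add: cone_def)
  then show ?thesis by (simp add: cone_def min.commute)
qed

lemma cone_Nil [simp]: "cone [] r"
  by (simp add: cone_def)

lemma rec_cone [rec_intros]: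
  assumes "rec A f" and "rec A g" shows "rec A (\<lambda>x. cone (f x) (g x))"
  unfolding cone_def by (intro rec_intros assms)

text \<open>The strings through which the tree has density at least \<open>2\<^sup>-\<^sup>2\<^sup>m\<^sup>-\<^sup>k\<^sup>-\<^sup>2\<close> at each level \<open>m\<close>; this makes
  nonemptiness of a subclass imply a lower bound on its measure.\<close>

definition star :: "(bool list \<Rightarrow> bool) \<Rightarrow> nat \<Rightarrow> bool list \<Rightarrow> bool" where
  "star T k r \<longleftrightarrow> T r \<and> (\<forall>m\<le>length r. 2 ^ length r
     \<le> 2 ^ (2 * m + k + 2) * card {q. length q = length r \<and> T q \<and> take m q = take m r})"

lemma star_iff_mu: "star T k r \<longleftrightarrow> T r \<and>
    (\<forall>m\<le>length r. (1/2) ^ (2 * m + k + 2) \<le> mu (\<lambda>q. T q \<and> take m q = take m r) (length r))"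
  unfolding star_def le_mu_iff ..

lemma tree_star: assumes "tree T" shows "tree (star T k)"
  unfolding tree_def
proof (intro allI impI)
  fix r n assume r: "star T k r"
  show "star T k (take n r)"
    unfolding star_iff_mu
  proof (intro conjI allI impI)
    show "T (take n r)" using r assms by (simp add: star_def treeD)
    fix m assume m: "m \<le> length (take n r)"
    then have "(1/2) ^ (2 * m + k + 2) \<le> mu (\<lambda>q. T q \<and> take m q = take m r) (length r)"
      using r by (simp add: star_iff_mu)
    also have "\<dots> \<le> mu (\<lambda>q. T q \<and> take m q = take m (take n r)) (length (take n r))"
    proof (rule mu_level)
      fix q assume "length q = length r" "T q \<and> take m q = take m r"
      then show "T (take (length (take n r)) q) \<and> take m (take (length (take n r)) q) = take m (take n r)"
        using treeD[OF assms] m by (simp add: min.absorb1)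
    qed simp
    finally show "(1/2) ^ (2 * m + k + 2) \<le> mu (\<lambda>q. T q \<and> take m q = take m (take n r)) (length (take n r))" .
  qed
qed

text \<open>At most 2^m strings of length m have density below 2^-(2m+k+2) above them, so removing
  them costs at most 2^-(m+k+2). Summed over all m this is at most 2^-(k+1), half of the guaranteed
  density 2^-k.\<close>

lemma big_star: assumes "big T k" shows "big (star T k) (Suc k)"
  unfolding big_iff_mu
proof
  fix N
  define bad where "bad m s \<longleftrightarrow> mu (\<lambda>q. T q \<and> take m q = s) N < (1/2) ^ (2 * m + k + 2)" for m s
  have bad: "mu (\<lambda>r. T r \<and> bad m (take m r)) N \<le> (1/2) ^ (k + 2) * (1/2) ^ m" if "m \<le> N" for m
  proof -
    have "mu (\<lambda>r. T r \<and> bad m (take m r)) N \<le> mu (\<lambda>r. \<exists>s\<in>{s. length s = m \<and> bad m s}. T r \<and> take m r = s) N"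
      by (rule mu_mono) (use that in auto)
    also have "\<dots> \<le> (\<Sum>s | length s = m \<and> bad m s. mu (\<lambda>r. T r \<and> take m r = s) N)"
      by (rule mu_UN) simp
    also have "\<dots> \<le> (\<Sum>s | length s = m \<and> bad m s. (1/2) ^ (2 * m + k + 2))"
      by (rule sum_mono) (simp add: bad_def)
    also have "\<dots> = real (card {s. length s = m \<and> bad m s}) * (1/2) ^ (2 * m + k + 2)" by simp
    also have "\<dots> \<le> 2 ^ m * (1/2) ^ (2 * m + k + 2)"
    proof (rule mult_right_mono)
      have "card {s. length s = m \<and> bad m s} \<le> 2 ^ m"
        using card_mono[of "{s. length s = m}" "{s. length s = m \<and> bad m s}"] finite_strings[of m "\<lambda>_. True"]
        by (auto simp: card_strings)
      then show "real (card {s. length s = m \<and> bad m s}) \<le> 2 ^ m"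
        by (metis of_nat_le_iff of_nat_numeral of_nat_power)
    qed simp
    also have "\<dots> = (2 ^ m * (1/2) ^ m) * ((1/2) ^ (k + 2) * (1/2) ^ m)"
      unfolding mult_2 power_add by (simp only: mult_ac)
    also have "(2::real) ^ m * (1/2) ^ m = 1" by (simp flip: power_mult_distrib)
    finally show ?thesis by simp
  qed
  have "(\<Sum>m<n. (1/2::real) ^ m) = 2 - 2 * (1/2) ^ n" for n
    by (induction n) auto
  then have geo: "(\<Sum>m<n. (1/2::real) ^ m) \<le> 2" for n by simp
  have "(1/2) ^ k \<le> mu T N" using assms by (simp add: big_iff_mu)
  also have "\<dots> \<le> mu (\<lambda>r. star T k r \<or> (\<exists>m\<in>{..N}. T r \<and> bad m (take m r))) N"
    by (rule mu_mono) (auto simp: star_iff_mu bad_def not_less)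
  also have "\<dots> \<le> mu (star T k) N + mu (\<lambda>r. \<exists>m\<in>{..N}. T r \<and> bad m (take m r)) N"
    by (rule mu_disj)
  also have "mu (\<lambda>r. \<exists>m\<in>{..N}. T r \<and> bad m (take m r)) N \<le> (\<Sum>m\<in>{..N}. mu (\<lambda>r. T r \<and> bad m (take m r)) N)"
    by (rule mu_UN) simp
  also have "\<dots> \<le> (\<Sum>m\<in>{..N}. (1/2) ^ (k + 2) * (1/2) ^ m)"
    by (rule sum_mono) (rule bad, simp)
  also have "\<dots> = (1/2) ^ (k + 2) * (\<Sum>m<Suc N. (1/2) ^ m)"
    unfolding sum_distrib_left lessThan_Suc_atMost ..
  also have "\<dots> \<le> (1/2) ^ (k + 2) * 2" by (rule mult_left_mono[OF geo]) simp
  finally show "(1/2) ^ Suc k \<le> mu (star T k) N" by (simp add: field_simps)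
qed

text \<open>A single extension of \<open>s\<close> in \<open>star T k\<close> at some level
  certifies the density of \<open>T\<close> above \<open>s\<close> at that level.\<close>

lemma big_above_star:
  assumes T: "tree T" and ext: "\<And>n. length s \<le> n \<Longrightarrow> \<exists>r. length r = n \<and> star T k r \<and> take (length s) r = s"
  shows "big (\<lambda>r. T r \<and> cone s r) (2 * length s + k + 2)"
proof -
  have *: "(1/2) ^ (2 * length s + k + 2) \<le> mu (\<lambda>r. T r \<and> take (length s) r = s) n" if n: "length s \<le> n" for n
  proof -
    obtain r where r: "length r = n" "star T k r" "take (length s) r = s" using ext[OF n] by blast
    have "(1/2) ^ (2 * length s + k + 2) \<le> mu (\<lambda>q. T q \<and> take (length s) q = take (length s) r) (length r)"
      using r n unfolding star_iff_mu by blast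
    with r show ?thesis by simp
  qed
  show ?thesis
    unfolding big_iff_mu
  proof
    fix n
    show "(1/2) ^ (2 * length s + k + 2) \<le> mu (\<lambda>r. T r \<and> cone s r) n"
    proof (cases "length s \<le> n")
      case True
      have "mu (\<lambda>r. T r \<and> take (length s) r = s) n \<le> mu (\<lambda>r. T r \<and> cone s r) n"
        by (rule mu_mono) (use True in \<open>simp add: cone_def\<close>)
      with *[OF True] show ?thesis by linarith
    next
      \<comment> \<open>Below \<open>length s\<close> the cone has only one string per level, a
        prefix of \<open>s\<close>; the bound is inherited from level
        \<open>length s\<close>.\<close>
      case False
      have "mu (\<lambda>r. T r \<and> take (length s) r = s) (length s) \<le> mu (\<lambda>r. T r \<and> cone s r) n"
        by (rule mu_level) (use False T in \<open>auto simp: cone_def treeD\<close>)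
      with *[of "length s"] show ?thesis by simp
    qed
  qed
qed

text \<open>Independence of events on disjoint blocks, by counting: a subset of \<open>S\<close>
  that avoids \<open>B z\<close> splits uniquely into a part outside \<open>B z\<close> and a proper
  subset of \<open>B z\<close>.\<close>

lemma card_avoiding_blocks:
  assumes "finite F" and "finite S" and "\<And>z. z \<in> F \<Longrightarrow> B z \<subseteq> S"
    and "\<And>z z'. z \<in> F \<Longrightarrow> z' \<in> F \<Longrightarrow> z \<noteq> z' \<Longrightarrow> B z \<inter> B z' = {}"
  shows "real (card {Y. Y \<subseteq> S \<and> (\<forall>z\<in>F. \<not> B z \<subseteq> Y)}) = 2 ^ card S * (\<Prod>z\<in>F. 1 - (1/2) ^ card (B z))"
  using assms
proof (induction F arbitrary: S)
  case empty
  then show ?case by (simp add: card_Pow flip: Pow_def)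
next
  case (insert z F)
  let ?G = "{Y. Y \<subseteq> S - B z \<and> (\<forall>z\<in>F. \<not> B z \<subseteq> Y)}"
  have BS: "B z \<subseteq> S" using insert.prems(2)[of z] by simp
  then have fin: "finite (B z)" "finite (S - B z)" using insert.prems(1) finite_subset by auto
  have disj: "B z' \<inter> B z = {}" if "z' \<in> F" for z'
    by (rule insert.prems(3)) (use that insert.hyps in auto)
  have IH: "real (card ?G) = 2 ^ card (S - B z) * (\<Prod>z\<in>F. 1 - (1/2) ^ card (B z))"
  proof (rule insert.IH)
    show "B z' \<subseteq> S - B z" if "z' \<in> F" for z' using insert.prems(2)[of z'] disj[of z'] that by blast
    show "B z1 \<inter> B z2 = {}" if "z1 \<in> F" "z2 \<in> F" "z1 \<noteq> z2" for z1 z2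
      by (rule insert.prems(3)) (use that in auto)
  qed (rule fin)
  have "bij_betw (\<lambda>(Y, Z). Y \<union> Z) (?G \<times> (Pow (B z) - {B z})) {Y. Y \<subseteq> S \<and> (\<forall>z\<in>insert z F. \<not> B z \<subseteq> Y)}"
  proof (rule bij_betwI[where g = "\<lambda>Y. (Y - B z, Y \<inter> B z)"])
    show "(\<lambda>(Y, Z). Y \<union> Z) \<in> ?G \<times> (Pow (B z) - {B z}) \<rightarrow> {Y. Y \<subseteq> S \<and> (\<forall>z\<in>insert z F. \<not> B z \<subseteq> Y)}"
    proof (rule Pi_I)
      fix p assume "p \<in> ?G \<times> (Pow (B z) - {B z})"
      then obtain Y Z where p: "p = (Y, Z)" and
        *: "Y \<subseteq> S - B z" "\<forall>z\<in>F. \<not> B z \<subseteq> Y" "Z \<subseteq> B z" "Z \<noteq> B z" by blast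
      have "Y \<union> Z \<subseteq> S" using * BS by auto
      moreover have "\<not> B z' \<subseteq> Y \<union> Z" if "z' \<in> F" for z'
      proof
        assume "B z' \<subseteq> Y \<union> Z"
        with *(3) disj[OF that] have "B z' \<subseteq> Y" by blast
        with *(2) that show False by blast
      qed
      moreover have "\<not> B z \<subseteq> Y \<union> Z" using * by blast
      ultimately show "(\<lambda>(Y, Z). Y \<union> Z) p \<in> {Y. Y \<subseteq> S \<and> (\<forall>z\<in>insert z F. \<not> B z \<subseteq> Y)}"
        by (simp add: p)
    qed
    show "(\<lambda>Y. (Y - B z, Y \<inter> B z)) \<in> {Y. Y \<subseteq> S \<and> (\<forall>z\<in>insert z F. \<not> B z \<subseteq> Y)} \<rightarrow> ?G \<times> (Pow (B z) - {B z})"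
      by auto
  qed auto
  then have "card {Y. Y \<subseteq> S \<and> (\<forall>z\<in>insert z F. \<not> B z \<subseteq> Y)} = card ?G * card (Pow (B z) - {B z})"
    by (simp only: bij_betw_same_card[symmetric] card_cartesian_product)
  also have "card (Pow (B z) - {B z}) = 2 ^ card (B z) - 1"
    using fin by (simp add: card_Pow)
  finally have "real (card {Y. Y \<subseteq> S \<and> (\<forall>z\<in>insert z F. \<not> B z \<subseteq> Y)}) = real (card ?G) * (2 ^ card (B z) - 1)"
    by (simp add: of_nat_diff)
  also have "(2::real) ^ card (B z) - 1 = 2 ^ card (B z) * (1 - (1/2) ^ card (B z))"
    by (simp add: right_diff_distrib flip: power_mult_distrib)
  also have "real (card ?G) * (2 ^ card (B z) * (1 - (1/2) ^ card (B z)))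
    = (2 ^ card (S - B z) * 2 ^ card (B z)) * ((1 - (1/2) ^ card (B z)) * (\<Prod>z\<in>F. 1 - (1/2) ^ card (B z)))"
    unfolding IH by (simp only: mult_ac)
  also have "(2::real) ^ card (S - B z) * 2 ^ card (B z) = 2 ^ card S"
    using insert.prems(1) BS fin card_mono[of S "B z"] by (simp add: card_Diff_subset flip: power_add)
  finally show ?case using insert.hyps by simp
qed

lemma mu_avoiding_blocks:
  assumes "finite F" and "\<And>z. z \<in> F \<Longrightarrow> B z \<subseteq> {..<N}"
    and "\<And>z z'. z \<in> F \<Longrightarrow> z' \<in> F \<Longrightarrow> z \<noteq> z' \<Longrightarrow> B z \<inter> B z' = {}"
  shows "mu (\<lambda>r. \<forall>z\<in>F. \<not> (\<forall>j\<in>B z. bit_at r j)) N = (\<Prod>z\<in>F. 1 - (1/2) ^ card (B z))"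
proof -
  have "bij_betw (\<lambda>Y. Y \<restriction> N) {Y. Y \<subseteq> {..<N} \<and> (\<forall>z\<in>F. \<not> B z \<subseteq> Y)}
      {r. length r = N \<and> (\<forall>z\<in>F. \<not> (\<forall>j\<in>B z. bit_at r j))}"
  proof (rule bij_betwI[where g = "\<lambda>r. {j. bit_at r j}"])
    show "(\<lambda>Y. Y \<restriction> N) \<in> {Y. Y \<subseteq> {..<N} \<and> (\<forall>z\<in>F. \<not> B z \<subseteq> Y)} \<rightarrow>
      {r. length r = N \<and> (\<forall>z\<in>F. \<not> (\<forall>j\<in>B z. bit_at r j))}"
    proof (intro Pi_I CollectI conjI ballI)
      fix Y z assume *: "Y \<in> {Y. Y \<subseteq> {..<N} \<and> (\<forall>z\<in>F. \<not> B z \<subseteq> Y)}" "z \<in> F"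
      then obtain j where "j \<in> B z" "j \<notin> Y" by blast
      then show "\<not> (\<forall>j\<in>B z. bit_at (Y \<restriction> N) j)" by auto
    qed simp
    show "{j. bit_at r j} \<restriction> N = r" if "r \<in> {r. length r = N \<and> (\<forall>z\<in>F. \<not> (\<forall>j\<in>B z. bit_at r j))}" for r
      using that by (intro nth_equalityI) (auto simp: bit_at_def)
  qed (auto simp: bit_at_def)
  then have "card {r. length r = N \<and> (\<forall>z\<in>F. \<not> (\<forall>j\<in>B z. bit_at r j))}
      = card {Y. Y \<subseteq> {..<N} \<and> (\<forall>z\<in>F. \<not> B z \<subseteq> Y)}"
    by (simp add: bij_betw_same_card)
  then show ?thesis
    using card_avoiding_blocks[OF assms(1) finite_lessThan[of N] assms(2,3)]
    by (simp add: mu_def)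
qed

text \<open>A lower bound for the probability of avoiding all events becomes an upper bound for the
  sum of their probabilities, a finite form of the second Borel-Cantelli lemma.\<close>

lemma sum_le_inverse_prod:
  assumes "finite F" and "\<And>z. z \<in> F \<Longrightarrow> 0 \<le> x z \<and> x z \<le> (1::real)"
  shows "(\<Prod>z\<in>F. 1 - x z) * (1 + (\<Sum>z\<in>F. x z)) \<le> 1"
  using assms
proof induction
  case (insert z F)
  let ?P = "\<Prod>z\<in>F. 1 - x z" and ?S = "\<Sum>z\<in>F. x z"
  have P: "0 \<le> ?P" and S: "0 \<le> ?S" using insert.prems by (auto intro!: prod_nonneg sum_nonneg)
  have xz: "0 \<le> x z" "x z \<le> 1" using insert.prems by auto
  have "(1 - x z) * (1 + (x z + ?S)) \<le> 1 + ?S"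
    using xz S mult_nonneg_nonneg[of "x z" "x z + ?S"] by (simp add: algebra_simps)
  then have "?P * ((1 - x z) * (1 + (x z + ?S))) \<le> ?P * (1 + ?S)" by (rule mult_left_mono[OF _ P])
  also have "\<dots> \<le> 1" using insert by simp
  finally show ?case using insert.hyps by (simp add: algebra_simps)
qed simp

lemma length_le_enc: "length l \<le> enc l" for l :: "'a::enc list"
proof (induction l)
  case (Cons x l)
  then show ?case using le_prod_encode_2[of "enc l" "enc x"] by (simp add: enc_list_def)
qed simp

lemma enc_le_enc_prod: "enc a \<le> enc (a, b)" "enc b \<le> enc (a, b)"
  unfolding enc_prod_def by (simp_all add: le_prod_encode_1 le_prod_encode_2)

section \<open>Descriptions of numbers and their blocks\<close>

locale optimal =
  fixes U :: "bool list \<rightharpoonup> bool list"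
  assumes opt: "optimal_machine U"
begin

definition machine :: prog where
  "machine = (SOME u. \<forall>s t. U s = Some t \<longleftrightarrow> eval {} u (string_code s) (string_code t))"

lemma U_iff_eval: "U s = Some t \<longleftrightarrow> eval {} machine (string_code s) (string_code t)"
proof -
  have "\<exists>u. \<forall>s t. U s = Some t \<longleftrightarrow> eval {} u (string_code s) (string_code t)"
    using opt unfolding optimal_machine_def prefix_free_machine_def partial_computable_def by blast
  from someI_ex[OF this] show ?thesis unfolding machine_def[symmetric] by blast
qed

text \<open>A string of zeros is an initial segment of the empty oracle, so \<open>c\<close> is
  merely a time bound.\<close>

definition halts :: "nat \<Rightarrow> bool list \<Rightarrow> bool list \<Rightarrow> bool" where
  "halts c s t \<longleftrightarrow> evb (replicate c False) machine (string_code s) (string_code t)"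

lemma U_iff: "U s = Some t \<longleftrightarrow> (\<exists>c. halts c s t)"
  unfolding U_iff_eval halts_def eval_iff_evb empty_initial_segment ..

lemma rec_halts [rec_intros]:
  assumes "rec A c" and "rec A s" and "rec A t" shows "rec A (\<lambda>x. halts (c x) (s x) (t x))"
  unfolding halts_def by (intro rec_intros assms)

lemma prefix_free: "U s = Some t \<Longrightarrow> U s' = Some t' \<Longrightarrow> prefix s s' \<Longrightarrow> s = s'"
  using opt unfolding optimal_machine_def prefix_free_machine_def dom_def by blast

lemma weight_domain:
  assumes "finite F" and "inj_on f F" and "\<And>z. z \<in> F \<Longrightarrow> U (f z) \<noteq> None"
  shows "(\<Sum>z\<in>F. (1/2) ^ length (f z) :: real) \<le> 1"
proof -
  have "(\<Sum>s\<in>f ` F. (1/2) ^ length s :: real) \<le> 1"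
  proof (rule kraft_inequality)
    show "s = t" if "s \<in> f ` F" "t \<in> f ` F" "prefix s t" for s t
    proof -
      have "U s \<noteq> None" "U t \<noteq> None" using that assms(3) by auto
      then show ?thesis using prefix_free that(3) by (metis not_None_eq)
    qed
  qed (use assms(1) in simp)
  then show ?thesis by (simp add: sum.reindex[OF assms(2)])
qed

text \<open>Requesting the \<open>i\<close>-th string with length i + 1 has total weight below 1. So
  \<open>K\<close> is a genuine minimum for every string.\<close>

lemma description_exists: "\<exists>s. U s = Some t"
proof -
  have sum: "(\<Sum>i<N. (1/2) ^ Suc i :: real) = 1 - (1/2) ^ N" for N
    by (induction N) auto
  have "\<exists>c. \<forall>i. True \<longrightarrow> (\<exists>s. U s = Some (dec i) \<and> length s \<le> Suc i + c)"
  proof (rule machine_existence[OF opt])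
    show "(\<Sum>i | i < N \<and> True. (1/2) ^ Suc i :: real) \<le> 1" for N
      using sum[of N] by (simp add: lessThan_def)
  qed (intro rec_intros)+
  then show ?thesis by (metis dec_enc)
qed

lemma K_attained: "\<exists>s. U s = Some t \<and> length s = K U t"
proof -
  have "\<exists>n s. U s = Some t \<and> length s = n" using description_exists by blast
  then show ?thesis unfolding K_def by (rule LeastI_ex)
qed

lemma K_le: "U s = Some t \<Longrightarrow> K U t \<le> length s"
  unfolding K_def by (rule Least_le) blast

text \<open>Its paths are the sets whose initial segments of length m have complexity at least m,
  for all m. Pairs of a description and a halting time are inspected only up to the length of
  \<open>r\<close>, which keeps the predicate decidable.\<close>

definition random_tree :: "bool list \<Rightarrow> bool" where
  "random_tree r \<longleftrightarrow> (\<forall>m\<le>length r. \<forall>c<length r. case dec c of (s, c') \<Rightarrow>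
     \<not> (length s < m \<and> halts c' s (take m r)))"

lemma rec_random_tree [rec_intros]: assumes "rec A f" shows "rec A (\<lambda>x. random_tree (f x))"
  unfolding random_tree_def
  by (intro rec_intros rec_comp[OF assms] assms)

lemma tree_random_tree: "tree random_tree"
  unfolding tree_def
proof (intro allI impI)
  fix r n assume r: "random_tree r"
  show "random_tree (take n r)"
    unfolding random_tree_def
  proof (intro allI impI)
    fix m c assume "m \<le> length (take n r)" "c < length (take n r)"
    then have "m \<le> length r" "c < length r" "take m (take n r) = take m r" by simp_all
    with r show "case dec c of (s, c') \<Rightarrow> \<not> (length s < m \<and> halts c' s (take m (take n r)))"
      unfolding random_tree_def by simp
  qed
qed

text \<open>A string with a description shorter than itself has at most half the weight of that
  description, so by the Kraft inequality the removed cones have measure at most 1/2.\<close>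

lemma big_random_tree: "big random_tree 1"
  unfolding big_iff_mu
proof
  fix N
  define F where "F = {t. length t \<le> N \<and> (\<exists>s. U s = Some t \<and> length s < length t)}"
  have "\<forall>t\<in>F. \<exists>s. U s = Some t \<and> length s < length t" by (auto simp: F_def)
  then obtain f where f: "\<And>t. t \<in> F \<Longrightarrow> U (f t) = Some t \<and> length (f t) < length t" by metis
  have fin: "finite F"
    by (rule finite_subset[OF _ finite_lists_length_le[of "UNIV :: bool set" N]]) (auto simp: F_def)
  have "inj_on f F" using f by (intro inj_onI) (metis option.inject)
  then have w: "(\<Sum>t\<in>F. (1/2) ^ length (f t) :: real) \<le> 1"
    using weight_domain[OF fin] f by simp
  have "1 = mu (\<lambda>_. True) N" by (simp add: mu_True)
  also have "\<dots> \<le> mu (\<lambda>r. random_tree r \<or> (\<exists>t\<in>F. take (length t) r = t)) N"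
  proof (rule mu_mono)
    fix r :: "bool list" assume r: "length r = N"
    show "random_tree r \<or> (\<exists>t\<in>F. take (length t) r = t)"
    proof (rule disjCI)
      assume no: "\<not> (\<exists>t\<in>F. take (length t) r = t)"
      show "random_tree r"
        unfolding random_tree_def
      proof (intro allI impI)
        fix m c assume m: "m \<le> length r"
        obtain s c' where c: "dec c = (s :: bool list, c' :: nat)" by (cases "dec c :: bool list \<times> nat")
        have "\<not> (length s < m \<and> halts c' s (take m r))"
        proof
          assume *: "length s < m \<and> halts c' s (take m r)"
          then have "take m r \<in> F" using m r U_iff unfolding F_def by auto
          moreover have "take (length (take m r)) r = take m r" using m by simp
          ultimately show False using no by blast
        qed
        then show "case dec c of (s, c') \<Rightarrow> \<not> (length s < m \<and> halts c' s (take m r))" by (simp add: c)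
      qed
    qed
  qed
  also have "\<dots> \<le> mu random_tree N + mu (\<lambda>r. \<exists>t\<in>F. take (length t) r = t) N" by (rule mu_disj)
  also have "mu (\<lambda>r. \<exists>t\<in>F. take (length t) r = t) N \<le> (\<Sum>t\<in>F. mu (\<lambda>r. take (length t) r = t) N)"
    by (rule mu_UN[OF fin])
  also have "\<dots> = (\<Sum>t\<in>F. (1/2) ^ length t)"
    by (rule sum.cong) (auto simp: F_def mu_extensions)
  also have "\<dots> \<le> (\<Sum>t\<in>F. 1/2 * (1/2) ^ length (f t))"
  proof (rule sum_mono)
    fix t assume "t \<in> F"
    then have "(1/2::real) ^ length t \<le> (1/2) ^ Suc (length (f t))"
      using f by (intro power_decreasing) (auto simp: Suc_le_eq)
    then show "(1/2::real) ^ length t \<le> 1/2 * (1/2) ^ length (f t)" by simp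
  qed
  also have "\<dots> = 1/2 * (\<Sum>t\<in>F. (1/2) ^ length (f t))" by (simp only: sum_distrib_left)
  also have "\<dots> \<le> 1/2 * 1" by (rule mult_left_mono[OF w]) simp
  finally show "(1/2) ^ 1 \<le> mu random_tree N" by simp
qed

lemma random_tree_path:
  assumes "\<And>n. random_tree (R \<restriction> n)" shows "martin_loef_random U R"
  unfolding martin_loef_random_def
proof (intro exI allI)
  fix n
  obtain s where s: "U s = Some (R \<restriction> n)" "length s = K U (R \<restriction> n)" using K_attained by blast
  then obtain c where c: "halts c s (R \<restriction> n)" using U_iff by blast
  define N where "N = max n (Suc (enc (s, c)))"
  have *: "n \<le> length (R \<restriction> N)" "enc (s, c) < length (R \<restriction> N)" "take n (R \<restriction> N) = R \<restriction> n"
    by (simp_all add: N_def)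
  have "case dec (enc (s, c)) of (s, c') \<Rightarrow> \<not> (length s < n \<and> halts c' s (take n (R \<restriction> N)))"
    using assms[of N, unfolded random_tree_def, rule_format, OF *(1,2)] .
  then have "\<not> length s < n" using c *(3) by simp
  then show "n < K U (R \<restriction> n) + 1" using s by simp
qed

lemma K_trivialI:
  assumes "\<And>n s. U s = Some (replicate n True) \<Longrightarrow> \<exists>s'. U s' = Some (A \<restriction> n) \<and> length s' \<le> length s + c"
  shows "K_trivial U A"
  unfolding K_trivial_def
proof (intro exI allI)
  fix n
  obtain s where s: "U s = Some (replicate n True)" "length s = K U (replicate n True)" using K_attained by blast
  then obtain s' where "U s' = Some (A \<restriction> n)" "length s' \<le> length s + c" using assms by blast
  then show "K U (A \<restriction> n) \<le> K U (replicate n True) + c" using K_le[of s'] s by fastforce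
qed

text \<open>Leastness of the witness makes the numbers that are valid for \<open>A\<close> correspond one-to-one to the
  descriptions of numbers, so that their weights satisfy the Kraft inequality.\<close>

definition tgt :: "nat \<Rightarrow> bool list" where
  "tgt z = fst (dec z :: bool list \<times> bool list \<times> nat)"

definition src :: "nat \<Rightarrow> bool list" where
  "src z = fst (snd (dec z :: bool list \<times> bool list \<times> nat))"

definition witness :: "nat \<Rightarrow> nat" where
  "witness z = snd (snd (dec z :: bool list \<times> bool list \<times> nat))"

text \<open>The first condition discards numbers that are not codes. Only the length of
  \<open>tgt z\<close> is constrained, so validity is decidable without \<open>A\<close>.\<close>

definition valid :: "nat \<Rightarrow> bool" where
  "valid z \<longleftrightarrow> enc (tgt z, src z, witness z) = z
     \<and> halts (witness z) (src z) (replicate (length (tgt z)) True)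
     \<and> (\<forall>c<witness z. \<not> halts c (src z) (replicate (length (tgt z)) True))"

definition valid_for :: "nat set \<Rightarrow> nat \<Rightarrow> bool" where
  "valid_for A z \<longleftrightarrow> valid z \<and> tgt z = A \<restriction> length (tgt z)"

definition in_V :: "nat \<Rightarrow> nat \<Rightarrow> bool list \<Rightarrow> bool" where
  "in_V b z r \<longleftrightarrow> (\<forall>j<length (src z) + b. bit_at r (prod_encode (z, j)))"

text \<open>The sum exceeds every position in the blocks up to \<open>z\<close>, so strings of this
  length decide these events. The summand \<open>b\<close> makes the length exceed \<open>b\<close>,
  and thereby makes the stems grow.\<close>

definition level :: "nat \<Rightarrow> nat \<Rightarrow> nat" where
  "level b z = b + Suc (\<Sum>y<Suc z. \<Sum>j<length (src y) + b. prod_encode (y, j))"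

lemma rec_tgt [rec_intros]: "rec A f \<Longrightarrow> rec A (\<lambda>x. tgt (f x))"
  unfolding tgt_def by (rule rec_fst, rule rec_dec)

lemma rec_src [rec_intros]: "rec A f \<Longrightarrow> rec A (\<lambda>x. src (f x))"
  unfolding src_def by (rule rec_fst, rule rec_snd, rule rec_dec)

lemma rec_witness [rec_intros]: "rec A f \<Longrightarrow> rec A (\<lambda>x. witness (f x))"
  unfolding witness_def by (rule rec_snd, rule rec_snd, rule rec_dec)

lemma rec_valid [rec_intros]: assumes "rec A f" shows "rec A (\<lambda>x. valid (f x))"
  unfolding valid_def by (intro rec_intros rec_comp[OF assms] assms)

lemma rec_valid_for [rec_intros]: assumes "rec A f" shows "rec A (\<lambda>x. valid_for A (f x))"
  unfolding valid_for_def by (intro rec_intros rec_comp[OF assms] assms)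

lemma rec_in_V [rec_intros]:
  assumes "rec A b" and "rec A z" and "rec A r" shows "rec A (\<lambda>x. in_V (b x) (z x) (r x))"
  unfolding in_V_def by (intro rec_intros rec_comp[OF assms(1)] rec_comp[OF assms(2)] rec_comp[OF assms(3)] assms)

lemma rec_level [rec_intros]:
  assumes "rec A b" and "rec A z" shows "rec A (\<lambda>x. level (b x) (z x))"
  unfolding level_def by (intro rec_intros rec_comp[OF assms(1)] rec_comp[OF assms(2)] assms)

lemma less_level: "b < level b z"
  by (simp add: level_def)

lemma position_less_level:
  assumes "j < length (src y) + b" and "y \<le> z" shows "prod_encode (y, j) < level b z"
proof -
  have "prod_encode (y, j) \<le> (\<Sum>j<length (src y) + b. prod_encode (y, j))"
    by (rule member_le_sum) (use assms in auto)
  also have "\<dots> \<le> (\<Sum>y<Suc z. \<Sum>j<length (src y) + b. prod_encode (y, j))"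
    by (rule member_le_sum[where f = "\<lambda>y. \<Sum>j<length (src y) + b. prod_encode (y, j)"]) (use assms in auto)
  finally show ?thesis by (simp add: level_def)
qed

lemma level_mono: "y \<le> z \<Longrightarrow> level b y \<le> level b z"
  unfolding level_def by (intro add_left_mono Suc_le_mono[THEN iffD2] sum_mono2) auto

lemma bit_at_take: "bit_at (take m r) i \<longleftrightarrow> i < m \<and> bit_at r i"
  by (auto simp: bit_at_def)

lemma in_V_mono: "in_V b z (take m r) \<Longrightarrow> in_V b z r"
  unfolding in_V_def bit_at_take by blast

lemma in_V_take: "level b z \<le> m \<Longrightarrow> in_V b z (take m r) \<longleftrightarrow> in_V b z r"
  unfolding in_V_def bit_at_take using position_less_level[of _ z b z] by fastforce

lemma valid_for_inj:
  assumes "valid_for A y" and "valid_for A z" and "src y = src z" shows "y = z"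
proof -
  have "U (src y) = Some (replicate (length (tgt y)) True)" "U (src z) = Some (replicate (length (tgt z)) True)"
    using assms(1,2) U_iff unfolding valid_for_def valid_def by blast+
  then have "length (tgt y) = length (tgt z)" using assms(3) by (metis length_replicate option.inject)
  then have tgt: "tgt y = tgt z" using assms(1,2) unfolding valid_for_def by metis
  then have "witness y = witness z"
    using assms unfolding valid_for_def valid_def by (metis nat_neq_iff)
  with tgt assms show ?thesis unfolding valid_for_def valid_def by metis
qed

lemma valid_for_exists:
  assumes "U s = Some (replicate n True)" shows "\<exists>z. valid_for A z \<and> src z = s \<and> tgt z = A \<restriction> n"
proof -
  obtain c where c: "halts c s (replicate n True)" "\<forall>c'<c. \<not> halts c' s (replicate n True)"
    using assms unfolding U_iff using exists_least_iff[of "\<lambda>c. halts c s (replicate n True)"] by blast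
  show ?thesis
    by (intro exI[of _ "enc (A \<restriction> n, s, c)"]) (simp add: valid_for_def valid_def tgt_def src_def witness_def c)
qed

lemma weight_valid_for:
  assumes "finite F" and "\<And>z. z \<in> F \<Longrightarrow> valid_for A z"
  shows "(\<Sum>z\<in>F. (1/2) ^ (length (src z) + b) :: real) \<le> (1/2) ^ b"
proof -
  have "(\<Sum>z\<in>F. (1/2) ^ length (src z) :: real) \<le> 1"
  proof (rule weight_domain[OF assms(1)])
    show "inj_on src F" using assms(2) valid_for_inj by (intro inj_onI) blast
    show "U (src z) \<noteq> None" if "z \<in> F" for z
      using assms(2)[OF that] U_iff unfolding valid_for_def valid_def by (metis option.distinct(1))
  qed
  then have "(\<Sum>z\<in>F. (1/2) ^ length (src z) :: real) * (1/2) ^ b \<le> 1 * (1/2) ^ b"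
    by (rule mult_right_mono) simp
  then show ?thesis by (simp add: power_add sum_distrib_right)
qed

definition block :: "nat \<Rightarrow> nat \<Rightarrow> nat set" where
  "block b z = (\<lambda>j. prod_encode (z, j)) ` {..<length (src z) + b}"

lemma in_V_iff_block: "in_V b z r \<longleftrightarrow> (\<forall>j\<in>block b z. bit_at r j)"
  unfolding in_V_def block_def by auto

lemma mu_avoiding_V:
  assumes "finite Z" and "\<And>z. z \<in> Z \<Longrightarrow> level b z \<le> N"
  shows "mu (\<lambda>r. \<forall>z\<in>Z. \<not> in_V b z r) N = (\<Prod>z\<in>Z. 1 - (1/2) ^ (length (src z) + b))"
proof -
  have "mu (\<lambda>r. \<forall>z\<in>Z. \<not> in_V b z r) N = (\<Prod>z\<in>Z. 1 - (1/2) ^ card (block b z))"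
    unfolding in_V_iff_block
  proof (rule mu_avoiding_blocks[OF assms(1)])
    show "block b z \<subseteq> {..<N}" if "z \<in> Z" for z
      using position_less_level[of _ z b z] assms(2)[OF that] unfolding block_def by fastforce
  qed (auto simp: block_def)
  moreover have "card (block b z) = length (src z) + b" for z
    unfolding block_def by (simp add: card_image inj_on_def)
  ultimately show ?thesis by simp
qed

lemma mu_in_V: "mu (in_V b z) N \<le> (1/2) ^ (length (src z) + b)"
proof -
  define M where "M = max N (level b z)"
  have "mu (in_V b z) N = mu (\<lambda>r. in_V b z (take N r)) M"
    by (rule mu_take[symmetric]) (simp add: M_def)
  also have "\<dots> \<le> mu (in_V b z) M" by (rule mu_mono) (rule in_V_mono)
  also have "\<dots> = 1 - mu (\<lambda>r. \<not> in_V b z r) M"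
    using mu_split[of "\<lambda>_. True" M "in_V b z"] by (simp add: mu_True)
  also have "\<dots> = (1/2) ^ (length (src z) + b)"
    using mu_avoiding_V[of "{z}" b M] by (simp add: M_def)
  finally show ?thesis .
qed

text \<open>For a tree this says, by compactness, that some path lies in the event. Failure shows at
  a single level and is therefore enumerable for decidable \<open>T\<close>.\<close>

definition meets :: "(bool list \<Rightarrow> bool) \<Rightarrow> nat \<Rightarrow> nat \<Rightarrow> bool" where
  "meets T b z \<longleftrightarrow> (\<forall>N. level b z \<le> N \<longrightarrow> (\<exists>r. length r = N \<and> T r \<and> in_V b z r))"

text \<open>If no valid block for \<open>A\<close> meets \<open>T\<close>, then the computably enumerable set of all valid \<open>z\<close> whose
  blocks miss \<open>T\<close> has finite weight by independence, and its requests make \<open>A\<close> \<open>K\<close>-trivial.\<close>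

lemma exists_meeting_block:
  assumes T: "rec {} T" and tree: "tree T" and big: "big T k" and A: "\<not> K_trivial U A"
  shows "\<exists>z. valid_for A z \<and> meets T b z"
proof (rule ccontr)
  assume no: "\<not> (\<exists>z. valid_for A z \<and> meets T b z)"
  define miss where "miss z N \<longleftrightarrow> level b z \<le> N \<and> \<not> (\<exists>r. length r = N \<and> T r \<and> in_V b z r)" for z N
  have rec_miss: "rec {} (\<lambda>x. miss (f x) (g x))" if "rec {} f" "rec {} g" for f g :: "nat \<times> nat \<Rightarrow> nat"
    unfolding miss_def by (intro rec_intros rec_comp[OF that(1)] rec_comp[OF that(2)] rec_comp[OF T] that)
  have rec_miss': "rec {} (\<lambda>x. miss (f x) (g x))" if "rec {} f" "rec {} g" for f g :: "nat \<Rightarrow> nat"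
    unfolding miss_def by (intro rec_intros rec_comp[OF that(1)] rec_comp[OF that(2)] rec_comp[OF T] that)
  \<comment> \<open>A request is a pair of \<open>z\<close> and the least level at which
    \<open>z\<close> is seen to miss \<open>T\<close>; by leastness every \<open>z\<close> is
    requested at most once.\<close>
  define G where "G i \<longleftrightarrow> valid (fst (prod_decode i)) \<and> miss (fst (prod_decode i)) (snd (prod_decode i))
    \<and> (\<forall>N<snd (prod_decode i). \<not> miss (fst (prod_decode i)) N)" for i
  have "\<exists>c. \<forall>i. G i \<longrightarrow> (\<exists>s. U s = Some (tgt (fst (prod_decode i))) \<and>
      length s \<le> length (src (fst (prod_decode i))) + b + k + c)"
  proof (rule machine_existence[OF opt])
    show "rec {} G"
      unfolding G_def[abs_def] by (intro rec_intros rec_miss rec_miss')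
    show "(\<Sum>i | i < M \<and> G i. (1/2) ^ (length (src (fst (prod_decode i))) + b + k) :: real) \<le> 1" for M
    proof -
      define F where "F = {i. i < M \<and> G i}"
      define z where "z i = fst (prod_decode i)" for i
      \<comment> \<open>A common level at which all requested blocks are already seen to miss
        \<open>T\<close>.\<close>
      define L where "L = (\<Sum>i\<in>F. snd (prod_decode i))"
      have fin: "finite F" by (simp add: F_def)
      have inj: "inj_on z F"
      proof (rule inj_onI)
        fix i j assume "i \<in> F" "j \<in> F" and z: "z i = z j"
        then have "G i" "G j" by (auto simp: F_def)
        then have "snd (prod_decode i) = snd (prod_decode j)"
          using z unfolding G_def z_def by (metis nat_neq_iff)
        with z show "i = j" unfolding z_def by (metis prod.expand prod_decode_inverse)
      qed
      have Z: "level b (z i) \<le> L \<and> (\<forall>r. length r = L \<longrightarrow> T r \<longrightarrow> \<not> in_V b (z i) r)"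
        if "i \<in> F" for i
      proof -
        define N where "N = snd (prod_decode i)"
        have m: "miss (z i) N" using that by (simp add: F_def G_def z_def N_def)
        have N: "N \<le> L" unfolding L_def N_def by (rule member_le_sum) (use that fin in auto)
        have "\<not> in_V b (z i) r" if r: "length r = L" "T r" for r
        proof -
          have "length (take N r) = N" "T (take N r)" using r N tree by (simp_all add: treeD)
          with m have "\<not> in_V b (z i) (take N r)" unfolding miss_def by blast
          then show ?thesis using m in_V_take unfolding miss_def by blast
        qed
        with m N show ?thesis unfolding miss_def by auto
      qed
      have "(1/2) ^ k \<le> mu T L" using big by (simp add: big_iff_mu)
      also have "\<dots> \<le> mu (\<lambda>r. \<forall>y\<in>z ` F. \<not> in_V b y r) L" by (rule mu_mono) (use Z in auto)
      also have "\<dots> = (\<Prod>y\<in>z ` F. 1 - (1/2) ^ (length (src y) + b))"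
        by (rule mu_avoiding_V) (use Z fin in auto)
      \<comment> \<open>The measure of \<open>T\<close> bounds the product from below, so the weight
        of the requested blocks is less than 2^k; the summand \<open>k\<close> in the request
        lengths compensates for this.\<close>
      finally have "(1/2) ^ k * (1 + (\<Sum>y\<in>z ` F. (1/2) ^ (length (src y) + b)))
          \<le> (\<Prod>y\<in>z ` F. 1 - (1/2) ^ (length (src y) + b)) * (1 + (\<Sum>y\<in>z ` F. (1/2) ^ (length (src y) + b)) :: real)"
        by (rule mult_right_mono) (auto intro!: add_nonneg_nonneg sum_nonneg)
      also have "\<dots> \<le> 1"
        by (rule sum_le_inverse_prod) (use fin in \<open>auto intro: power_le_one\<close>)
      finally have *: "(1/2) ^ k * (1 + (\<Sum>y\<in>z ` F. (1/2) ^ (length (src y) + b))) \<le> (1::real)" .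
      have "(\<Sum>i\<in>F. (1/2) ^ (length (src (z i)) + b + k)) = (1/2) ^ k * (\<Sum>y\<in>z ` F. (1/2) ^ (length (src y) + b) :: real)"
        unfolding sum.reindex[OF inj] comp_def sum_distrib_left by (simp add: power_add mult_ac)
      also have "\<dots> \<le> (1/2) ^ k * (1 + (\<Sum>y\<in>z ` F. (1/2) ^ (length (src y) + b)))"
        by (rule mult_left_mono) auto
      finally show ?thesis using * unfolding F_def z_def by linarith
    qed
  qed (intro rec_intros)+
  then obtain c where c: "\<And>i. G i \<Longrightarrow> \<exists>s. U s = Some (tgt (fst (prod_decode i))) \<and>
      length s \<le> length (src (fst (prod_decode i))) + b + k + c" by blast
  have "K_trivial U A"
  proof (rule K_trivialI)
    fix n s assume "U s = Some (replicate n True)"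
    then obtain z where z: "valid_for A z" "src z = s" "tgt z = A \<restriction> n" using valid_for_exists by blast
    \<comment> \<open>By assumption no block valid for \<open>A\<close> meets \<open>T\<close>, so
      each of them is eventually requested, and with it a description of
      \<open>A \<restriction> n\<close>.\<close>
    then have "\<exists>N. miss z N" using no unfolding meets_def miss_def by blast
    then obtain N where "miss z N" "\<forall>N'<N. \<not> miss z N'" using exists_least_iff[of "miss z"] by blast
    then have "G (prod_encode (z, N))" using z unfolding G_def valid_for_def by simp
    from c[OF this] show "\<exists>s'. U s' = Some (A \<restriction> n) \<and> length s' \<le> length s + (b + k + c)"
      by (simp add: z add.assoc)
  qed
  with A show False by blast
qed

text \<open>By compactness one string \<open>s\<close> of length \<open>level b z\<close> extends
  through the thinned tree inside the block to every level. If \<open>s\<close> lay in an earlier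
  valid block, the same extensions would show that this block meets the tree, against leastness of
  \<open>z\<close>.\<close>

lemma meeting_string:
  assumes tree: "tree T" and z: "valid_for A z" "meets (star T k) b z"
    and least: "\<And>y. y < z \<Longrightarrow> valid_for A y \<Longrightarrow> \<not> meets (star T k) b y"
  shows "\<exists>s. length s = level b z \<and> in_V b z s \<and> (\<forall>y<z. valid_for A y \<longrightarrow> \<not> in_V b y s) \<and> T s
    \<and> big (\<lambda>r. T r \<and> cone s r) (2 * level b z + k + 2)"
proof -
  let ?S = "star T k"
  have S: "tree ?S" using tree by (rule tree_star)
  define L where "L = level b z"
  define P where "P s n \<longleftrightarrow> (\<exists>r. length r = n \<and> ?S r \<and> in_V b z r \<and> take L r = s)" for s n
  have "\<exists>s. length s = L \<and> (\<forall>n\<ge>L. P s n)"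
  proof (rule ccontr)
    assume "\<not> ?thesis"
    then have "\<forall>s. \<exists>n. length s = L \<longrightarrow> L \<le> n \<and> \<not> P s n" by blast
    then obtain f where f: "\<And>s. length s = L \<Longrightarrow> L \<le> f s \<and> \<not> P s (f s)" by metis
    \<comment> \<open>A level above all the levels \<open>f s\<close> at which the individual
      candidates fail.\<close>
    define N where "N = L + (\<Sum>s | length s = L. f s)"
    obtain r where r: "length r = N" "?S r" "in_V b z r"
      using z(2) unfolding meets_def N_def L_def by (meson le_add1)
    define s where "s = take L r"
    have s: "length s = L" using r by (simp add: s_def N_def)
    have "f s \<le> (\<Sum>s | length s = L. f s)"
      by (rule member_le_sum) (use s finite_strings[of L "\<lambda>_. True"] in auto)
    then have "f s \<le> N" by (simp add: N_def)
    then have "length (take (f s) r) = f s" "?S (take (f s) r)" "in_V b z (take (f s) r)" "take L (take (f s) r) = s"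
      using r f[OF s] S in_V_take[of b z "f s" r] by (simp_all add: treeD L_def s_def min.absorb1)
    then have "P s (f s)" unfolding P_def by blast
    with f[OF s] show False by blast
  qed
  then obtain s where s: "length s = L" and P: "\<And>n. L \<le> n \<Longrightarrow> P s n" by blast
  obtain r where r: "length r = L" "?S r" "in_V b z r" "take L r = s" using P[of L] unfolding P_def by auto
  then have "r = s" by simp
  with r have sV: "in_V b z s" "?S s" by auto
  have "\<not> in_V b y s" if y: "y < z" "valid_for A y" for y
  proof
    assume V: "in_V b y s"
    have "meets ?S b y"
      unfolding meets_def
    proof (intro allI impI)
      fix N assume N: "level b y \<le> N"
      obtain r where r: "length r = max N L" "?S r" "take L r = s" using P[of "max N L"] unfolding P_def by auto
      have "in_V b y r" using V r(3) in_V_mono by blast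
      then have "in_V b y (take N r)" using in_V_take N by blast
      then show "\<exists>r. length r = N \<and> ?S r \<and> in_V b y r"
        using r S by (intro exI[of _ "take N r"]) (simp add: treeD)
    qed
    with least y show False by blast
  qed
  moreover have "big (\<lambda>r. T r \<and> cone s r) (2 * length s + k + 2)"
  proof (rule big_above_star[OF tree])
    show "\<exists>r. length r = n \<and> ?S r \<and> take (length s) r = s" if "length s \<le> n" for n
      using P[of n] that unfolding P_def s by blast
  qed
  moreover have "T s" using sV by (simp add: star_def)
  ultimately show ?thesis using s sV unfolding L_def by auto
qed

definition avoid :: "(nat \<Rightarrow> bool) \<Rightarrow> nat \<Rightarrow> nat \<Rightarrow> bool list \<Rightarrow> bool" where
  "avoid I b m r \<longleftrightarrow> (\<forall>y<m. I y \<longrightarrow> \<not> in_V b y r)"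

text \<open>With \<open>b = Suc k\<close> the blocks valid for \<open>A\<close> have total measure
  at most 2^-(k+1) by the Kraft inequality, however large \<open>m\<close> is.\<close>

lemma big_avoid:
  assumes "big T k" shows "big (\<lambda>r. T r \<and> avoid (valid_for A) (Suc k) m r) (Suc k)"
  unfolding big_iff_mu
proof
  fix N
  define F where "F = {y. y < m \<and> valid_for A y}"
  have "(1/2) ^ k \<le> mu T N" using assms by (simp add: big_iff_mu)
  also have "\<dots> \<le> mu (\<lambda>r. (T r \<and> avoid (valid_for A) (Suc k) m r) \<or> (\<exists>y\<in>F. in_V (Suc k) y r)) N"
    by (rule mu_mono) (auto simp: avoid_def F_def)
  also have "\<dots> \<le> mu (\<lambda>r. T r \<and> avoid (valid_for A) (Suc k) m r) N + mu (\<lambda>r. \<exists>y\<in>F. in_V (Suc k) y r) N"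
    by (rule mu_disj)
  also have "mu (\<lambda>r. \<exists>y\<in>F. in_V (Suc k) y r) N \<le> (\<Sum>y\<in>F. mu (in_V (Suc k) y) N)"
    by (rule mu_UN) (simp add: F_def)
  also have "\<dots> \<le> (\<Sum>y\<in>F. (1/2) ^ (length (src y) + Suc k))"
    by (rule sum_mono) (rule mu_in_V)
  also have "\<dots> \<le> (1/2) ^ Suc k"
    by (rule weight_valid_for) (auto simp: F_def)
  finally show "(1/2) ^ Suc k \<le> mu (\<lambda>r. T r \<and> avoid (valid_for A) (Suc k) m r) N" by simp
qed

lemma tree_avoid: "tree T \<Longrightarrow> tree (\<lambda>r. T r \<and> avoid I b m r)"
  by (auto simp: tree_def avoid_def dest: in_V_mono)

end

section \<open>Forcing conditions\<close>

text \<open>A constraint \<open>(b, p, x, y, N)\<close> on a set \<open>X\<close> says that \<open>p\<close> with oracle \<open>X\<close> does not map \<open>x\<close> to \<open>y\<close>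
  if \<open>b\<close> is false, and that it does so with use and time at most \<open>N\<close> if \<open>b\<close> is true.\<close>

type_synonym constraint = "bool \<times> prog \<times> nat \<times> nat \<times> nat"

definition sat :: "constraint \<Rightarrow> bool list \<Rightarrow> bool" where
  "sat c r \<longleftrightarrow> (case c of (b, p, x, y, N) \<Rightarrow>
     if b then N \<le> length r \<longrightarrow> evb (take N r) p x y else \<not> evb r p x y)"

lemma sat_take: "sat c r \<Longrightarrow> sat c (take m r)"
  by (auto simp: sat_def min_def dest: evb_mono split: prod.splits if_splits)

lemma rec_sat [rec_intros]:
  assumes "rec A c" and "rec A r" shows "rec A (\<lambda>x. sat (c x) (r x))"
  unfolding sat_def
  by (intro rec_intros rec_comp[OF assms(1)] rec_comp[OF assms(2)] assms)

lemma big_mono: "big T k \<Longrightarrow> (\<And>r. T r \<Longrightarrow> T' r) \<Longrightarrow> big T' k"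
  unfolding big_iff_mu by (meson mu_mono order_trans)

lemma less_mu_iff: "(1/2) ^ k < mu P n \<longleftrightarrow> 2 ^ n < 2 ^ k * card {r. length r = n \<and> P r}"
proof -
  have "(1/2) ^ k < mu P n \<longleftrightarrow> (2::real) ^ n < 2 ^ k * card {r. length r = n \<and> P r}"
    unfolding mu_def by (simp add: power_one_over field_simps)
  also have "\<dots> \<longleftrightarrow> real (2 ^ n) < real (2 ^ k * card {r. length r = n \<and> P r})" by simp
  finally show ?thesis by (simp only: of_nat_less_iff)
qed

text \<open>If the part of \<open>T\<close> without the computation does not keep density 2^-(k+1),
  it falls below that at some level \<open>N\<close>; then the computations found by
  \<open>N\<close> keep the rest. Below level \<open>N\<close> the positive constraint is
  vacuous.\<close>

lemma force_computation:
  assumes tree: "tree T" and big: "big T k"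
  shows "\<exists>b N. big (\<lambda>r. T r \<and> sat (b, p, x, y, N) r) (Suc k)"
proof (cases "big (\<lambda>r. T r \<and> sat (False, p, x, y, 0) r) (Suc k)")
  case False
  then obtain N where N: "mu (\<lambda>r. T r \<and> \<not> evb r p x y) N < (1/2) ^ Suc k"
    unfolding big_iff_mu sat_def by (auto simp: not_le)
  have "(1/2) ^ Suc k \<le> mu (\<lambda>r. T r \<and> sat (True, p, x, y, N) r) n" for n
  proof (cases "n < N")
    case True
    have "(1/2) ^ Suc k \<le> (1/2::real) ^ k" by simp
    also have "\<dots> \<le> mu T n" using big by (simp add: big_iff_mu)
    also have "\<dots> = mu (\<lambda>r. T r \<and> sat (True, p, x, y, N) r) n"
      by (rule mu_cong) (use True in \<open>simp add: sat_def\<close>)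
    finally show ?thesis .
  next
    case False
    have "(1/2) ^ k \<le> mu T n" using big by (simp add: big_iff_mu)
    also have "\<dots> \<le> mu (\<lambda>r. (T r \<and> sat (True, p, x, y, N) r) \<or> (T r \<and> \<not> evb (take N r) p x y)) n"
      by (rule mu_mono) (auto simp: sat_def)
    also have "\<dots> \<le> mu (\<lambda>r. T r \<and> sat (True, p, x, y, N) r) n + mu (\<lambda>r. T r \<and> \<not> evb (take N r) p x y) n"
      by (rule mu_disj)
    also have "mu (\<lambda>r. T r \<and> \<not> evb (take N r) p x y) n \<le> mu (\<lambda>r. T r \<and> \<not> evb r p x y) N"
      by (rule mu_level) (use False tree in \<open>auto simp: treeD\<close>)
    finally show ?thesis using N by simp
  qed
  then have "big (\<lambda>r. T r \<and> sat (True, p, x, y, N) r) (Suc k)" unfolding big_iff_mu by blast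
  then show ?thesis by blast
qed blast

text \<open>If there is no such \<open>x\<close>, then \<open>p\<close> computes \<open>D\<close> on most of \<open>T\<close>, and \<open>D\<close> is computable by a majority vote.\<close>

lemma force_difference:
  assumes T: "rec {} T" and tree: "tree T" and big: "big T k" and D: "\<not> computable_set D"
  shows "\<exists>x. big (\<lambda>r. T r \<and> sat (False, p, x, of_bool (x \<in> D), 0) r) (k + 2)"
proof (rule ccontr)
  assume no: "\<not> ?thesis"
  \<comment> \<open>The budget is 2^-k = 4e. The correct answer gets more than 4e - e; a wrong one
    gets less than e from the strings in \<open>T\<close> without the correct computation and less
    than e from strings that leave \<open>T\<close> later. So 2e separates them.\<close>
  define e :: real where "e = (1/2) ^ (k + 2)"
  have e: "e > 0" "(1/2) ^ Suc k = 2 * e" "(1/2) ^ k = 4 * e" by (simp_all add: e_def)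
  have "\<forall>x. \<exists>N. mu (\<lambda>r. T r \<and> \<not> evb r p x (of_bool (x \<in> D))) N < e"
    using no unfolding big_iff_mu sat_def e_def by (auto simp: not_le)
  then obtain f where f: "\<And>x. mu (\<lambda>r. T r \<and> \<not> evb r p x (of_bool (x \<in> D))) (f x) < e" by metis
  have f': "mu (\<lambda>r. T r \<and> \<not> evb r p x (of_bool (x \<in> D))) N < e" if "f x \<le> N" for x N
  proof -
    have "mu (\<lambda>r. T r \<and> \<not> evb r p x (of_bool (x \<in> D))) N \<le> mu (\<lambda>r. T r \<and> \<not> evb r p x (of_bool (x \<in> D))) (f x)"
      by (rule mu_level[OF that]) (auto simp: treeD[OF tree] dest: evb_mono)
    with f[of x] show ?thesis by simp
  qed
  \<comment> \<open>From level \<open>M\<close> on \<open>T\<close> loses less than e. The vote is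
    taken over extensions of strings of \<open>T\<close> at this fixed level, so that votes once
    counted are not lost at higher levels.\<close>
  have bdd: "bdd_below (range (mu T))" by (rule bdd_belowI[of _ 0]) (auto simp: mu_nonneg)
  have "Inf (range (mu T)) < Inf (range (mu T)) + e" using e by simp
  from cInf_lessD[OF _ this] obtain M where M: "mu T M < Inf (range (mu T)) + e" by auto
  have loss: "mu (\<lambda>r. T (take M r) \<and> \<not> T r) N < e" if "M \<le> N" for N
  proof -
    have "mu T M = mu (\<lambda>r. T (take M r)) N" using mu_take[OF that, of T] by simp
    also have "\<dots> = mu (\<lambda>r. T (take M r) \<and> T r) N + mu (\<lambda>r. T (take M r) \<and> \<not> T r) N" by (rule mu_split)
    also have "mu (\<lambda>r. T (take M r) \<and> T r) N = mu T N" by (rule mu_cong) (use tree in \<open>auto simp: treeD\<close>)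
    finally show ?thesis using M cInf_lower[OF _ bdd, of "mu T N"] by simp
  qed
  define Q where "Q x z \<longleftrightarrow> M \<le> snd z \<and>
    2 ^ snd z < 2 ^ Suc k * card {r. length r = snd z \<and> (T (take M r) \<and> evb r p x (of_bool (fst z)))}" for x and z :: "bool \<times> nat"
  have Q: "Q x z \<longleftrightarrow> M \<le> snd z \<and> 2 * e < mu (\<lambda>r. T (take M r) \<and> evb r p x (of_bool (fst z))) (snd z)" for x z
    unfolding Q_def less_mu_iff[symmetric] e by simp
  have right: "Q x (x \<in> D, max M (f x))" for x
  proof -
    let ?N = "max M (f x)"
    have "4 * e \<le> mu T ?N" using big e(3) unfolding big_iff_mu by metis
    also have "\<dots> \<le> mu (\<lambda>r. (T (take M r) \<and> evb r p x (of_bool (x \<in> D))) \<or> (T r \<and> \<not> evb r p x (of_bool (x \<in> D)))) ?N"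
      by (rule mu_mono) (use tree in \<open>auto simp: treeD\<close>)
    also have "\<dots> \<le> mu (\<lambda>r. T (take M r) \<and> evb r p x (of_bool (x \<in> D))) ?N + mu (\<lambda>r. T r \<and> \<not> evb r p x (of_bool (x \<in> D))) ?N"
      by (rule mu_disj)
    finally show ?thesis using f'[of x ?N] e(1) by (simp add: Q)
  qed
  have wrong: "i = (x \<in> D)" if "Q x (i, N)" for x i N
  proof (rule ccontr)
    assume i: "i \<noteq> (x \<in> D)"
    let ?N = "max N (f x)"
    have "M \<le> N" and "2 * e < mu (\<lambda>r. T (take M r) \<and> evb r p x (of_bool i)) N" using that by (simp_all add: Q)
    note this(2)
    also have "mu (\<lambda>r. T (take M r) \<and> evb r p x (of_bool i)) N
      = mu (\<lambda>r. T (take M (take N r)) \<and> evb (take N r) p x (of_bool i)) ?N"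
      by (rule mu_take[symmetric]) simp
    also have "\<dots> \<le> mu (\<lambda>r. (T r \<and> \<not> evb r p x (of_bool (x \<in> D))) \<or> (T (take M r) \<and> \<not> T r)) ?N"
    proof (rule mu_mono)
      fix r assume *: "T (take M (take N r)) \<and> evb (take N r) p x (of_bool i)"
      then have "evb r p x (of_bool i)" using evb_mono by blast
      then have "\<not> evb r p x (of_bool (x \<in> D))"
        using evb_unique[of r p x "of_bool i" "of_bool (x \<in> D)"] i by (auto simp: of_bool_eq_iff)
      with * \<open>M \<le> N\<close> show "(T r \<and> \<not> evb r p x (of_bool (x \<in> D))) \<or> (T (take M r) \<and> \<not> T r)"
        by (simp add: min.absorb1)
    qed
    also have "\<dots> \<le> mu (\<lambda>r. T r \<and> \<not> evb r p x (of_bool (x \<in> D))) ?N + mu (\<lambda>r. T (take M r) \<and> \<not> T r) ?N"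
      by (rule mu_disj)
    also have "\<dots> < e + e" using f'[of x ?N] loss[of ?N] \<open>M \<le> N\<close> by (intro add_strict_mono) auto
    finally show False by simp
  qed
  have ex: "\<exists>c. Q x (dec c)" for x using right[of x] by (metis dec_enc)
  have "rec {} (\<lambda>x. fst (dec (LEAST c. Q x (dec c)) :: bool \<times> nat))"
    by (intro rec_fst rec_dec rec_Least[OF _ ex], unfold Q_def) (intro rec_intros rec_comp[OF T])
  moreover have "fst (dec (LEAST c. Q x (dec c)) :: bool \<times> nat) = (x \<in> D)" for x
    using LeastI_ex[OF ex[of x]] wrong by (metis prod.collapse)
  ultimately have "rec {} (\<lambda>x. x \<in> D)" by simp
  with D show False unfolding computable_set_def turing_le_iff_rec by blast
qed

section \<open>Conditions and the coding of one index\<close>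

context optimal
begin

definition cond :: "constraint list \<Rightarrow> bool list \<Rightarrow> bool list \<Rightarrow> bool" where
  "cond C s r \<longleftrightarrow> random_tree r \<and> cone s r \<and> (\<forall>c\<in>set C. sat c r)"

lemma tree_cond: "tree (cond C s)"
  using tree_random_tree unfolding tree_def cond_def by (blast intro: cone_take sat_take)

lemma rec_cond [rec_intros]:
  assumes "rec A C" and "rec A s" and "rec A r" shows "rec A (\<lambda>x. cond (C x) (s x) (r x))"
  unfolding cond_def
  by (intro rec_intros rec_comp[OF assms(1)] rec_comp[OF assms(2)] rec_comp[OF assms(3)] assms)

lemma rec_big_cond:
  assumes J: "jump {} \<le>\<^sub>T B" and "rec B C" and "rec B s" and "rec B k"
  shows "rec B (\<lambda>x. big (cond (C x) (s x)) (k x))"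
proof -
  have "re (\<lambda>z. \<not> big (cond (fst z) (fst (snd z))) (snd (snd z)))"
  proof (rule reI[where Q = "\<lambda>z n. \<not> 2 ^ n \<le> 2 ^ snd (snd z) * card {r. length r = n \<and> cond (fst z) (fst (snd z)) r}"])
    show "rec {} (\<lambda>z. \<not> 2 ^ snd z \<le> 2 ^ snd (snd (fst z)) * card {r. length r = snd z \<and> cond (fst (fst z)) (fst (snd (fst z))) r})"
      by (intro rec_intros)
  qed (simp add: big_def)
  then have "rec B (\<lambda>z. \<not> \<not> big (cond (fst z) (fst (snd z))) (snd (snd z)))"
    using J by (intro rec_not re_imp_rec_jump)
  from rec_comp[OF this rec_pair[OF assms(2) rec_pair[OF assms(3,4)]]] show ?thesis by simp
qed

text \<open>Only finitely much of the oracle of \<open>valid_for\<close> is needed below a given bound.\<close>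

definition valid_in :: "bool list \<Rightarrow> nat \<Rightarrow> bool" where
  "valid_in a z \<longleftrightarrow> valid z \<and> tgt z = take (length (tgt z)) a"

lemma valid_in_iff: "z < m \<Longrightarrow> valid_in (A \<restriction> m) z \<longleftrightarrow> valid_for A z"
proof -
  assume z: "z < m"
  have "valid z \<Longrightarrow> length (tgt z) \<le> z"
    using length_le_enc[of "tgt z"] enc_le_enc_prod(1)[of "tgt z" "(src z, witness z)"]
    unfolding valid_def by linarith
  then show ?thesis using z unfolding valid_in_def valid_for_def by (auto simp: min_def)
qed

lemma rec_valid_in [rec_intros]:
  assumes "rec A a" and "rec A z" shows "rec A (\<lambda>x. valid_in (a x) (z x))"
  unfolding valid_in_def by (intro rec_intros assms)

definition below :: "nat set \<Rightarrow> constraint list \<Rightarrow> bool list \<Rightarrow> nat \<Rightarrow> nat \<Rightarrow> bool list \<Rightarrow> bool" where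
  "below A C s k m r \<longleftrightarrow> cond C s r \<and> avoid (valid_for A) (Suc k) m r"

lemma below_iff: "below A C s k m r \<longleftrightarrow> cond C s r \<and> (\<forall>y<m. valid_in (A \<restriction> m) y \<longrightarrow> \<not> in_V (Suc k) y r)"
  unfolding below_def avoid_def using valid_in_iff by blast

lemma tree_below: "tree (below A C s k m)"
  using tree_avoid[OF tree_cond] unfolding below_def[abs_def] .

lemma rec_below: "rec {} (below A C s k m)"
  unfolding below_iff[abs_def] by (intro rec_intros)

text \<open>The candidates for an index. The tree avoids all valid blocks with numbers below
  \<open>m\<close>, so every hit is at least \<open>m\<close>; this is how an index is forced to be
  large.\<close>

definition hit :: "nat set \<Rightarrow> constraint list \<Rightarrow> bool list \<Rightarrow> nat \<Rightarrow> nat \<Rightarrow> nat \<Rightarrow> bool" where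
  "hit A C s k m z \<longleftrightarrow> valid_for A z \<and> meets (star (below A C s k m) (Suc k)) (Suc k) z"

text \<open>Only the initial segment of \<open>A\<close> of length \<open>m\<close> enters the tree.
  Passed as a parameter, it leaves a predicate that is co-enumerable without an oracle, so
  \<open>A\<close> and \<open>jump {}\<close> suffice and the jump of \<open>A\<close> is
  avoided.\<close>

lemma rec_hit:
  assumes A: "A \<le>\<^sub>T B" and J: "jump {} \<le>\<^sub>T B"
    and "rec B C" and "rec B s" and "rec B k" and m: "rec B m" and z: "rec B z"
  shows "rec B (\<lambda>x. hit A (C x) (s x) (k x) (m x) (z x))"
proof -
  define T where "T C s k m a r \<longleftrightarrow> cond C s r \<and> (\<forall>y<m. valid_in a y \<longrightarrow> \<not> in_V (Suc k) y r)" for C s k m a r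
  define P where "P w \<longleftrightarrow> (case w of (C, s, k, m, z, a) \<Rightarrow> meets (star (T C s k m a) (Suc k)) (Suc k) z)" for w
  have rec_T: "rec {} (\<lambda>x. T (C x) (s x) (k x) (m x) (a x) (r x))"
    if "rec {} C" "rec {} s" "rec {} k" "rec {} m" "rec {} a" "rec {} r" for C s k m a and r :: "'x::enc \<Rightarrow> _"
    unfolding T_def
    by (intro rec_intros rec_comp[OF that(1)] rec_comp[OF that(2)] rec_comp[OF that(3)] rec_comp[OF that(4)]
        rec_comp[OF that(5)] rec_comp[OF that(6)] that)
  have "re (\<lambda>w. \<not> P w)"
  proof (rule reI[where Q = "\<lambda>w N. case w of (C, s, k, m, z, a) \<Rightarrow>
      level (Suc k) z \<le> N \<and> \<not> (\<exists>r. length r = N \<and> star (T C s k m a) (Suc k) r \<and> in_V (Suc k) z r)"])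
    show "rec {} (\<lambda>z. case fst z of (C, s, k, m, y, a) \<Rightarrow>
      level (Suc k) y \<le> snd z \<and> \<not> (\<exists>r. length r = snd z \<and> star (T C s k m a) (Suc k) r \<and> in_V (Suc k) y r))"
      unfolding star_def by (intro rec_intros rec_T)
  qed (auto simp: P_def meets_def)
  then have "rec B (\<lambda>w. \<not> \<not> P w)" using J by (intro rec_not re_imp_rec_jump)
  then have P: "rec B P" by simp
  have vA: "rec B (\<lambda>z. valid_for A z)" by (rule rec_trans[OF _ A]) (intro rec_intros)
  have iA: "rec B (\<lambda>m. A \<restriction> m)" by (rule rec_trans[OF _ A]) (intro rec_intros)
  have "rec B (\<lambda>x. P (C x, s x, k x, m x, z x, A \<restriction> m x))"
    by (rule rec_comp[OF P]) (intro rec_pair assms rec_comp[OF iA])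
  then have "rec B (\<lambda>x. valid_for A (z x) \<and> P (C x, s x, k x, m x, z x, A \<restriction> m x))"
    by (intro rec_conj rec_comp[OF vA z])
  moreover have "T C s k m (A \<restriction> m) = below A C s k m" for C s k m
    unfolding T_def below_iff by blast
  ultimately show ?thesis unfolding P_def hit_def by simp
qed

text \<open>The new bound is that of \<open>meeting_string\<close> for \<open>Suc k\<close>. It
  mentions neither \<open>C\<close> nor the choice of \<open>t\<close>, so a reader who knows
  \<open>k\<close> and \<open>z\<close> knows it too.\<close>

definition code_step :: "nat set \<Rightarrow> constraint list \<Rightarrow> bool list \<Rightarrow> nat \<Rightarrow> nat \<Rightarrow> nat \<Rightarrow> bool list \<Rightarrow> bool" where
  "code_step A C s k m z t \<longleftrightarrow> hit A C s k m z \<and> (\<forall>y<z. \<not> hit A C s k m y)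
     \<and> length t = level (Suc k) z \<and> in_V (Suc k) z t \<and> (\<forall>y<z. valid_for A y \<longrightarrow> \<not> in_V (Suc k) y t)
     \<and> cone s t \<and> big (cond C t) (2 * level (Suc k) z + k + 3) \<and> m \<le> z"

lemma hit_exists:
  assumes "big (cond C s) k" and A: "\<not> K_trivial U A"
  shows "\<exists>z. hit A C s k m z \<and> (\<forall>y<z. \<not> hit A C s k m y)"
proof -
  have "big (below A C s k m) (Suc k)"
    using big_avoid[OF assms(1)] unfolding below_def[abs_def] .
  then have "big (star (below A C s k m) (Suc k)) (Suc (Suc k))" by (rule big_star)
  moreover have "rec {} (star (below A C s k m) (Suc k))"
    unfolding star_def[abs_def] by (intro rec_intros rec_comp[OF rec_below] rec_below)
  ultimately have "\<exists>z. valid_for A z \<and> meets (star (below A C s k m) (Suc k)) (Suc k) z"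
    using exists_meeting_block tree_star[OF tree_below] A by blast
  then show ?thesis unfolding hit_def[symmetric] using exists_least_iff[of "hit A C s k m"] by blast
qed

lemma code_step_exists:
  assumes "big (cond C s) k" and A: "\<not> K_trivial U A"
  shows "\<exists>z t. code_step A C s k m z t"
proof -
  let ?T = "below A C s k m"
  obtain z where z: "hit A C s k m z" "\<And>y. y < z \<Longrightarrow> \<not> hit A C s k m y" using hit_exists[OF assms] by blast
  have v: "valid_for A z" "meets (star ?T (Suc k)) (Suc k) z" using z(1) by (simp_all add: hit_def)
  obtain t where t: "length t = level (Suc k) z" "in_V (Suc k) z t" "\<forall>y<z. valid_for A y \<longrightarrow> \<not> in_V (Suc k) y t"
      "?T t" "big (\<lambda>r. ?T r \<and> cone t r) (2 * level (Suc k) z + Suc k + 2)"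
    using meeting_string[OF tree_below v] z(2) unfolding hit_def by blast
  have "cone s t" using t(4) by (simp add: below_def cond_def)
  moreover have "big (cond C t) (2 * level (Suc k) z + k + 3)"
    using big_mono[OF t(5), of "cond C t"] by (simp add: below_def cond_def numeral_3_eq_3)
  moreover have "m \<le> z"
  proof (rule ccontr)
    assume "\<not> m \<le> z"
    with t(2,4) v(1) show False unfolding below_def avoid_def by auto
  qed
  ultimately show ?thesis using t z unfolding code_step_def by blast
qed

lemma rec_code_step:
  assumes A: "A \<le>\<^sub>T B" and J: "jump {} \<le>\<^sub>T B"
    and C: "rec B C" and s: "rec B s" and k: "rec B k" and m: "rec B m" and z: "rec B z" and t: "rec B t"
  shows "rec B (\<lambda>x. code_step A (C x) (s x) (k x) (m x) (z x) (t x))"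
proof -
  have vA: "rec B (\<lambda>z. valid_for A z)" by (rule rec_trans[OF _ A]) (intro rec_intros)
  show ?thesis
    unfolding code_step_def
    by (intro rec_intros rec_hit[OF A J] rec_big_cond[OF J] rec_comp[OF vA] assms
        rec_comp[OF C] rec_comp[OF s] rec_comp[OF k] rec_comp[OF m] rec_comp[OF z] rec_comp[OF t])
qed

text \<open>The threshold for a bit of \<open>D\<close>. It ranges over all constraint lists with
  code up to \<open>n\<close>, because the reader knows the stem and the margin but not the list;
  lists without the measure bound are exempted since they may have no hit.\<close>

definition hit_bound :: "nat set \<Rightarrow> bool list \<Rightarrow> nat \<Rightarrow> nat \<Rightarrow> nat" where
  "hit_bound A s k n = (LEAST Z. \<forall>c\<le>n. big (cond (dec c) s) k \<longrightarrow> (\<exists>z\<le>Z. hit A (dec c) s k 0 z))"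

lemma hit_bound_exists:
  assumes A: "\<not> K_trivial U A"
  shows "\<exists>Z. \<forall>c\<le>n. big (cond (dec c) s) k \<longrightarrow> (\<exists>z\<le>Z. hit A (dec c) s k 0 z)"
proof -
  have "\<forall>c. \<exists>z. big (cond (dec c) s) k \<longrightarrow> hit A (dec c) s k 0 z" using hit_exists A by blast
  then obtain f where f: "\<And>c. big (cond (dec c) s) k \<Longrightarrow> hit A (dec c) s k 0 (f c)" by metis
  have "f c \<le> (\<Sum>c\<le>n. f c)" if "c \<le> n" for c by (rule member_le_sum) (use that in auto)
  with f show ?thesis by blast
qed

lemma rec_hit_bound:
  assumes nt: "\<not> K_trivial U A" and A: "A \<le>\<^sub>T B" and J: "jump {} \<le>\<^sub>T B"
    and s: "rec B s" and k: "rec B k" and n: "rec B n"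
  shows "rec B (\<lambda>x. hit_bound A (s x) (k x) (n x))"
  unfolding hit_bound_def
  by (rule rec_Least[OF _ hit_bound_exists[OF nt]])
    (intro rec_intros rec_hit[OF A J] rec_big_cond[OF J] rec_comp[OF s] rec_comp[OF k] rec_comp[OF n])

lemma code_step_le_hit_bound:
  assumes nt: "\<not> K_trivial U A" and step: "code_step A C s k 0 z t" and "big (cond C s) k" and "enc C \<le> n"
  shows "z \<le> hit_bound A s k n"
proof -
  have "\<forall>c\<le>n. big (cond (dec c) s) k \<longrightarrow> (\<exists>z\<le>hit_bound A s k n. hit A (dec c) s k 0 z)"
    unfolding hit_bound_def by (rule LeastI_ex[OF hit_bound_exists[OF nt]])
  then obtain y where "y \<le> hit_bound A s k n" "hit A C s k 0 y" using assms(3,4) dec_enc by metis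
  then show ?thesis using step unfolding code_step_def by (meson le_trans not_less)
qed

text \<open>The reader's view of a coding step: no constraint list occurs in it.\<close>

definition first_hit :: "nat set \<Rightarrow> nat set \<Rightarrow> nat \<Rightarrow> nat \<Rightarrow> bool list \<Rightarrow> bool" where
  "first_hit A R k z t \<longleftrightarrow> (valid_for A z \<and> in_V (Suc k) z (R \<restriction> level (Suc k) z))
     \<and> (\<forall>y<z. \<not> (valid_for A y \<and> in_V (Suc k) y (R \<restriction> level (Suc k) y))) \<and> t = R \<restriction> level (Suc k) z"

lemma first_hit_unique: "first_hit A R k z t \<Longrightarrow> first_hit A R k z' t' \<Longrightarrow> z = z' \<and> t = t'"
  unfolding first_hit_def by (metis nat_neq_iff)

text \<open>\<open>level\<close> is monotone, so any earlier valid block contained in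
  \<open>R\<close> would be visible in \<open>t\<close>, which was chosen outside all of
  them.\<close>

lemma code_step_first_hit:
  assumes "code_step A C s k m z t" and "t = R \<restriction> level (Suc k) z"
  shows "first_hit A R k z t"
  unfolding first_hit_def
proof (intro conjI allI impI notI)
  show "valid_for A z" "in_V (Suc k) z (R \<restriction> level (Suc k) z)" "t = R \<restriction> level (Suc k) z"
    using assms unfolding code_step_def hit_def by auto
  fix y assume y: "valid_for A y \<and> in_V (Suc k) y (R \<restriction> level (Suc k) y)" and "y < z"
  then have "R \<restriction> level (Suc k) y = take (level (Suc k) y) t"
    using level_mono[of y z "Suc k"] assms(2) by (simp add: min.absorb1)
  then have "in_V (Suc k) y t" using y in_V_mono by metis
  with assms(1) \<open>y < z\<close> y show False unfolding code_step_def by blast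
qed

lemma rec_first_hit:
  assumes A: "A \<le>\<^sub>T B" and R: "R \<le>\<^sub>T B" and k: "rec B k" and z: "rec B z" and t: "rec B t"
  shows "rec B (\<lambda>x. first_hit A R (k x) (z x) (t x))"
proof -
  have vA: "rec B (\<lambda>z. valid_for A z)" by (rule rec_trans[OF _ A]) (intro rec_intros)
  have iR: "rec B (\<lambda>n. R \<restriction> n)" by (rule rec_trans[OF _ R]) (intro rec_intros)
  show ?thesis
    unfolding first_hit_def
    by (intro rec_intros rec_comp[OF vA] rec_comp[OF iR] rec_comp[OF k] rec_comp[OF z] k z t)
qed

end

section \<open>The construction\<close>

lemma rec_mem: "B \<le>\<^sub>T A \<Longrightarrow> rec A f \<Longrightarrow> rec A (\<lambda>x. f x \<in> B)"
  unfolding turing_le_iff_rec by (rule rec_comp)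

lemma rec_Comp_Zero [rec_intros]: assumes "rec A f" shows "rec A (\<lambda>x. Comp Zero (f x))"
proof -
  have "rec A (\<lambda>x. enc (Comp Zero (f x)))"
    unfolding enc_prog_def goedel.simps by (intro rec_intros assms)
  then show ?thesis unfolding rec_enc_iff .
qed

lemma join_iff: "n \<in> X \<oplus> Y \<longleftrightarrow> (if even n then n div 2 \<in> X else n div 2 \<in> Y)"
proof -
  have "n \<in> X \<oplus> Y \<longleftrightarrow> (\<exists>m. n = 2 * m \<and> m \<in> X) \<or> (\<exists>m. n = 2 * m + 1 \<and> m \<in> Y)"
    unfolding join_def by blast
  also have "(\<exists>m. n = 2 * m \<and> m \<in> X) \<longleftrightarrow> even n \<and> n div 2 \<in> X" by auto
  also have "(\<exists>m. n = 2 * m + 1 \<and> m \<in> Y) \<longleftrightarrow> odd n \<and> n div 2 \<in> Y" by (auto elim: oddE)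
  finally show ?thesis by simp
qed

lemma join_turing_le_iff: "X \<oplus> Y \<le>\<^sub>T B \<longleftrightarrow> X \<le>\<^sub>T B \<and> Y \<le>\<^sub>T B"
proof
  assume XY: "X \<oplus> Y \<le>\<^sub>T B"
  have "rec B (\<lambda>n. 2 * n \<in> X \<oplus> Y)" "rec B (\<lambda>n. 2 * n + 1 \<in> X \<oplus> Y)"
    by (intro rec_mem[OF XY] rec_intros)+
  then show "X \<le>\<^sub>T B \<and> Y \<le>\<^sub>T B" by (simp add: join_iff turing_le_iff_rec)
next
  assume *: "X \<le>\<^sub>T B \<and> Y \<le>\<^sub>T B"
  show "X \<oplus> Y \<le>\<^sub>T B"
    unfolding turing_le_iff_rec join_iff
    by (intro rec_if rec_even rec_div rec_mem[of X] rec_mem[of Y] rec_id rec_const) (use * in auto)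
qed

lemma turing_le_refl: "X \<le>\<^sub>T X"
  unfolding turing_le_iff_rec by (intro rec_intros)

definition halts_within :: "nat \<Rightarrow> nat \<Rightarrow> bool" where
  "halts_within n m \<longleftrightarrow> evb (replicate m False) (Comp Zero (dec n)) n 0"

lemma rec_halts_within [rec_intros]:
  "rec A f \<Longrightarrow> rec A g \<Longrightarrow> rec A (\<lambda>x. halts_within (f x) (g x))"
  unfolding halts_within_def by (intro rec_evb rec_replicate rec_const rec_Comp_Zero rec_dec)

text \<open>Composition with \<open>Zero\<close> turns halting into halting with output 0, the kind
  of statement that constraints and \<open>evb\<close> express.\<close>

lemma jump_iff: "n \<in> jump X \<longleftrightarrow> eval X (Comp Zero (dec n)) n 0"
proof -
  have n: "goedel (dec n) = n" using enc_dec_prog[of n] by (simp add: enc_prog_def)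
  have "goedel (dec n) \<in> jump X \<longleftrightarrow> (\<exists>y. eval X (dec n) (goedel (dec n)) y)"
    unfolding jump_def by (auto dest: inj_goedel)
  then have "n \<in> jump X \<longleftrightarrow> (\<exists>y. eval X (dec n) n y)" unfolding n .
  also have "\<dots> \<longleftrightarrow> eval X (Comp Zero (dec n)) n 0"
    unfolding eval_Comp_iff using eval.zero by blast
  finally show ?thesis .
qed

lemma jump_iff_halts_within: "n \<in> jump {} \<longleftrightarrow> (\<exists>m. halts_within n m)"
  unfolding jump_iff eval_iff_evb halts_within_def empty_initial_segment ..

lemma halts_within_mono: "halts_within n m \<Longrightarrow> m \<le> m' \<Longrightarrow> halts_within n m'"
  unfolding halts_within_def using evb_mono[of m "replicate m' False"] by (simp add: min.absorb1)

locale construction = optimal +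
  fixes A D :: "nat set"
  assumes not_K_trivial: "\<not> K_trivial U A" and not_computable: "\<not> computable_set D"
begin

definition next_bound :: "nat \<Rightarrow> nat \<Rightarrow> nat" where
  "next_bound k z = 2 * level (Suc k) z + k + 3"

lemma rec_next_bound [rec_intros]:
  "rec A' k \<Longrightarrow> rec A' z \<Longrightarrow> rec A' (\<lambda>x. next_bound (k x) (z x))"
  unfolding next_bound_def by (intro rec_add rec_mult rec_level rec_Suc rec_const)

type_synonym state = "constraint list \<times> bool list \<times> nat \<times>
  constraint \<times> constraint \<times> nat \<times> nat \<times> bool list \<times> nat"

text \<open>At stage \<open>n\<close> the constraint \<open>c1\<close> decides \<open>n \<in> jump R\<close> and \<open>c2\<close> prevents the \<open>n\<close>-th program from
  computing \<open>D\<close> from \<open>R\<close>. The number \<open>z1\<close> is made large enough to decide \<open>n \<in> jump {}\<close> and to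
  bound the code of the current constraints, as \<open>hit_bound\<close> requires.\<close>

definition step :: "nat \<Rightarrow> state \<Rightarrow> state \<Rightarrow> bool" where
  "step n u u' \<longleftrightarrow> (case u of (C, s, k, _) \<Rightarrow> case u' of (C', s', k', c1, c2, m1, z1, t1, z2) \<Rightarrow>
     C' = c2 # c1 # C
     \<and> c1 = (fst c1, Comp Zero (dec n), n, 0, snd (snd (snd (snd c1))))
     \<and> c2 = (False, dec n, fst (snd (snd c2)), of_bool (fst (snd (snd c2)) \<in> D), 0)
     \<and> big (cond C' s) (k + 3)
     \<and> enc C' \<le> m1 \<and> (n \<in> jump {} \<longrightarrow> halts_within n m1)
     \<and> code_step A C' s (k + 3) m1 z1 t1
     \<and> code_step A C' t1 (next_bound (k + 3) z1)
         (if n \<in> D then Suc (hit_bound A t1 (next_bound (k + 3) z1) z1) else 0) z2 s'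
     \<and> k' = next_bound (next_bound (k + 3) z1) z2)"

lemma rec_step:
  assumes A: "A \<le>\<^sub>T B" and D: "D \<le>\<^sub>T B" and J: "jump {} \<le>\<^sub>T B"
    and n: "rec B n" and u: "rec B u" and v: "rec B v"
  shows "rec B (\<lambda>x. step (n x) (u x) (v x))"
proof -
  have "rec B (\<lambda>z. step (fst z) (fst (snd z)) (snd (snd z)))"
    unfolding step_def
    by (intro rec_intros rec_mem[OF D] rec_mem[OF J] rec_big_cond[OF J] rec_code_step[OF A J]
        rec_hit_bound[OF not_K_trivial A J])
  from rec_comp[OF this rec_pair[OF n rec_pair[OF u v]]] show ?thesis by simp
qed

text \<open>The next stem is longer than the margin, so the bound on the length makes it a proper
  extension.\<close>

definition good :: "state \<Rightarrow> bool" where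
  "good u \<longleftrightarrow> (case u of (C, s, k, _) \<Rightarrow> big (cond C s) k \<and> length s \<le> k)"

lemma step_exists: assumes "good u" shows "\<exists>u'. step n u u'"
proof -
  obtain C s k w where u: "u = (C, s, k, w)" by (cases u)
  have big: "big (cond C s) k" using assms by (simp add: good_def u)
  have cond_Cons: "(\<lambda>r. cond C s r \<and> sat c r) = cond (c # C) s" for c C
    by (auto simp: cond_def fun_eq_iff)
  obtain b N where 1: "big (cond ((b, Comp Zero (dec n), n, 0, N) # C) s) (Suc k)"
    using force_computation[OF tree_cond big] unfolding cond_Cons by blast
  define c1 :: constraint where "c1 = (b, Comp Zero (dec n), n, 0, N)"
  have "rec {} (cond (c1 # C) s)" by (intro rec_cond rec_const rec_id)
  then obtain x where 2: "big (cond ((False, dec n, x, of_bool (x \<in> D), 0) # c1 # C) s) (Suc k + 2)"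
    using force_difference[OF _ tree_cond 1[folded c1_def] not_computable] unfolding cond_Cons by blast
  define c2 :: constraint where "c2 = (False, dec n, x, of_bool (x \<in> D), 0)"
  define C' where "C' = c2 # c1 # C"
  \<comment> \<open>The constraint for the jump costs one in the exponent and the one for
    \<open>D\<close> costs two.\<close>
  have 3: "big (cond C' s) (k + 3)" using 2 unfolding C'_def c2_def by (simp add: numeral_3_eq_3)
  obtain m where m: "n \<in> jump {} \<longrightarrow> halts_within n m" using jump_iff_halts_within by blast
  define m1 where "m1 = max m (enc C')"
  have m1: "n \<in> jump {} \<longrightarrow> halts_within n m1" "enc C' \<le> m1"
    using m halts_within_mono by (auto simp: m1_def)
  obtain z1 t1 where 4: "code_step A C' s (k + 3) m1 z1 t1" using code_step_exists[OF 3 not_K_trivial] by blast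
  then have "big (cond C' t1) (next_bound (k + 3) z1)" unfolding code_step_def next_bound_def by blast
  from code_step_exists[OF this not_K_trivial] obtain z2 s'
    where 5: "code_step A C' t1 (next_bound (k + 3) z1)
         (if n \<in> D then Suc (hit_bound A t1 (next_bound (k + 3) z1) z1) else 0) z2 s'" by blast
  have "step n u (C', s', next_bound (next_bound (k + 3) z1) z2, c1, c2, m1, z1, t1, z2)"
    unfolding step_def u using 3 m1 4 5 by (simp add: c1_def c2_def C'_def)
  then show ?thesis by blast
qed

lemma step_good: assumes "step n u u'" shows "good u'"
proof -
  obtain C s k w where u: "u = (C, s, k, w)" by (cases u)
  obtain C' s' k' c1 c2 m1 z1 t1 z2 where u': "u' = (C', s', k', c1, c2, m1, z1, t1, z2)" by (metis surj_pair)
  define k1 where "k1 = next_bound (k + 3) z1"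
  have *: "code_step A C' t1 k1 (if n \<in> D then Suc (hit_bound A t1 k1 z1) else 0) z2 s'" "k' = next_bound k1 z2"
    using assms unfolding u u' step_def k1_def by auto
  then have "big (cond C' s') k'" "length s' = level (Suc k1) z2"
    unfolding code_step_def next_bound_def by blast+
  with * show ?thesis by (simp add: good_def u' next_bound_def)
qed

text \<open>The successor of least code is the only solution of a relation decidable from
  \<open>A\<close>, \<open>D\<close> and \<open>jump {}\<close>, which makes the whole sequence
  computable from them. The initial margin 1 is the measure bound of
  \<open>random_tree\<close>.\<close>

definition state :: "nat \<Rightarrow> state" where
  "state = rec_nat ([], [], 1, undefined) (\<lambda>n u. ARG_MIN enc u'. step n u u')"

lemma good_state: "good (state n)"
proof (induction n)
  case 0
  have "cond [] [] = random_tree" by (auto simp: cond_def fun_eq_iff)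
  then show ?case using big_random_tree by (simp add: state_def good_def)
next
  case (Suc n)
  then have "step n (state n) (ARG_MIN enc u'. step n (state n) u')"
    using step_exists arg_min_natI by metis
  then show ?case using step_good unfolding state_def by simp
qed

lemma step_state: "step n (state n) (state (Suc n))"
  using step_exists[OF good_state[of n], of n] arg_min_natI[of "step n (state n)" _ enc]
  unfolding state_def by auto

lemma state_minimal: "step n (state n) u \<Longrightarrow> enc (state (Suc n)) \<le> enc u"
  using arg_min_nat_le[of "step n (state n)" u enc] unfolding state_def by simp

lemma rec_state:
  assumes A: "A \<le>\<^sub>T B" and D: "D \<le>\<^sub>T B" and J: "jump {} \<le>\<^sub>T B"
  shows "rec B state"
\<comment> \<open>A smaller number that is not a code might decode to \<open>u'\<close> itself, so
  the minimality test skips such numbers.\<close>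
proof (rule rec_sequence[where S = "\<lambda>n u u'. step n u u' \<and> (\<forall>c<enc u'. enc (dec c :: state) = c \<longrightarrow> \<not> step n u (dec c))"])
  show "rec B (\<lambda>z. step (fst z) (fst (snd z)) (snd (snd z)) \<and>
      (\<forall>c<enc (snd (snd z)). enc (dec c :: state) = c \<longrightarrow> \<not> step (fst z) (fst (snd z)) (dec c)))"
    by (intro rec_intros rec_step[OF A D J])
  show "step n (state n) (state (Suc n)) \<and>
      (\<forall>c<enc (state (Suc n)). enc (dec c :: state) = c \<longrightarrow> \<not> step n (state n) (dec c))" for n
    using step_state state_minimal by (metis not_less)
  show "u = state (Suc n)"
    if "step n (state n) u \<and> (\<forall>c<enc u. enc (dec c :: state) = c \<longrightarrow> \<not> step n (state n) (dec c))" for n u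
  proof -
    have "enc (state (Suc n)) \<le> enc u" using that state_minimal by blast
    moreover have "\<not> enc (state (Suc n)) < enc u" using that step_state by (metis dec_enc)
    ultimately have "enc (state (Suc n)) = enc u" by simp
    then show ?thesis by simp
  qed
qed

section \<open>The components of the construction and the set \<open>R\<close>\<close>

definition constraints :: "nat \<Rightarrow> constraint list" where "constraints n = fst (state n)"
definition stem :: "nat \<Rightarrow> bool list" where "stem n = fst (snd (state n))"
definition margin :: "nat \<Rightarrow> nat" where "margin n = fst (snd (snd (state n)))"
definition code1 :: "nat \<Rightarrow> nat" where "code1 n = fst (snd (snd (snd (snd (snd (snd (state (Suc n))))))))"
definition stem1 :: "nat \<Rightarrow> bool list" where "stem1 n = fst (snd (snd (snd (snd (snd (snd (snd (state (Suc n)))))))))"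
definition code2 :: "nat \<Rightarrow> nat" where "code2 n = snd (snd (snd (snd (snd (snd (snd (snd (state (Suc n)))))))))"
definition margin1 :: "nat \<Rightarrow> nat" where "margin1 n = next_bound (margin n + 3) (code1 n)"

lemma margin_Suc: "margin (Suc n) = next_bound (margin1 n) (code2 n)"
  using step_state[of n] unfolding step_def margin_def margin1_def code1_def code2_def by (auto split: prod.splits)

lemma big_cond: "big (cond (constraints n) (stem n)) (margin n)" and length_stem_le: "length (stem n) \<le> margin n"
  using good_state[of n] unfolding good_def constraints_def stem_def margin_def by (auto split: prod.splits)

lemma constraints_Suc:
  "\<exists>b N x. constraints (Suc n) = (False, dec n, x, of_bool (x \<in> D), 0) # (b, Comp Zero (dec n), n, 0, N) # constraints n
    \<and> fst (fst (snd (snd (snd (state (Suc n)))))) = b"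
  using step_state[of n] unfolding step_def constraints_def by (force split: prod.splits)

lemma code_step_1:
  "\<exists>m. enc (constraints (Suc n)) \<le> m \<and> (n \<in> jump {} \<longrightarrow> halts_within n m) \<and>
     code_step A (constraints (Suc n)) (stem n) (margin n + 3) m (code1 n) (stem1 n)"
  using step_state[of n] unfolding step_def constraints_def stem_def margin_def code1_def stem1_def by (auto split: prod.splits)

lemma code_step_2:
  "code_step A (constraints (Suc n)) (stem1 n) (margin1 n) (if n \<in> D then Suc (hit_bound A (stem1 n) (margin1 n) (code1 n)) else 0)
     (code2 n) (stem (Suc n))"
  using step_state[of n] unfolding step_def constraints_def stem_def margin_def code1_def stem1_def code2_def margin1_def
  by (auto split: prod.splits)

lemma stem1_extends: "take (length (stem n)) (stem1 n) = stem n" "length (stem n) < length (stem1 n)"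
  "length (stem1 n) = level (Suc (margin n + 3)) (code1 n)"
proof -
  have *: "length (stem1 n) = level (Suc (margin n + 3)) (code1 n)" "cone (stem n) (stem1 n)"
    using code_step_1[of n] unfolding code_step_def by blast+
  show "length (stem1 n) = level (Suc (margin n + 3)) (code1 n)" by (rule *)
  show l: "length (stem n) < length (stem1 n)"
    using less_level[of "Suc (margin n + 3)" "code1 n"] length_stem_le[of n] * by linarith
  show "take (length (stem n)) (stem1 n) = stem n" using *(2) l by (simp add: cone_def)
qed

lemma stem_Suc_extends: "take (length (stem1 n)) (stem (Suc n)) = stem1 n" "length (stem1 n) < length (stem (Suc n))"
  "length (stem (Suc n)) = level (Suc (margin1 n)) (code2 n)"
proof -
  have *: "length (stem (Suc n)) = level (Suc (margin1 n)) (code2 n)" "cone (stem1 n) (stem (Suc n))"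
    using code_step_2[of n] unfolding code_step_def by blast+
  show "length (stem (Suc n)) = level (Suc (margin1 n)) (code2 n)" by (rule *)
  have "length (stem1 n) \<le> margin1 n" unfolding margin1_def next_bound_def stem1_extends(3) by simp
  then show l: "length (stem1 n) < length (stem (Suc n))"
    using less_level[of "Suc (margin1 n)" "code2 n"] * by linarith
  show "take (length (stem1 n)) (stem (Suc n)) = stem1 n" using *(2) l by (simp add: cone_def)
qed

lemma stem_step: "take (length (stem n)) (stem (Suc n)) = stem n" "length (stem n) < length (stem (Suc n))"
proof -
  have "take (length (stem n)) (take (length (stem1 n)) (stem (Suc n))) = stem n"
    unfolding stem_Suc_extends(1) stem1_extends(1) ..
  then show "take (length (stem n)) (stem (Suc n)) = stem n" using stem1_extends(2)[of n] by (simp add: min.absorb1)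
  show "length (stem n) < length (stem (Suc n))" using stem1_extends(2) stem_Suc_extends(2) by (rule less_trans)
qed

lemma stem_mono: "n \<le> m \<Longrightarrow> take (length (stem n)) (stem m) = stem n \<and> length (stem n) \<le> length (stem m)"
proof (induction m rule: dec_induct)
  case (step m)
  have "take (length (stem n)) (take (length (stem m)) (stem (Suc m))) = stem n" using stem_step(1)[of m] step by simp
  then show ?case using step stem_step(2)[of m] by (simp add: min.absorb1)
qed simp

lemma le_length_stem: "n \<le> length (stem n)"
  by (induction n) (use stem_step(2) in \<open>auto simp: Suc_le_eq intro: le_less_trans\<close>)

definition R :: "nat set" where
  "R = {i. bit_at (stem (Suc i)) i}"

lemma R_stem: "R \<restriction> length (stem n) = stem n"
proof (rule nth_equalityI)
  fix i assume "i < length (R \<restriction> length (stem n))"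
  then have i: "i < length (stem n)" by simp
  have i': "i < length (stem (Suc i))" using le_length_stem[of "Suc i"] by simp
  have "stem (Suc i) ! i = stem n ! i"
  proof (cases "Suc i \<le> n")
    case True
    then show ?thesis using stem_mono[OF True] i' by (metis nth_take)
  next
    case False
    then show ?thesis using stem_mono[of n "Suc i"] i by (metis nat_le_linear nth_take)
  qed
  then show "(R \<restriction> length (stem n)) ! i = stem n ! i" using i i' by (simp add: R_def bit_at_def)
qed simp

lemma R_stem1: "R \<restriction> length (stem1 n) = stem1 n"
proof -
  have "R \<restriction> length (stem1 n) = take (length (stem1 n)) (R \<restriction> length (stem (Suc n)))"
    using stem_Suc_extends(2)[of n] by (simp add: min.absorb1)
  then show ?thesis unfolding R_stem stem_Suc_extends(1) .
qed

text \<open>Positive density at the level of the stem yields a string there, and the stem is the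
  only string of its length in its own cone.\<close>

lemma cond_stem: "cond (constraints n) (stem n) (stem n)"
proof -
  have "0 < mu (cond (constraints n) (stem n)) (length (stem n))"
    using big_cond[of n] unfolding big_iff_mu by (meson less_le_trans zero_less_power zero_less_divide_1_iff zero_less_numeral)
  then obtain r where "length r = length (stem n)" "cond (constraints n) (stem n) r" using mu_posD by blast
  moreover from this have "r = stem n" by (simp add: cond_def cone_def)
  ultimately show ?thesis by simp
qed

lemma constraints_mono: "n \<le> m \<Longrightarrow> set (constraints n) \<subseteq> set (constraints m)"
proof (induction m rule: dec_induct)
  case (step m)
  then show ?case using constraints_Suc[of m] by auto
qed simp

text \<open>Every initial segment of \<open>R\<close> is a prefix of a late stem, and stems satisfy
  their constraints, which pass to prefixes.\<close>

lemma R_cond: "random_tree (R \<restriction> m)" "c \<in> set (constraints n) \<Longrightarrow> sat c (R \<restriction> m)"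
proof -
  define N where "N = max n m"
  have "m \<le> length (stem N)" using le_length_stem[of N] by (simp add: N_def)
  then have m: "R \<restriction> m = take m (stem N)" using R_stem[of N] by (metis min.absorb1 take_initial_segment)
  then show "random_tree (R \<restriction> m)"
    using cond_stem[of N] tree_random_tree by (simp add: cond_def treeD)
  show "sat c (R \<restriction> m)" if "c \<in> set (constraints n)"
  proof -
    have "c \<in> set (constraints N)" using constraints_mono[of n N] that by (auto simp: N_def)
    then have "sat c (stem N)" using cond_stem[of N] unfolding cond_def by blast
    then show ?thesis unfolding m by (rule sat_take)
  qed
qed

lemma R_random: "martin_loef_random U R"
  by (rule random_tree_path) (rule R_cond)

lemma R_not_above_D: "\<not> D \<le>\<^sub>T R"
proof
  assume "D \<le>\<^sub>T R"
  then obtain p where p: "\<And>x. eval R p x (of_bool (x \<in> D))" unfolding turing_le_def by blast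
  obtain b N x where "constraints (Suc (enc p)) =
      (False, dec (enc p), x, of_bool (x \<in> D), 0) # (b, Comp Zero (dec (enc p)), enc p, 0, N) # constraints (enc p)"
    using constraints_Suc[of "enc p"] by blast
  then have "(False, p, x, of_bool (x \<in> D), 0) \<in> set (constraints (Suc (enc p)))" by simp
  then have "sat (False, p, x, of_bool (x \<in> D), 0) (R \<restriction> m)" for m using R_cond(2) by simp
  then have "\<not> eval R p x (of_bool (x \<in> D))" unfolding eval_iff_evb by (simp add: sat_def)
  with p show False by blast
qed

lemma jump_R_iff: "n \<in> jump R \<longleftrightarrow> fst (fst (snd (snd (snd (state (Suc n))))))"
proof -
  obtain b N x where C: "constraints (Suc n) = (False, dec n, x, of_bool (x \<in> D), 0) # (b, Comp Zero (dec n), n, 0, N) # constraints n"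
    and b: "fst (fst (snd (snd (snd (state (Suc n)))))) = b"
    using constraints_Suc[of n] by blast
  have c: "(b, Comp Zero (dec n), n, 0, N) \<in> set (constraints (Suc n))" unfolding C by simp
  have s: "sat (b, Comp Zero (dec n), n, 0, N) (R \<restriction> m)" for m using R_cond(2)[OF c] .
  show ?thesis
  proof (cases b)
    case True
    then have "evb (R \<restriction> N) (Comp Zero (dec n)) n 0" using s[of N] by (simp add: sat_def)
    then show ?thesis using True b unfolding jump_iff eval_iff_evb by blast
  next
    case False
    then have "\<not> evb (R \<restriction> m) (Comp Zero (dec n)) n 0" for m using s[of m] by (simp add: sat_def)
    then show ?thesis using False b unfolding jump_iff eval_iff_evb by blast
  qed
qed

section \<open>Reductions in both directions\<close>

lemma upper_bounds:
  assumes "A \<le>\<^sub>T B" and "D \<le>\<^sub>T B" and "jump {} \<le>\<^sub>T B"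
  shows "R \<le>\<^sub>T B" and "jump R \<le>\<^sub>T B"
proof -
  note st = rec_state[OF assms]
  show "R \<le>\<^sub>T B"
    unfolding turing_le_iff_rec R_def stem_def mem_Collect_eq
    by (intro rec_intros rec_comp[OF st])
  show "jump R \<le>\<^sub>T B"
    unfolding turing_le_iff_rec jump_R_iff
    by (intro rec_intros rec_comp[OF st])
qed

text \<open>The part of a state that can be recovered from \<open>A\<close> and \<open>R\<close>;
  the constraints and the lower bound \<open>m1\<close> are left out.\<close>

definition trace :: "nat \<Rightarrow> bool list \<times> nat \<times> nat \<times> bool list \<times> nat" where
  "trace n = (case state n of (C, s, k, c1, c2, m1, z1, t1, z2) \<Rightarrow> (s, k, z1, t1, z2))"

lemma trace_Suc: "trace (Suc n) = (stem (Suc n), margin (Suc n), code1 n, stem1 n, code2 n)"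
  unfolding trace_def stem_def margin_def code1_def stem1_def code2_def by (simp split: prod.splits)

lemma fst_trace: "fst (trace n) = stem n" "fst (snd (trace n)) = margin n"
  unfolding trace_def stem_def margin_def by (simp_all split: prod.splits)

text \<open>Each index determines the margin with which the next one has to be read, so both indices
  of a stage are found by searching for first blocks containing \<open>R\<close>.\<close>

lemma rec_trace:
  assumes A: "A \<le>\<^sub>T B" and R: "R \<le>\<^sub>T B" shows "rec B trace"
proof -
  define S where "S = (\<lambda>(n::nat) (v :: bool list \<times> nat \<times> nat \<times> bool list \<times> nat) v'.
    case v' of (s', k', z1, t1, z2) \<Rightarrow> let k = fst (snd v) in
    first_hit A R (k + 3) z1 t1 \<and> first_hit A R (next_bound (k + 3) z1) z2 s' \<and>
    k' = next_bound (next_bound (k + 3) z1) z2)"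
  have S: "S n (trace n) (trace (Suc n))" for n
  proof -
    have "first_hit A R (margin n + 3) (code1 n) (stem1 n)"
      using code_step_1[of n] code_step_first_hit R_stem1[of n] stem1_extends(3)[of n] by metis
    moreover have "first_hit A R (margin1 n) (code2 n) (stem (Suc n))"
      using code_step_first_hit[OF code_step_2[of n]] R_stem[of "Suc n"] stem_Suc_extends(3)[of n] by metis
    ultimately show ?thesis
      unfolding S_def trace_Suc by (simp add: fst_trace margin_Suc margin1_def)
  qed
  show ?thesis
  proof (rule rec_sequence[where S = S])
    show "rec B (\<lambda>z. S (fst z) (fst (snd z)) (snd (snd z)))"
      unfolding S_def by (intro rec_intros rec_first_hit[OF A R])
    show "v = trace (Suc n)" if "S n (trace n) v" for n v
    proof -
      obtain s' k' y1 r1 y2 where v: "v = (s', k', y1, r1, y2)" by (cases v)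
      have a: "first_hit A R (margin n + 3) y1 r1" "first_hit A R (next_bound (margin n + 3) y1) y2 s'"
          "k' = next_bound (next_bound (margin n + 3) y1) y2"
        using that unfolding S_def v by (simp_all add: fst_trace Let_def)
      have b: "first_hit A R (margin n + 3) (code1 n) (stem1 n)" "first_hit A R (next_bound (margin n + 3) (code1 n)) (code2 n) (stem (Suc n))"
        using S[of n] unfolding S_def trace_Suc by (simp_all add: fst_trace Let_def)
      have "y1 = code1 n \<and> r1 = stem1 n" using first_hit_unique[OF a(1) b(1)] .
      moreover from this have "y2 = code2 n \<and> s' = stem (Suc n)" using first_hit_unique a(2) b(2) by blast
      ultimately show ?thesis unfolding v trace_Suc using a(3) by (simp add: margin_Suc margin1_def)
    qed
  qed (rule S)
qed

lemma jump_empty_decoded: "n \<in> jump {} \<longleftrightarrow> halts_within n (code1 n)"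
proof -
  obtain m where "n \<in> jump {} \<longrightarrow> halts_within n m" "m \<le> code1 n"
    using code_step_1[of n] unfolding code_step_def by blast
  then show ?thesis using halts_within_mono jump_iff_halts_within by blast
qed

text \<open>If \<open>n\<close> is in \<open>D\<close>, the second index was forced above the
  threshold. Otherwise it is the least unforced hit for a list whose code is at most
  \<open>code1 n\<close>, and the threshold covers this list.\<close>

lemma D_decoded: "n \<in> D \<longleftrightarrow> \<not> code2 n \<le> hit_bound A (stem1 n) (margin1 n) (code1 n)"
proof (cases "n \<in> D")
  case True
  then show ?thesis using code_step_2[of n] unfolding code_step_def by simp
next
  case False
  then have step: "code_step A (constraints (Suc n)) (stem1 n) (margin1 n) 0 (code2 n) (stem (Suc n))" using code_step_2[of n] by simp
  obtain m where m: "enc (constraints (Suc n)) \<le> m" "code_step A (constraints (Suc n)) (stem n) (margin n + 3) m (code1 n) (stem1 n)"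
    using code_step_1[of n] by blast
  then have "big (cond (constraints (Suc n)) (stem1 n)) (margin1 n)" "enc (constraints (Suc n)) \<le> code1 n"
    unfolding code_step_def margin1_def next_bound_def by auto
  from code_step_le_hit_bound[OF not_K_trivial step this] show ?thesis using False by simp
qed

text \<open>The order matters: the halting problem is read off the first indices alone and then
  serves to compute the thresholds for \<open>D\<close>.\<close>

lemma lower_bounds:
  assumes A: "A \<le>\<^sub>T B" and R: "R \<le>\<^sub>T B"
  shows "jump {} \<le>\<^sub>T B" and "D \<le>\<^sub>T B"
proof -
  note tr = rec_trace[OF A R]
  have eqs: "code1 n = fst (snd (snd (trace (Suc n))))" "stem1 n = fst (snd (snd (snd (trace (Suc n)))))"
    "code2 n = snd (snd (snd (snd (trace (Suc n)))))" for n
    by (simp_all add: trace_Suc)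
  have z1: "rec B code1" and t1: "rec B stem1" and z2: "rec B code2"
    unfolding eqs[abs_def] by (intro rec_intros rec_comp[OF tr])+
  show J: "jump {} \<le>\<^sub>T B"
    unfolding turing_le_iff_rec jump_empty_decoded by (intro rec_intros z1)
  have margin1: "rec B margin1"
    unfolding margin1_def[abs_def] fst_trace(2)[symmetric] by (intro rec_intros rec_comp[OF tr] z1)
  show "D \<le>\<^sub>T B"
    unfolding turing_le_iff_rec D_decoded
    by (intro rec_not rec_le rec_hit_bound[OF not_K_trivial A J] z1 t1 z2 margin1)
qed

end

theorem theorem3p7:
  fixes U :: "bool list \<rightharpoonup> bool list" and A D :: "nat set"
  assumes "optimal_machine U"
    and "\<not> K_trivial U A"
    and "\<not> computable_set D"
  shows "\<exists>R. martin_loef_random U R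
           \<and> A \<oplus> R \<equiv>\<^sub>T A \<oplus> D \<oplus> jump {}
           \<and> \<not> D \<le>\<^sub>T R
           \<and> jump R \<le>\<^sub>T A \<oplus> R"
proof -
  interpret construction U A D
    by unfold_locales (use assms in auto)
  have AR: "A \<le>\<^sub>T A \<oplus> R" "R \<le>\<^sub>T A \<oplus> R"
    using join_turing_le_iff turing_le_refl by blast+
  then have lower: "jump {} \<le>\<^sub>T A \<oplus> R" "D \<le>\<^sub>T A \<oplus> R" by (rule lower_bounds)+
  have up: "A \<le>\<^sub>T A \<oplus> D \<oplus> jump {}" "D \<le>\<^sub>T A \<oplus> D \<oplus> jump {}" "jump {} \<le>\<^sub>T A \<oplus> D \<oplus> jump {}"
    using join_turing_le_iff turing_le_refl by blast+
  have "A \<oplus> R \<equiv>\<^sub>T A \<oplus> D \<oplus> jump {}"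
    unfolding turing_equiv_def join_turing_le_iff using AR lower up upper_bounds(1)[OF up] by blast
  moreover have "jump R \<le>\<^sub>T A \<oplus> R" using upper_bounds(2) AR lower by blast
  ultimately show ?thesis using R_random R_not_above_D by blast
qed

end
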